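(* Let $M$ be a transitive model of ZFC in which $\kappa<\lambda$ are regular uncountable cardinals. Suppose there are sequences $\langle M_i: i<\lambda\rangle$, $\langle\mathcal U_i: i<\lambda\rangle$, $\langle k_i:i<\lambda\rangle$, with $\langle\mathcal U_i:i<\lambda\rangle,\langle k_i:i<\lambda\rangle\in M$, where each $M_i\subseteq M$ is a transitive model of ZFC, such that: (1) if $i<j$ then $M_i\subseteq M_j$; (2) $\mathcal U_i\in M_i$ and $M_i\models$ "$\mathcal U_i$ is a normal ultrafilter on $\kappa$"; (3) $k_i\in[\kappa]^\kappa$ and $k_i\subseteq^* X$ for every $X\in\mathcal U_i$; moreover $k_j\in M_i$ for all $j<i$; (4) $P(\kappa)^M=\bigcup_{i<\lambda}P(\kappa)^{M_i}$; (5) there is an unbounded $S\subseteq\lambda$ such that $\mathcal U_i\subseteq\mathcal U_j$ for all $i<j$ in $S$. Then in $M$ there is a normal ultrafilter $\mathcal U$ on $\kappa$ which is a simple $\pi P_\lambda$-point. In particular, $M\models \pi\mathfrak u^{com}_\kappa=\lambda$.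
   Context: $A\subseteq^*B$ means $A\setminus\alpha\subseteq B$ for some $\alpha<\kappa$. For a uniform ultrafilter $U$ on $\kappa$: a $\pi$-base is a family $\mathcal B\subseteq[\kappa]^\kappa$ such that every $A\in U$ has some $B\in\mathcal B$ with $B\subseteq^*A$; $\pi\mathfrak{ch}(U)$ is the least size of a $\pi$-base. $U$ is a $\pi P_\mu$-point if every $\mathcal A\subseteq U$ with $|\mathcal A|<\mu$ has a pseudo-intersection (some $B\in[\kappa]^\kappa$ with $B\subseteq^*A$ for all $A\in\mathcal A$); $\pi\mathfrak p(U)=\min\{\mu:U$ is not a $\pi P_{\mu^+}$-point$\}$; $U$ is a simple $\pi P_\lambda$-point if $\pi\mathfrak p(U)=\lambda=\pi\mathfrak{ch}(U)$. $\pi\mathfrak u^{com}_\kappa=\min\{\pi\mathfrak{ch}(U):U$ a $\kappa$-complete uniform ultrafilter on $\kappa\}$.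
   Formalization: In (5) the unbounded set S is required to belong to M; if S may lie outside M, the union of the ultrafilters along S need not be in M and the claim can fail (κ need not even be measurable in M). *)

theory Defs
  imports Main
begin

text \<open>
  The universe of sets is a type \<open>'v\<close> with a membership relation; a model is a subclass
  \<open>M\<close> of it. Formulas of the language of set theory are needed only for the two axiom schemes;
  they have named variables. Every other notion is the relativisation to \<open>M\<close> of its usual
  set-theoretic definition: all quantifiers range over \<open>M\<close>.
\<close>

datatype fm =
    Mem nat nat
  | Eq nat nat
  | Neg fm
  | Conj fm fm
  | All nat fm

locale eps_structure =
  fixes elem :: "'v \<Rightarrow> 'v \<Rightarrow> bool"  (infix "\<epsilon>" 50)
    and M :: "'v set"
begin

primrec sat :: "fm \<Rightarrow> (nat \<Rightarrow> 'v) \<Rightarrow> bool" where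
  "sat (Mem i j) env \<longleftrightarrow> env i \<epsilon> env j"
| "sat (Eq i j) env \<longleftrightarrow> env i = env j"
| "sat (Neg p) env \<longleftrightarrow> \<not> sat p env"
| "sat (Conj p q) env \<longleftrightarrow> sat p env \<and> sat q env"
| "sat (All i p) env \<longleftrightarrow> (\<forall>x\<in>M. sat p (env(i := x)))"

definition elts :: "'v \<Rightarrow> 'v set" where
  "elts x = {z \<in> M. z \<epsilon> x}"


subsection \<open>ZFC\<close>

definition extensionality :: bool where
  "extensionality \<longleftrightarrow> (\<forall>x\<in>M. \<forall>y\<in>M. elts x = elts y \<longrightarrow> x = y)"

definition foundation :: bool where
  "foundation \<longleftrightarrow> (\<forall>x\<in>M. elts x \<noteq> {} \<longrightarrow> (\<exists>y\<in>elts x. elts x \<inter> elts y = {}))"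

definition pairing :: bool where
  "pairing \<longleftrightarrow> (\<forall>x\<in>M. \<forall>y\<in>M. \<exists>p\<in>M. elts p = {x, y})"

definition union :: bool where
  "union \<longleftrightarrow> (\<forall>x\<in>M. \<exists>u\<in>M. elts u = (\<Union>y\<in>elts x. elts y))"

definition power_set :: bool where
  "power_set \<longleftrightarrow> (\<forall>x\<in>M. \<exists>p\<in>M. elts p = {y \<in> M. elts y \<subseteq> elts x})"

definition infinity :: bool where
  "infinity \<longleftrightarrow> (\<exists>w\<in>M. (\<exists>e\<in>elts w. elts e = {}) \<and>
      (\<forall>x\<in>elts w. \<exists>y\<in>elts w. elts y = insert x (elts x)))"

text \<open>In the schemes, the values of \<open>env\<close> at the remaining variables are the parameters.\<close>

definition separation :: bool where
  "separation \<longleftrightarrow> (\<forall>\<phi> env. range env \<subseteq> M \<longrightarrow>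
      (\<forall>a\<in>M. \<exists>b\<in>M. elts b = {x \<in> elts a. sat \<phi> (env(0 := x))}))"

definition replacement :: bool where
  "replacement \<longleftrightarrow> (\<forall>\<phi> env. range env \<subseteq> M \<longrightarrow>
      (\<forall>a\<in>M.
        (\<forall>x\<in>elts a. \<forall>y\<in>M. \<forall>y'\<in>M.
            sat \<phi> (env(0 := x, 1 := y)) \<and> sat \<phi> (env(0 := x, 1 := y')) \<longrightarrow> y = y') \<longrightarrow>
        (\<exists>b\<in>M. elts b = {y \<in> M. \<exists>x\<in>elts a. sat \<phi> (env(0 := x, 1 := y))})))"

definition choice_axiom :: bool where
  "choice_axiom \<longleftrightarrow> (\<forall>x\<in>M.
      (\<forall>y\<in>elts x. elts y \<noteq> {}) \<and>
      (\<forall>y\<in>elts x. \<forall>z\<in>elts x. y \<noteq> z \<longrightarrow> elts y \<inter> elts z = {}) \<longrightarrow>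
      (\<exists>c\<in>M. \<forall>y\<in>elts x. \<exists>!z. z \<in> elts c \<inter> elts y))"

definition ZFC :: bool where
  "ZFC \<longleftrightarrow> extensionality \<and> foundation \<and> pairing \<and> union \<and> power_set \<and> infinity \<and>
     separation \<and> replacement \<and> choice_axiom"

definition transitive_model :: bool where
  "transitive_model \<longleftrightarrow> (\<forall>x\<in>M. \<forall>y. y \<epsilon> x \<longrightarrow> y \<in> M) \<and> ZFC"


subsection \<open>Functions, ordinals and cardinals\<close>

text \<open>\<open>is_pair x y p\<close>: \<open>p\<close> is the Kuratowski pair of \<open>x\<close> and \<open>y\<close>.\<close>

definition is_pair :: "'v \<Rightarrow> 'v \<Rightarrow> 'v \<Rightarrow> bool" where
  "is_pair x y p \<longleftrightarrow> (\<exists>a\<in>M. \<exists>b\<in>M. elts a = {x} \<and> elts b = {x, y} \<and> elts p = {a, b})"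

text \<open>\<open>val f x y\<close>: \<open>f(x) = y\<close>. \<open>maps f a b\<close>: \<open>f\<close> is a function from \<open>a\<close> to \<open>b\<close>.\<close>

definition val :: "'v \<Rightarrow> 'v \<Rightarrow> 'v \<Rightarrow> bool" where
  "val f x y \<longleftrightarrow> (\<exists>p\<in>elts f. is_pair x y p)"

definition maps :: "'v \<Rightarrow> 'v \<Rightarrow> 'v \<Rightarrow> bool" where
  "maps f a b \<longleftrightarrow>
     (\<forall>p\<in>elts f. \<exists>x\<in>elts a. \<exists>y\<in>elts b. is_pair x y p) \<and>
     (\<forall>x\<in>elts a. \<exists>!y. y \<in> elts b \<and> val f x y)"

definition injection :: "'v \<Rightarrow> 'v \<Rightarrow> 'v \<Rightarrow> bool" where
  "injection f a b \<longleftrightarrow> maps f a b \<and>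
     (\<forall>x\<in>elts a. \<forall>x'\<in>elts a. \<forall>y\<in>elts b. val f x y \<and> val f x' y \<longrightarrow> x = x')"

definition bijection :: "'v \<Rightarrow> 'v \<Rightarrow> 'v \<Rightarrow> bool" where
  "bijection f a b \<longleftrightarrow> injection f a b \<and> (\<forall>y\<in>elts b. \<exists>x\<in>elts a. val f x y)"

definition ordinal :: "'v \<Rightarrow> bool" where
  "ordinal \<alpha> \<longleftrightarrow> (\<forall>x\<in>elts \<alpha>. elts x \<subseteq> elts \<alpha>) \<and>
     (\<forall>x\<in>elts \<alpha>. \<forall>y\<in>elts x. elts y \<subseteq> elts x)"

definition limit_ordinal :: "'v \<Rightarrow> bool" where
  "limit_ordinal \<alpha> \<longleftrightarrow> ordinal \<alpha> \<and> elts \<alpha> \<noteq> {} \<and> (\<forall>x\<in>elts \<alpha>. \<exists>y\<in>elts \<alpha>. x \<epsilon> y)"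

definition is_omega :: "'v \<Rightarrow> bool" where
  "is_omega w \<longleftrightarrow> limit_ordinal w \<and> (\<forall>x\<in>elts w. \<not> limit_ordinal x)"

definition uncountable :: "'v \<Rightarrow> bool" where
  "uncountable x \<longleftrightarrow> \<not> (\<exists>w\<in>M. \<exists>f\<in>M. is_omega w \<and> injection f x w)"

definition regular :: "'v \<Rightarrow> bool" where
  "regular \<kappa> \<longleftrightarrow> limit_ordinal \<kappa> \<and>
     (\<forall>\<alpha>\<in>elts \<kappa>. \<forall>f\<in>M. maps f \<alpha> \<kappa> \<longrightarrow>
        (\<exists>\<beta>\<in>elts \<kappa>. \<forall>x\<in>elts \<alpha>. \<forall>y\<in>elts \<kappa>. val f x y \<longrightarrow> y \<epsilon> \<beta>))"

definition cardinal :: "'v \<Rightarrow> bool" where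
  "cardinal \<mu> \<longleftrightarrow> ordinal \<mu> \<and> (\<forall>\<alpha>\<in>elts \<mu>. \<not> (\<exists>f\<in>M. bijection f \<alpha> \<mu>))"

text \<open>\<open>card_of x \<mu>\<close>: \<open>|x| = \<mu>\<close>. \<open>succ_card \<mu> \<nu>\<close>: \<open>\<nu> = \<mu>\<^sup>+\<close>.\<close>

definition card_of :: "'v \<Rightarrow> 'v \<Rightarrow> bool" where
  "card_of x \<mu> \<longleftrightarrow> cardinal \<mu> \<and> (\<exists>f\<in>M. bijection f x \<mu>)"

definition succ_card :: "'v \<Rightarrow> 'v \<Rightarrow> bool" where
  "succ_card \<mu> \<nu> \<longleftrightarrow> cardinal \<nu> \<and> \<mu> \<epsilon> \<nu> \<and>
     (\<forall>\<rho>\<in>elts \<nu>. cardinal \<rho> \<longrightarrow> \<rho> = \<mu> \<or> \<rho> \<epsilon> \<mu>)"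

definition is_min :: "('v \<Rightarrow> bool) \<Rightarrow> 'v \<Rightarrow> bool" where
  "is_min P \<mu> \<longleftrightarrow> \<mu> \<in> M \<and> ordinal \<mu> \<and> P \<mu> \<and> (\<forall>\<nu>\<in>elts \<mu>. \<not> P \<nu>)"

text \<open>The sequence \<open>\<langle>s i : i < \<lambda>\<rangle>\<close> is an element of \<open>M\<close>.\<close>

definition sequence_in :: "'v \<Rightarrow> ('v \<Rightarrow> 'v) \<Rightarrow> bool" where
  "sequence_in lam s \<longleftrightarrow> (\<forall>i\<in>elts lam. s i \<in> M) \<and>
     (\<exists>F\<in>M. elts F = {p \<in> M. \<exists>i\<in>elts lam. is_pair i (s i) p})"


subsection \<open>Ultrafilters on \<open>\<kappa>\<close>\<close>

definition subsets :: "'v \<Rightarrow> 'v set" where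
  "subsets \<kappa> = {X \<in> M. elts X \<subseteq> elts \<kappa>}"

text \<open>\<open>[\<kappa>]\<^sup>\<kappa>\<close>\<close>

definition full_subsets :: "'v \<Rightarrow> 'v set" where
  "full_subsets \<kappa> = {X \<in> subsets \<kappa>. card_of X \<kappa>}"

text \<open>\<open>A \<subseteq>\<^sup>* B\<close>\<close>

definition almost_subset :: "'v \<Rightarrow> 'v \<Rightarrow> 'v \<Rightarrow> bool" where
  "almost_subset \<kappa> A B \<longleftrightarrow> (\<exists>\<alpha>\<in>elts \<kappa>. elts A - elts \<alpha> \<subseteq> elts B)"

definition ultrafilter :: "'v \<Rightarrow> 'v \<Rightarrow> bool" where
  "ultrafilter \<kappa> U \<longleftrightarrow>
     elts U \<subseteq> subsets \<kappa> \<and> \<kappa> \<in> elts U \<and>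
     (\<forall>X\<in>elts U. elts X \<noteq> {}) \<and>
     (\<forall>X\<in>elts U. \<forall>Y\<in>subsets \<kappa>. elts X \<subseteq> elts Y \<longrightarrow> Y \<in> elts U) \<and>
     (\<forall>X\<in>elts U. \<forall>Y\<in>elts U. \<exists>Z\<in>elts U. elts Z = elts X \<inter> elts Y) \<and>
     (\<forall>X\<in>subsets \<kappa>. X \<in> elts U \<or> (\<exists>Y\<in>elts U. elts Y = elts \<kappa> - elts X))"

definition uniform_ultrafilter :: "'v \<Rightarrow> 'v \<Rightarrow> bool" where
  "uniform_ultrafilter \<kappa> U \<longleftrightarrow> ultrafilter \<kappa> U \<and> elts U \<subseteq> full_subsets \<kappa>"

text \<open>\<open>\<kappa>\<close>-completeness: closure under intersections of fewer than \<open>\<kappa>\<close> sets.\<close>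

definition complete_ultrafilter :: "'v \<Rightarrow> 'v \<Rightarrow> bool" where
  "complete_ultrafilter \<kappa> U \<longleftrightarrow> ultrafilter \<kappa> U \<and>
     (\<forall>\<alpha>\<in>elts \<kappa>. \<forall>f\<in>M. maps f \<alpha> U \<longrightarrow>
        (\<exists>Y\<in>elts U. elts Y =
           {x \<in> elts \<kappa>. \<forall>\<xi>\<in>elts \<alpha>. \<forall>X\<in>elts U. val f \<xi> X \<longrightarrow> x \<epsilon> X}))"

text \<open>A normal ultrafilter is moreover closed under diagonal intersections.\<close>

definition normal_ultrafilter :: "'v \<Rightarrow> 'v \<Rightarrow> bool" where
  "normal_ultrafilter \<kappa> U \<longleftrightarrow> uniform_ultrafilter \<kappa> U \<and> complete_ultrafilter \<kappa> U \<and>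
     (\<forall>f\<in>M. maps f \<kappa> U \<longrightarrow>
        (\<exists>Y\<in>elts U. elts Y =
           {x \<in> elts \<kappa>. \<forall>\<xi>\<in>elts x. \<forall>X\<in>elts U. val f \<xi> X \<longrightarrow> x \<epsilon> X}))"

definition pi_base :: "'v \<Rightarrow> 'v \<Rightarrow> 'v \<Rightarrow> bool" where
  "pi_base \<kappa> U B \<longleftrightarrow> elts B \<subseteq> full_subsets \<kappa> \<and>
     (\<forall>A\<in>elts U. \<exists>b\<in>elts B. almost_subset \<kappa> b A)"

text \<open>\<open>pi_char \<kappa> U \<mu>\<close>: the \<open>\<pi>\<close>-character \<open>\<pi>ch(U)\<close> equals \<open>\<mu>\<close>.\<close>

definition pi_char :: "'v \<Rightarrow> 'v \<Rightarrow> 'v \<Rightarrow> bool" where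
  "pi_char \<kappa> U = is_min (\<lambda>\<mu>. \<exists>B\<in>M. pi_base \<kappa> U B \<and> card_of B \<mu>)"

definition pi_P_point :: "'v \<Rightarrow> 'v \<Rightarrow> 'v \<Rightarrow> bool" where
  "pi_P_point \<kappa> \<mu> U \<longleftrightarrow>
     (\<forall>\<A>\<in>M. elts \<A> \<subseteq> elts U \<and> (\<exists>\<nu>\<in>elts \<mu>. card_of \<A> \<nu>) \<longrightarrow>
        (\<exists>B\<in>full_subsets \<kappa>. \<forall>A\<in>elts \<A>. almost_subset \<kappa> B A))"

text \<open>\<open>pi_pseudo \<kappa> U \<mu>\<close>: \<open>\<pi>p(U)\<close> equals \<open>\<mu>\<close>.\<close>

definition pi_pseudo :: "'v \<Rightarrow> 'v \<Rightarrow> 'v \<Rightarrow> bool" where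
  "pi_pseudo \<kappa> U =
     is_min (\<lambda>\<mu>. cardinal \<mu> \<and> (\<exists>\<nu>\<in>M. succ_card \<mu> \<nu> \<and> \<not> pi_P_point \<kappa> \<nu> U))"

definition simple_pi_P_point :: "'v \<Rightarrow> 'v \<Rightarrow> 'v \<Rightarrow> bool" where
  "simple_pi_P_point \<kappa> lam U \<longleftrightarrow>
     uniform_ultrafilter \<kappa> U \<and> pi_pseudo \<kappa> U lam \<and> pi_char \<kappa> U lam"

text \<open>\<open>pi_u_com \<kappa> \<mu>\<close>: the invariant \<open>\<pi>u\<close>, restricted to \<open>\<kappa>\<close>-complete ultrafilters,
  equals \<open>\<mu>\<close>.\<close>

definition pi_u_com :: "'v \<Rightarrow> 'v \<Rightarrow> bool" where
  "pi_u_com \<kappa> =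
     is_min (\<lambda>\<mu>. \<exists>U\<in>M. uniform_ultrafilter \<kappa> U \<and> complete_ultrafilter \<kappa> U \<and> pi_char \<kappa> U \<mu>)"

end

end

theory Submission
  imports Defs
begin

text \<open>
  Let \<open>U\<close> be the union of the \<open>\<U> s\<close> for \<open>s \<in> S\<close>. It is an ultrafilter because every subset of
  \<open>\<kappa>\<close> appears in some \<open>N t\<close>. It is normal because a sequence of \<open>\<kappa>\<close> subsets of \<open>\<kappa>\<close> is coded, up to
  a set in the ultrafilter, by a single subset of \<open>\<kappa>\<close> and hence can be decoded in some \<open>N t\<close>,
  where \<open>\<U> t\<close> is normal. Fewer than \<open>lam\<close> elements of \<open>U\<close> all lie in one \<open>\<U> t\<close>, so \<open>k t\<close> is a
  pseudo-intersection.

  If \<open>B \<in> N t\<close> is unbounded, then its set of limits lies in \<open>\<U> t\<close> and so almost contains \<open>k t\<close>.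
  Hence a union of suitable intervals of \<open>k t\<close> splits every unbounded \<open>B \<in> N t\<close>. As
  fewer than \<open>lam\<close> sets lie in one \<open>N t\<close>, no ultrafilter has a \<open>\<pi>\<close>-base of size less than \<open>lam\<close>;
  and the splitting sets or their complements, for \<open>t < lam\<close>, form a subfamily of \<open>U\<close> without
  pseudo-intersection. To be available in all later models, the intervals are chosen by a
  definition from \<open>k t\<close> alone.
\<close>

section \<open>Definability with parameters\<close>

text \<open>Only the sequences of the \<open>\<U> i\<close> and of the \<open>k i\<close> are
  assumed to be elements of \<open>M\<close>, not that of the models \<open>N i\<close>. So
  \<open>M\<close> cannot speak of membership in \<open>N t\<close>. Whenever indices are chosen
  inside \<open>M\<close>, the condition is phrased through \<open>\<U> s\<close>: a subset of
  \<kappa> lies in \<open>N s\<close> exactly if it or its complement belongs to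
  \<open>\<U> s\<close>. The models share the notions that are written with bounded quantifiers:
  pairs, functions, ordinals and the splitting sets mean the same in all of them. A second obstacle
  is that the splitting set of \<open>k i\<close> needs unboundedly many elements of
  \<open>k i\<close> without an immediate predecessor. \<open>N i\<close> does not see them, since
  it does not contain \<open>k i\<close>; they come from a later measure \<open>\<U> j\<close>,
  whose model does contain \<open>k i\<close>. That \<open>k i\<close> is new over
  \<open>N i\<close> is not assumed either. It follows from the splitting, and it is what gives the
  base and the family without pseudo-intersection their exact size.\<close>

primrec fm_vars :: "fm \<Rightarrow> nat set" where
  "fm_vars (Mem i j) = {i, j}"
| "fm_vars (Eq i j) = {i, j}"
| "fm_vars (Neg p) = fm_vars p"
| "fm_vars (Conj p q) = fm_vars p \<union> fm_vars q"
| "fm_vars (All i p) = insert i (fm_vars p)"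

lemma finite_fm_vars: "finite (fm_vars p)"
  by (induction p) auto

context eps_structure
begin

lemma sat_cong: "(\<And>n. n \<in> fm_vars p \<Longrightarrow> e n = e' n) \<Longrightarrow> sat p e \<longleftrightarrow> sat p e'"
proof (induction p arbitrary: e e')
  case (Neg p)
  have "sat p e \<longleftrightarrow> sat p e'" using Neg.prems by (intro Neg.IH) simp
  then show ?case by simp
next
  case (Conj p q)
  have "sat p e \<longleftrightarrow> sat p e'" "sat q e \<longleftrightarrow> sat q e'"
    using Conj.prems by (intro Conj.IH; simp)+
  then show ?case by simp
next
  case (All i p)
  have "sat p (e(i := x)) \<longleftrightarrow> sat p (e'(i := x))" for x
    using All.prems by (intro All.IH) auto
  then show ?case by simp
qed auto

text \<open>This serves to move the variables of a formula apart when formulas are combined or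
  quantified. Variables are named, so a variable renamed by \<open>r\<close> could be captured by a
  quantifier; the bound variable therefore gets a fresh name.\<close>

lemma sat_rename: "\<exists>q. \<forall>e. sat q e \<longleftrightarrow> sat p (\<lambda>n. e (r n))"
proof (induction p arbitrary: r)
  case (Mem i j)
  then show ?case by (intro exI[of _ "Mem (r i) (r j)"]) simp
next
  case (Eq i j)
  then show ?case by (intro exI[of _ "Eq (r i) (r j)"]) simp
next
  case (Neg p)
  then show ?case by (metis sat.simps(3))
next
  case (Conj p q)
  then show ?case by (metis sat.simps(4))
next
  case (All i p)
  have "finite (r ` fm_vars p)" by (simp add: finite_fm_vars)
  then obtain j where j: "j \<notin> r ` fm_vars p"
    using ex_new_if_finite infinite_UNIV_nat by blast
  obtain q where q: "\<And>e. sat q e \<longleftrightarrow> sat p (\<lambda>n. e ((r(i := j)) n))"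
    using All.IH by blast
  have "sat p (\<lambda>n. (e(j := x)) ((r(i := j)) n)) \<longleftrightarrow> sat p ((\<lambda>n. e (r n))(i := x))" for e x
    using j by (intro sat_cong) auto
  then show ?case by (intro exI[of _ "All j q"]) (simp add: q)
qed

text \<open>Parameters are kept in the terms and not in the formula. Substitution then only composes
  terms and leaves the formula alone.\<close>

definition param :: "((nat \<Rightarrow> 'v) \<Rightarrow> 'v) \<Rightarrow> bool" where
  "param t \<longleftrightarrow> (\<exists>i. t = (\<lambda>e. e i)) \<or> (\<exists>c\<in>M. t = (\<lambda>e. c))"

text \<open>A predicate of assignments is \<open>definable\<close> if it is first-order definable over \<open>M\<close> with
  parameters; quantification turns \<open>e\<close> into the assignment with \<open>e 0\<close> in front, as with
  de Bruijn indices.\<close>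

definition definable :: "((nat \<Rightarrow> 'v) \<Rightarrow> bool) \<Rightarrow> bool" where
  "definable P \<longleftrightarrow> (\<exists>\<phi> \<sigma>. (\<forall>n. param (\<sigma> n)) \<and>
     (\<forall>e. range e \<subseteq> M \<longrightarrow> (sat \<phi> (\<lambda>n. \<sigma> n e) \<longleftrightarrow> P e)))"

lemma param_var: "param (\<lambda>e. e i)"
  and param_const: "c \<in> M \<Longrightarrow> param (\<lambda>e. c)"
  by (auto simp: param_def)

lemma param_subst: "param t \<Longrightarrow> (\<And>n. param (\<tau> n)) \<Longrightarrow> param (\<lambda>e. t (\<lambda>n. \<tau> n e))"
  by (auto simp: param_def)

lemma param_in: "param t \<Longrightarrow> range e \<subseteq> M \<Longrightarrow> t e \<in> M"
  by (auto simp: param_def)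

lemma definable_cong:
  assumes "definable P" "\<And>e. range e \<subseteq> M \<Longrightarrow> P e \<longleftrightarrow> Q e"
  shows "definable Q"
  using assms unfolding definable_def by metis

lemma definable_subst:
  assumes "definable P" and \<tau>: "\<And>n. param (\<tau> n)"
  shows "definable (\<lambda>e. P (\<lambda>n. \<tau> n e))"
proof -
  obtain \<phi> \<sigma> where \<sigma>: "\<And>n. param (\<sigma> n)"
    and \<phi>: "\<And>e. range e \<subseteq> M \<Longrightarrow> sat \<phi> (\<lambda>n. \<sigma> n e) \<longleftrightarrow> P e"
    using assms(1) unfolding definable_def by metis
  have "sat \<phi> (\<lambda>n. \<sigma> n (\<lambda>m. \<tau> m e)) \<longleftrightarrow> P (\<lambda>n. \<tau> n e)" if "range e \<subseteq> M" for e
    using \<tau> param_in that by (intro \<phi>) blast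
  then show ?thesis
    unfolding definable_def
    by (intro exI[of _ \<phi>] exI[of _ "\<lambda>n e. \<sigma> n (\<lambda>m. \<tau> m e)"]) (simp add: \<sigma> \<tau> param_subst)
qed

lemma definable_mem:
  assumes "param s" "param t" shows "definable (\<lambda>e. s e \<epsilon> t e)"
  unfolding definable_def
  by (intro exI[of _ "Mem 0 1"] exI[of _ "\<lambda>n. if n = 0 then s else t"]) (simp add: assms)

lemma definable_eq:
  assumes "param s" "param t" shows "definable (\<lambda>e. s e = t e)"
  unfolding definable_def
  by (intro exI[of _ "Eq 0 1"] exI[of _ "\<lambda>n. if n = 0 then s else t"]) (simp add: assms)

lemma definable_not: "definable P \<Longrightarrow> definable (\<lambda>e. \<not> P e)"
  unfolding definable_def by (metis sat.simps(3))

lemma definable_conj: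
  assumes "definable P" "definable Q" shows "definable (\<lambda>e. P e \<and> Q e)"
proof -
  obtain \<phi> \<sigma> where \<sigma>: "\<And>n. param (\<sigma> n)"
    and \<phi>: "\<And>e. range e \<subseteq> M \<Longrightarrow> sat \<phi> (\<lambda>n. \<sigma> n e) \<longleftrightarrow> P e"
    using assms(1) unfolding definable_def by metis
  obtain \<psi> \<tau> where \<tau>: "\<And>n. param (\<tau> n)"
    and \<psi>: "\<And>e. range e \<subseteq> M \<Longrightarrow> sat \<psi> (\<lambda>n. \<tau> n e) \<longleftrightarrow> Q e"
    using assms(2) unfolding definable_def by metis
  \<comment> \<open>The two formulas come with unrelated lists of terms. Those of \<phi> go to the
    even variables and those of \<psi> to the odd ones.\<close>
  obtain \<phi>' where \<phi>': "\<And>e. sat \<phi>' e \<longleftrightarrow> sat \<phi> (\<lambda>n. e (2 * n))" using sat_rename by metis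
  obtain \<psi>' where \<psi>': "\<And>e. sat \<psi>' e \<longleftrightarrow> sat \<psi> (\<lambda>n. e (2 * n + 1))" using sat_rename by metis
  show ?thesis
    unfolding definable_def
    by (intro exI[of _ "Conj \<phi>' \<psi>'"]
          exI[of _ "\<lambda>n. if even n then \<sigma> (n div 2) else \<tau> (n div 2)"])
      (simp add: \<sigma> \<tau> \<phi> \<psi> \<phi>' \<psi>')
qed

lemma definable_all:
  assumes "definable (\<lambda>e. Q (\<lambda>n. e (Suc n)) (e 0))"
  shows "definable (\<lambda>e. \<forall>x\<in>M. Q e x)"
proof -
  obtain \<phi> \<sigma> where \<sigma>: "\<And>n. param (\<sigma> n)"
    and \<phi>: "\<And>e. range e \<subseteq> M \<Longrightarrow> sat \<phi> (\<lambda>n. \<sigma> n e) \<longleftrightarrow> Q (\<lambda>n. e (Suc n)) (e 0)"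
    using assms unfolding definable_def by metis
  define v0 :: "(nat \<Rightarrow> 'v) \<Rightarrow> 'v" where "v0 = (\<lambda>e. e 0)"
  \<comment> \<open>Several variables of \<phi> may carry the term \<open>e 0\<close>. They are
    merged into variable 0, which the new quantifier binds; all others are shifted up.\<close>
  obtain \<phi>' where \<phi>': "\<And>e. sat \<phi>' e \<longleftrightarrow> sat \<phi> (\<lambda>n. e (if \<sigma> n = v0 then 0 else Suc n))"
    using sat_rename by metis
  \<comment> \<open>Terms other than \<open>e 0\<close> are constants or read a later entry, so they
    have the same value whatever stands at entry 0; \<open>undefined\<close> is a placeholder there.
    The value at variable 0 is overwritten by the quantifier.\<close>
  define \<tau> where "\<tau> n e = (case n of 0 \<Rightarrow> e 0 | Suc m \<Rightarrow>
      if \<sigma> m = v0 then e 0 else \<sigma> m (\<lambda>k. case k of 0 \<Rightarrow> undefined | Suc j \<Rightarrow> e j))" for n e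
  have shift: "\<sigma> m (case_nat x e) = \<sigma> m (\<lambda>k. case k of 0 \<Rightarrow> undefined | Suc j \<Rightarrow> e j)"
    if "\<sigma> m \<noteq> v0" for m e x
    using \<sigma>[of m] that by (auto simp: param_def v0_def split: nat.split)
  have "param (\<tau> n)" for n
  proof (cases n)
    case 0
    then show ?thesis by (simp add: \<tau>_def[abs_def] param_var)
  next
    case (Suc m)
    show ?thesis
    proof (cases "\<sigma> m = v0")
      case True
      then show ?thesis by (simp add: \<tau>_def[abs_def] Suc param_var)
    next
      case False
      then consider i where "\<sigma> m = (\<lambda>e. e (Suc i))" | c where "c \<in> M" "\<sigma> m = (\<lambda>e. c)"
        using \<sigma>[of m] unfolding param_def v0_def by (metis not0_implies_Suc)
      then show ?thesis
        using False by cases (simp_all add: \<tau>_def[abs_def] Suc param_var param_const)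
    qed
  qed
  moreover have "sat (All 0 \<phi>') (\<lambda>n. \<tau> n e) \<longleftrightarrow> (\<forall>x\<in>M. Q e x)" if e: "range e \<subseteq> M" for e
  proof -
    have "sat \<phi>' ((\<lambda>n. \<tau> n e)(0 := x)) \<longleftrightarrow> Q e x" if "x \<in> M" for x
    proof -
      have "(\<lambda>n. ((\<lambda>n. \<tau> n e)(0 := x)) (if \<sigma> n = v0 then 0 else Suc n)) = (\<lambda>n. \<sigma> n (case_nat x e))"
      proof
        fix n
        show "((\<lambda>n. \<tau> n e)(0 := x)) (if \<sigma> n = v0 then 0 else Suc n) = \<sigma> n (case_nat x e)"
        proof (cases "\<sigma> n = v0")
          case True
          then show ?thesis by (simp add: v0_def)
        next
          case False
          have "\<tau> (Suc n) e = \<sigma> n (case_nat x e)"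
            using False shift[OF False, of x e] by (auto simp: \<tau>_def)
          then show ?thesis using False by simp
        qed
      qed
      moreover have "range (case_nat x e) \<subseteq> M"
        using e that by (auto simp: image_subset_iff split: nat.split)
      ultimately show ?thesis using \<phi>[of "case_nat x e"] unfolding \<phi>' by simp
    qed
    then show ?thesis by simp
  qed
  ultimately show ?thesis
    unfolding definable_def by (intro exI[of _ "All 0 \<phi>'"] exI[of _ \<tau>]) blast
qed

lemma definable_disj:
  assumes "definable P" "definable Q" shows "definable (\<lambda>e. P e \<or> Q e)"
proof -
  have "definable (\<lambda>e. \<not> (\<not> P e \<and> \<not> Q e))"
    by (intro definable_not definable_conj assms)
  then show ?thesis by simp
qed

lemma definable_imp:
  assumes "definable P" "definable Q" shows "definable (\<lambda>e. P e \<longrightarrow> Q e)"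
proof -
  have "definable (\<lambda>e. \<not> P e \<or> Q e)" by (intro definable_not definable_disj assms)
  then show ?thesis by (rule definable_cong) blast
qed

lemma definable_iff:
  assumes "definable P" "definable Q" shows "definable (\<lambda>e. P e \<longleftrightarrow> Q e)"
proof -
  have "definable (\<lambda>e. (P e \<longrightarrow> Q e) \<and> (Q e \<longrightarrow> P e))"
    by (intro definable_conj definable_imp assms)
  then show ?thesis by (rule definable_cong) blast
qed

lemma definable_ex:
  assumes "definable (\<lambda>e. Q (\<lambda>n. e (Suc n)) (e 0))"
  shows "definable (\<lambda>e. \<exists>x\<in>M. Q e x)"
proof -
  have "definable (\<lambda>e. \<not> (\<forall>x\<in>M. \<not> Q e x))" by (intro definable_not definable_all assms)
  then show ?thesis by simp
qed

lemmas definable_basic = param_var param_const definable_mem definable_eq definable_not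
  definable_conj definable_disj definable_imp definable_iff definable_all definable_ex

end

section \<open>Pairs, functions and ordinals in the ambient universe\<close>

locale eps_universe =
  fixes elem :: "'v \<Rightarrow> 'v \<Rightarrow> bool"  (infix "\<epsilon>" 50)
  assumes wf: "wfP elem"
    and extensional: "\<And>x y. (\<And>z. z \<epsilon> x \<longleftrightarrow> z \<epsilon> y) \<Longrightarrow> x = y"
begin

text \<open>No model is mentioned and all quantifiers are bounded. This makes \<open>kpair\<close>,
  and then \<open>app\<close>, \<open>sub\<close> and \<open>ord\<close>, absolute between
  transitive models, and the rules for bounded quantifiers prove their definability.\<close>

definition kpair :: "'v \<Rightarrow> 'v \<Rightarrow> 'v \<Rightarrow> bool" where
  "kpair x y p \<longleftrightarrow> (\<exists>a. a \<epsilon> p \<and> (\<exists>b. b \<epsilon> p \<and>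
     (x \<epsilon> a \<and> (\<forall>z. z \<epsilon> a \<longrightarrow> z = x)) \<and>
     (x \<epsilon> b \<and> y \<epsilon> b \<and> (\<forall>z. z \<epsilon> b \<longrightarrow> z = x \<or> z = y)) \<and>
     (\<forall>z. z \<epsilon> p \<longrightarrow> z = a \<or> z = b)))"

definition app :: "'v \<Rightarrow> 'v \<Rightarrow> 'v \<Rightarrow> bool" where
  "app f x y \<longleftrightarrow> (\<exists>p. p \<epsilon> f \<and> kpair x y p)"

definition sub :: "'v \<Rightarrow> 'v \<Rightarrow> bool" where
  "sub x y \<longleftrightarrow> (\<forall>z. z \<epsilon> x \<longrightarrow> z \<epsilon> y)"

definition ord :: "'v \<Rightarrow> bool" where
  "ord a \<longleftrightarrow> (\<forall>x. x \<epsilon> a \<longrightarrow> sub x a) \<and> (\<forall>x. x \<epsilon> a \<longrightarrow> (\<forall>y. y \<epsilon> x \<longrightarrow> sub y x))"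

lemma kpairE:
  assumes "kpair x y p"
  obtains a b where "\<forall>z. z \<epsilon> a \<longleftrightarrow> z = x" "\<forall>z. z \<epsilon> b \<longleftrightarrow> z = x \<or> z = y"
    "\<forall>z. z \<epsilon> p \<longleftrightarrow> z = a \<or> z = b"
proof -
  obtain a b where *: "a \<epsilon> p" "b \<epsilon> p" "x \<epsilon> a" "\<And>z. z \<epsilon> a \<Longrightarrow> z = x"
    "x \<epsilon> b" "y \<epsilon> b" "\<And>z. z \<epsilon> b \<Longrightarrow> z = x \<or> z = y" "\<And>z. z \<epsilon> p \<Longrightarrow> z = a \<or> z = b"
    using assms unfolding kpair_def by (elim exE conjE) metis
  show thesis
  proof (rule that)
    show "\<forall>z. z \<epsilon> a \<longleftrightarrow> z = x" using *(3,4) by metis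
    show "\<forall>z. z \<epsilon> b \<longleftrightarrow> z = x \<or> z = y" using *(5-7) by metis
    show "\<forall>z. z \<epsilon> p \<longleftrightarrow> z = a \<or> z = b" using *(1,2,8) by metis
  qed
qed

lemma kpairI:
  assumes "\<And>z. z \<epsilon> a \<longleftrightarrow> z = x" "\<And>z. z \<epsilon> b \<longleftrightarrow> z = x \<or> z = y" "\<And>z. z \<epsilon> p \<longleftrightarrow> z = a \<or> z = b"
  shows "kpair x y p"
  unfolding kpair_def by (rule exI[of _ a], rule conjI, simp add: assms(3), rule exI[of _ b]) (simp add: assms)

lemma kpair_inject:
  assumes "kpair x y p" "kpair x' y' p"
  shows "x = x' \<and> y = y'"
proof -
  obtain a b where ab: "\<forall>z. z \<epsilon> a \<longleftrightarrow> z = x" "\<forall>z. z \<epsilon> b \<longleftrightarrow> z = x \<or> z = y"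
    "\<forall>z. z \<epsilon> p \<longleftrightarrow> z = a \<or> z = b"
    using assms(1) by (rule kpairE)
  obtain a' b' where ab': "\<forall>z. z \<epsilon> a' \<longleftrightarrow> z = x'" "\<forall>z. z \<epsilon> b' \<longleftrightarrow> z = x' \<or> z = y'"
    "\<forall>z. z \<epsilon> p \<longleftrightarrow> z = a' \<or> z = b'"
    using assms(2) by (rule kpairE)
  have "a = a' \<or> a = b'" "b = a' \<or> b = b'" "a' = a \<or> a' = b" "b' = a \<or> b' = b"
    using ab(3) ab'(3) by metis+
  then show ?thesis using ab(1,2) ab'(1,2) by metis
qed

lemma irrefl: "\<not> x \<epsilon> x"
  using wf by (metis wfp_imp_irreflp irreflpD)

lemma minimal:
  assumes "P x"
  obtains m where "P m" "\<And>y. y \<epsilon> m \<Longrightarrow> \<not> P y"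
  using wfE_min[OF wf[unfolded wfp_def], of x "Collect P"] assms by auto

lemma ord_mem: "ord a \<Longrightarrow> x \<epsilon> a \<Longrightarrow> ord x"
  unfolding ord_def sub_def by blast

lemma ord_trans: "ord a \<Longrightarrow> y \<epsilon> a \<Longrightarrow> x \<epsilon> y \<Longrightarrow> x \<epsilon> a"
  unfolding ord_def sub_def by blast

text \<open>Induction on \<open>a\<close> and, inside it, on \<open>b\<close>. If \<open>a\<close>
  and \<open>b\<close> were incomparable, then by the induction hypotheses every element of one
  would be an element of the other, and extensionality would make them equal.\<close>

lemma ord_linear:
  assumes "ord a" "ord b"
  shows "a \<epsilon> b \<or> a = b \<or> b \<epsilon> a"
  using assms
proof (induction a arbitrary: b rule: wfp_induct_rule[OF wf])
  case (1 a)
  note IHa = 1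
  show ?case using IHa(3)
  proof (induction b rule: wfp_induct_rule[OF wf])
    case (1 b)
    have A: "x \<epsilon> b \<or> x = b \<or> b \<epsilon> x" if "x \<epsilon> a" for x
      using IHa(1)[OF that ord_mem[OF IHa(2) that] 1(2)] .
    have B: "a \<epsilon> y \<or> a = y \<or> y \<epsilon> a" if "y \<epsilon> b" for y
      using 1(1)[OF that ord_mem[OF 1(2) that]] .
    show ?case
    proof (rule ccontr)
      assume neg: "\<not> ?case"
      have "x \<epsilon> b" if "x \<epsilon> a" for x
        using A[OF that] neg that ord_trans[OF IHa(2) that] by auto
      moreover have "y \<epsilon> a" if "y \<epsilon> b" for y
        using B[OF that] neg that ord_trans[OF 1(2) that] by auto
      ultimately have "a = b" using extensional[of a b] by blast
      then show False using neg by simp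
    qed
  qed
qed

lemma ord_asym: "ord a \<Longrightarrow> x \<epsilon> a \<Longrightarrow> \<not> a \<epsilon> x"
  using ord_trans irrefl by blast

end

section \<open>Definability of bounded notions in a transitive model\<close>

locale zfc_model = eps_universe elem + eps_structure elem M
  for elem :: "'v \<Rightarrow> 'v \<Rightarrow> bool"  (infix "\<epsilon>" 50) and M :: "'v set" +
  assumes transitive: "transitive_model"
begin

lemma mem_in: "x \<in> M \<Longrightarrow> y \<epsilon> x \<Longrightarrow> y \<in> M"
  using transitive unfolding transitive_model_def by blast

lemma elts_eq: "x \<in> M \<Longrightarrow> elts x = {z. z \<epsilon> x}"
  unfolding elts_def using mem_in by blast

text \<open>By transitivity a quantifier bounded by an element of \<open>M\<close> ranges over
  elements of \<open>M\<close>, even though it is written over the whole universe.\<close>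

lemma definable_ball:
  assumes "param t" "definable (\<lambda>e. Q (\<lambda>n. e (Suc n)) (e 0))"
  shows "definable (\<lambda>e. \<forall>x. x \<epsilon> t e \<longrightarrow> Q e x)"
proof -
  have "param (\<lambda>e. t (\<lambda>n. e (Suc n)))"
    using param_subst[OF assms(1), of "\<lambda>n e. e (Suc n)"] by (simp add: param_var)
  then have "definable (\<lambda>e. \<forall>x\<in>M. x \<epsilon> t e \<longrightarrow> Q e x)"
    by (intro definable_all definable_imp definable_mem assms(2) param_var)
  then show ?thesis
    by (rule definable_cong) (metis mem_in param_in[OF assms(1)])
qed

lemma definable_bex:
  assumes "param t" "definable (\<lambda>e. Q (\<lambda>n. e (Suc n)) (e 0))"
  shows "definable (\<lambda>e. \<exists>x. x \<epsilon> t e \<and> Q e x)"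
proof -
  have "definable (\<lambda>e. \<not> (\<forall>x. x \<epsilon> t e \<longrightarrow> \<not> Q e x))"
    by (intro definable_not definable_ball assms)
  then show ?thesis by simp
qed

text \<open>A defined relation is unfolded only once, with variables as arguments; its instances at
  arbitrary terms follow by substitution.\<close>

lemma definable_rel3:
  assumes "definable (\<lambda>e. R (e 0) (e 1) (e 2))" "param s" "param t" "param u"
  shows "definable (\<lambda>e. R (s e) (t e) (u e))"
  using definable_subst[OF assms(1), of "\<lambda>n. if n = 0 then s else if n = 1 then t else u"] assms
  by simp

lemma definable_rel2:
  assumes "definable (\<lambda>e. R (e 0) (e 1))" "param s" "param t"
  shows "definable (\<lambda>e. R (s e) (t e))"
  using definable_subst[OF assms(1), of "\<lambda>n. if n = 0 then s else t"] assms
  by simp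

lemma definable_kpair:
  "param s \<Longrightarrow> param t \<Longrightarrow> param u \<Longrightarrow> definable (\<lambda>e. kpair (s e) (t e) (u e))"
  by (rule definable_rel3[of kpair], unfold kpair_def)
    (intro definable_basic definable_ball definable_bex)

lemma definable_app:
  "param s \<Longrightarrow> param t \<Longrightarrow> param u \<Longrightarrow> definable (\<lambda>e. app (s e) (t e) (u e))"
  by (rule definable_rel3[of app], unfold app_def)
    (intro definable_basic definable_ball definable_bex definable_kpair)

lemma definable_sub: "param s \<Longrightarrow> param t \<Longrightarrow> definable (\<lambda>e. sub (s e) (t e))"
  by (rule definable_rel2[of sub], unfold sub_def)
    (intro definable_basic definable_ball definable_bex)

lemma definable_ord: "param s \<Longrightarrow> definable (\<lambda>e. ord (s e))"
  by (rule definable_rel2[of "\<lambda>x y. ord x"], unfold ord_def)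
    (intro definable_basic definable_ball definable_bex definable_sub)

lemmas definable_intros = definable_basic definable_ball definable_bex definable_kpair
  definable_app definable_sub definable_ord

end

section \<open>Sets and functions in a transitive model\<close>

context zfc_model
begin

lemma zfc: extensionality foundation pairing union power_set infinity separation replacement choice_axiom
  using transitive unfolding transitive_model_def ZFC_def by blast+

text \<open>The bridge to the axiom schemes, which want one formula with its arguments at the
  variables 0 and 1 and the parameters in the assignment.\<close>

lemma definable_instance:
  assumes "definable P" "a \<in> M"
  shows "\<exists>\<phi> env. range env \<subseteq> M \<and> (\<forall>x y. x \<in> M \<longrightarrow> y \<in> M \<longrightarrow>
      (sat \<phi> (env(0 := x, 1 := y)) \<longleftrightarrow> P (\<lambda>n. if n = 0 then x else if n = 1 then y else a)))"
proof -
  obtain \<phi> \<sigma> where \<sigma>: "\<forall>n. param (\<sigma> n)"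
    and \<phi>: "\<forall>e. range e \<subseteq> M \<longrightarrow> (sat \<phi> (\<lambda>n. \<sigma> n e) \<longleftrightarrow> P e)"
    using assms(1) unfolding definable_def by (elim exE conjE)
  define v :: "nat \<Rightarrow> (nat \<Rightarrow> 'v) \<Rightarrow> 'v" where "v i = (\<lambda>e. e i)" for i
  \<comment> \<open>Variables that carry one of the two arguments are sent to 0 and 1. Each other
    term is evaluated once, with \<open>a\<close> at all entries, and stored at position
    \<open>n + 2\<close>.\<close>
  define r where "r n = (if \<sigma> n = v 0 then 0 else if \<sigma> n = v 1 then 1 else n + 2)" for n
  obtain \<phi>' where \<phi>': "\<forall>e. sat \<phi>' e \<longleftrightarrow> sat \<phi> (\<lambda>n. e (r n))" using sat_rename by blast
  define env where "env n = \<sigma> (n - 2) (\<lambda>k. a)" for n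
  show ?thesis
  proof (intro exI[of _ \<phi>'] exI[of _ env] conjI)
    show "range env \<subseteq> M"
      unfolding env_def using param_in \<sigma> assms(2) by (auto simp: image_subset_iff)
    show "\<forall>x y. x \<in> M \<longrightarrow> y \<in> M \<longrightarrow>
      (sat \<phi>' (env(0 := x, 1 := y)) \<longleftrightarrow> P (\<lambda>n. if n = 0 then x else if n = 1 then y else a))"
    proof (intro allI impI)
      fix x y assume xy: "x \<in> M" "y \<in> M"
      define e where "e = (\<lambda>n. if n = 0 then x else if n = (1::nat) then y else a)"
      have "(env(0 := x, 1 := y)) (r n) = \<sigma> n e" for n
      proof -
        consider "\<sigma> n = v 0" | "\<sigma> n = v 1" | i where "\<sigma> n = v (i + 2)"
          | c where "\<sigma> n = (\<lambda>e. c)"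
        proof -
          have "(\<exists>i. \<sigma> n = v i) \<or> (\<exists>c. \<sigma> n = (\<lambda>e. c))"
            using \<sigma> unfolding param_def v_def by blast
          moreover have "i = 0 \<or> i = 1 \<or> (\<exists>j. i = j + 2)" for i :: nat by presburger
          ultimately show thesis using that by metis
        qed
        note cases = this
        \<comment> \<open>Distinct projections are distinct functions only if there are two
          different sets. The axiom of infinity supplies them: an empty set and a set that contains
          it.\<close>
        have v_inj: "v i = v j \<longleftrightarrow> i = j" for i j
        proof
          assume "v i = v j"
          then have "v i (\<lambda>n. if n = i then x' else y') = v j (\<lambda>n. if n = i then x' else y')" for x' y'
            by simp
          then have *: "x' = (if j = i then x' else y')" for x' y' :: 'v by (simp add: v_def)
          show "i = j"
          proof (rule ccontr)
            assume "i \<noteq> j"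
            then have "x' = y'" for x' y' :: 'v using * by metis
            moreover obtain w u where "w \<in> M" "u \<in> M" "u \<noteq> w"
            proof -
              obtain w where w: "w \<in> M" "\<exists>e\<in>elts w. elts e = {}"
                using zfc(6) unfolding infinity_def by auto
              then obtain e where "e \<in> elts w" "elts e = {}" by auto
              then have "e \<noteq> w" "e \<in> M" using irrefl by (auto simp: elts_def)
              then show thesis using that w by blast
            qed
            ultimately show False by blast
          qed
        qed simp
        show ?thesis
          using cases
        proof cases
          case 3
          then show ?thesis using v_inj by (simp add: r_def env_def) (simp add: v_def e_def)
        next
          case (4 c)
          have ne: "\<sigma> n \<noteq> v i" for i
          proof
            assume "\<sigma> n = v i"
            then have "v i = (\<lambda>e. c)" using 4 by simp
            then have "v i (\<lambda>n. x') = c" for x' by metis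
            then have "x' = c" for x' by (simp add: v_def)
            then have "v 0 = v 1" by (intro ext) metis
            then show False using v_inj by simp
          qed
          show ?thesis using ne by (simp add: r_def env_def 4)
        qed (simp_all add: r_def v_inj, simp_all add: v_def e_def)
      qed
      then have "sat \<phi>' (env(0 := x, 1 := y)) \<longleftrightarrow> sat \<phi> (\<lambda>n. \<sigma> n e)" using \<phi>' by presburger
      moreover have "range e \<subseteq> M" using xy assms(2) by (auto simp: e_def)
      ultimately show "sat \<phi>' (env(0 := x, 1 := y)) \<longleftrightarrow>
          P (\<lambda>n. if n = 0 then x else if n = 1 then y else a)"
        using \<phi> unfolding e_def[symmetric] by blast
    qed
  qed
qed

lemma separation_definable:
  assumes "a \<in> M" "definable (\<lambda>e. P (e 0))"
  obtains b where "b \<in> M" "\<forall>z. z \<epsilon> b \<longleftrightarrow> z \<epsilon> a \<and> P z"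
proof -
  obtain \<phi> env where env: "range env \<subseteq> M"
    and \<phi>: "\<forall>x y. x \<in> M \<longrightarrow> y \<in> M \<longrightarrow> (sat \<phi> (env(0 := x, 1 := y)) \<longleftrightarrow> P x)"
    using definable_instance[OF assms(2,1)] by auto
  have "sat \<phi> ((env(1 := a))(0 := x)) \<longleftrightarrow> P x" if "x \<epsilon> a" for x
    using \<phi> mem_in[OF assms(1) that] assms(1) by (metis fun_upd_twist zero_neq_one)
  moreover have "range (env(1 := a)) \<subseteq> M" using env assms(1) by (auto simp: image_subset_iff)
  then obtain b where "b \<in> M" "elts b = {x \<in> elts a. sat \<phi> ((env(1 := a))(0 := x))}"
    using zfc(7) assms(1) unfolding separation_def by blast
  ultimately show thesis
    using that[of b] assms(1) by (auto simp: elts_eq)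
qed

lemma replacement_definable:
  assumes "a \<in> M" "definable (\<lambda>e. R (e 0) (e 1))"
    and "\<And>x y y'. x \<epsilon> a \<Longrightarrow> y \<in> M \<Longrightarrow> y' \<in> M \<Longrightarrow> R x y \<Longrightarrow> R x y' \<Longrightarrow> y = y'"
  obtains b where "b \<in> M" "\<forall>y. y \<epsilon> b \<longleftrightarrow> y \<in> M \<and> (\<exists>x. x \<epsilon> a \<and> R x y)"
proof -
  obtain \<phi> env where env: "range env \<subseteq> M"
    and \<phi>: "\<forall>x y. x \<in> M \<longrightarrow> y \<in> M \<longrightarrow> (sat \<phi> (env(0 := x, 1 := y)) \<longleftrightarrow> R x y)"
    using definable_instance[OF assms(2,1)] by auto
  have "\<exists>b\<in>M. elts b = {y \<in> M. \<exists>x\<in>elts a. sat \<phi> (env(0 := x, 1 := y))}"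
  proof -
    have "\<forall>x\<in>elts a. \<forall>y\<in>M. \<forall>y'\<in>M.
        sat \<phi> (env(0 := x, 1 := y)) \<and> sat \<phi> (env(0 := x, 1 := y')) \<longrightarrow> y = y'"
    proof (intro ballI impI)
      fix x y y' assume *: "x \<in> elts a" "y \<in> M" "y' \<in> M"
        "sat \<phi> (env(0 := x, 1 := y)) \<and> sat \<phi> (env(0 := x, 1 := y'))"
      then have "x \<epsilon> a" "x \<in> M" using assms(1) by (auto simp: elts_def)
      then show "y = y'" using * \<phi> assms(3)[of x y y'] by blast
    qed
    then show ?thesis
      using zfc(8)[unfolded replacement_def, rule_format, OF env assms(1), of \<phi>] by blast
  qed
  then obtain b where "b \<in> M" "elts b = {y \<in> M. \<exists>x\<in>elts a. sat \<phi> (env(0 := x, 1 := y))}"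
    by blast
  then have "y \<epsilon> b \<longleftrightarrow> y \<in> M \<and> (\<exists>x. x \<epsilon> a \<and> sat \<phi> (env(0 := x, 1 := y)))" for y
    using assms(1) by (simp add: elts_eq set_eq_iff)
  then show thesis
    using that[of b] \<open>b \<in> M\<close> \<phi> mem_in[OF assms(1)] by blast
qed

section \<open>Existence of pairs, unions, relations and functions in the model\<close>

lemma pair_set:
  assumes "x \<in> M" "y \<in> M"
  obtains p where "p \<in> M" "\<forall>z. z \<epsilon> p \<longleftrightarrow> z = x \<or> z = y"
proof -
  obtain p where "p \<in> M" "elts p = {x, y}" using zfc(3) assms unfolding pairing_def by blast
  then show thesis using that[of p] by (auto simp: elts_eq)
qed

lemma union_set:
  assumes "x \<in> M"
  obtains u where "u \<in> M" "\<forall>z. z \<epsilon> u \<longleftrightarrow> (\<exists>y. y \<epsilon> x \<and> z \<epsilon> y)"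
proof -
  obtain u where "u \<in> M" "elts u = (\<Union>y\<in>elts x. elts y)"
    using zfc(4) assms unfolding union_def by blast
  then show thesis using that[of u] assms mem_in[OF assms] by (auto simp: elts_eq)
qed

lemma union2_set:
  assumes "x \<in> M" "y \<in> M"
  obtains u where "u \<in> M" "\<forall>z. z \<epsilon> u \<longleftrightarrow> z \<epsilon> x \<or> z \<epsilon> y"
proof -
  obtain p where p: "p \<in> M" "\<forall>z. z \<epsilon> p \<longleftrightarrow> z = x \<or> z = y" using assms by (rule pair_set)
  obtain u where "u \<in> M" "\<forall>z. z \<epsilon> u \<longleftrightarrow> (\<exists>y. y \<epsilon> p \<and> z \<epsilon> y)" using p(1) by (rule union_set)
  then show thesis using that[of u] p(2) by auto
qed

lemma power_set_ex:
  assumes "x \<in> M"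
  obtains p where "p \<in> M" "\<forall>y. y \<epsilon> p \<longleftrightarrow> y \<in> M \<and> sub y x"
proof -
  obtain p where "p \<in> M" "elts p = {y \<in> M. elts y \<subseteq> elts x}"
    using zfc(5) assms unfolding power_set_def by blast
  then have "y \<epsilon> p \<longleftrightarrow> y \<in> M \<and> elts y \<subseteq> elts x" for y
    by (simp add: elts_eq[of p] set_eq_iff)
  moreover have "elts y \<subseteq> elts x \<longleftrightarrow> sub y x" if "y \<in> M" for y
    using assms that by (auto simp: elts_eq sub_def)
  ultimately show thesis using that[of p] \<open>p \<in> M\<close> by blast
qed

lemma kpair_ex:
  assumes "x \<in> M" "y \<in> M"
  obtains p where "p \<in> M" "kpair x y p"
proof -
  obtain a where a: "a \<in> M" "\<forall>z. z \<epsilon> a \<longleftrightarrow> z = x \<or> z = x" using assms(1,1) by (rule pair_set)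
  obtain b where b: "b \<in> M" "\<forall>z. z \<epsilon> b \<longleftrightarrow> z = x \<or> z = y" using assms by (rule pair_set)
  obtain p where p: "p \<in> M" "\<forall>z. z \<epsilon> p \<longleftrightarrow> z = a \<or> z = b" using a(1) b(1) by (rule pair_set)
  have "kpair x y p" using a(2) b(2) p(2) by (intro kpairI[of a x b y]) auto
  then show thesis using that p(1) by blast
qed

lemma is_pair_iff: "p \<in> M \<Longrightarrow> is_pair x y p \<longleftrightarrow> kpair x y p"
proof
  assume p: "p \<in> M" and "is_pair x y p"
  then obtain a b where "a \<in> M" "b \<in> M" "elts a = {x}" "elts b = {x, y}" "elts p = {a, b}"
    unfolding is_pair_def by blast
  then show "kpair x y p" using p by (intro kpairI[of a x b y]) (auto simp: elts_eq)
next
  assume p: "p \<in> M" and "kpair x y p"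
  from this(2) obtain a b where "\<forall>z. z \<epsilon> a \<longleftrightarrow> z = x" "\<forall>z. z \<epsilon> b \<longleftrightarrow> z = x \<or> z = y"
    and ab: "\<forall>z. z \<epsilon> p \<longleftrightarrow> z = a \<or> z = b" by (rule kpairE)
  moreover have "a \<in> M" "b \<in> M" using ab p mem_in by blast+
  ultimately show "is_pair x y p"
    unfolding is_pair_def using p
    by (intro bexI[of _ a] bexI[of _ b]) (auto simp: elts_eq)
qed

lemma val_iff: "f \<in> M \<Longrightarrow> val f x y \<longleftrightarrow> app f x y"
  unfolding val_def app_def using is_pair_iff mem_in by (auto simp: elts_eq)

lemma mapsD:
  assumes "maps f a b" "f \<in> M" "a \<in> M" "b \<in> M"
  shows "app f x y \<Longrightarrow> x \<epsilon> a \<and> y \<epsilon> b"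
    and "x \<epsilon> a \<Longrightarrow> \<exists>y. y \<epsilon> b \<and> app f x y"
    and "app f x y \<Longrightarrow> app f x z \<Longrightarrow> y = z"
proof -
  have 1: "\<And>p. p \<epsilon> f \<Longrightarrow> \<exists>x y. x \<epsilon> a \<and> y \<epsilon> b \<and> kpair x y p"
    using assms mem_in[OF assms(2)] unfolding maps_def by (auto simp: elts_eq is_pair_iff)
  then show *: "x \<epsilon> a \<and> y \<epsilon> b" if "app f x y" for x y
    using that unfolding app_def by (metis kpair_inject)
  have 2: "\<And>x. x \<epsilon> a \<Longrightarrow> \<exists>!y. y \<epsilon> b \<and> app f x y"
    using assms unfolding maps_def by (simp add: elts_eq val_iff)
  then show "\<exists>y. y \<epsilon> b \<and> app f x y" if "x \<epsilon> a" using that by blast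
  show "y = z" if "app f x y" "app f x z" using that * 2 by blast
qed

text \<open>A Kuratowski pair of elements of \<open>u\<close> consists of subsets of
  \<open>u\<close>, so it lies in the double power set of \<open>u\<close>.\<close>

lemma kpair_bound:
  assumes "u \<in> M"
  obtains b where "b \<in> M" "\<forall>x y p. x \<epsilon> u \<longrightarrow> y \<epsilon> u \<longrightarrow> p \<in> M \<longrightarrow> kpair x y p \<longrightarrow> p \<epsilon> b"
proof -
  obtain p1 where p1: "p1 \<in> M" "\<forall>y. y \<epsilon> p1 \<longleftrightarrow> y \<in> M \<and> sub y u" using assms by (rule power_set_ex)
  obtain p2 where p2: "p2 \<in> M" "\<forall>y. y \<epsilon> p2 \<longleftrightarrow> y \<in> M \<and> sub y p1" using p1(1) by (rule power_set_ex)
  have "p \<epsilon> p2" if xy: "x \<epsilon> u" "y \<epsilon> u" and p: "p \<in> M" "kpair x y p" for x y p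
  proof -
    obtain c d where cd: "\<forall>z. z \<epsilon> c \<longleftrightarrow> z = x" "\<forall>z. z \<epsilon> d \<longleftrightarrow> z = x \<or> z = y"
      "\<forall>z. z \<epsilon> p \<longleftrightarrow> z = c \<or> z = d" using p(2) by (rule kpairE)
    have "c \<in> M" "d \<in> M" using cd(3) p(1) mem_in by blast+
    moreover have "sub c u" "sub d u" using cd(1,2) xy by (auto simp: sub_def)
    ultimately have "c \<epsilon> p1" "d \<epsilon> p1" using p1(2) by auto
    then show ?thesis using p2(2) p(1) cd(3) by (auto simp: sub_def)
  qed
  then show thesis by (intro that[OF p2(1)]) blast
qed

text \<open>\<open>app\<close> is silent about elements of \<open>r\<close> that are not pairs. The
  last conclusion excludes them, as \<open>maps\<close> requires.\<close>

lemma relation_ex: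
  assumes "a \<in> M" "b \<in> M" "definable (\<lambda>e. R (e 0) (e 1))"
  obtains r where "r \<in> M" "\<forall>x y. app r x y \<longleftrightarrow> x \<epsilon> a \<and> y \<epsilon> b \<and> R x y"
    "\<forall>p. p \<epsilon> r \<longrightarrow> (\<exists>x y. x \<epsilon> a \<and> y \<epsilon> b \<and> kpair x y p)"
proof -
  obtain u where u: "u \<in> M" "\<forall>z. z \<epsilon> u \<longleftrightarrow> z \<epsilon> a \<or> z \<epsilon> b" using assms(1,2) by (rule union2_set)
  obtain p2 where p2: "p2 \<in> M"
    "\<forall>x y p. x \<epsilon> u \<longrightarrow> y \<epsilon> u \<longrightarrow> p \<in> M \<longrightarrow> kpair x y p \<longrightarrow> p \<epsilon> p2"
    using u(1) by (rule kpair_bound)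
  define Q where "Q p \<longleftrightarrow> (\<exists>x. x \<epsilon> a \<and> (\<exists>y. y \<epsilon> b \<and> (R x y \<and> kpair x y p)))" for p
  have "definable (\<lambda>e. Q (e 0))"
    unfolding Q_def by (intro definable_intros definable_rel2[OF assms(3)] assms(1,2))
  with p2(1) obtain r where r: "r \<in> M" "\<forall>p. p \<epsilon> r \<longleftrightarrow> p \<epsilon> p2 \<and> Q p"
    by (rule separation_definable)
  note r = r(1) r(2)[unfolded Q_def]
  have 1: "app r x y \<longleftrightarrow> x \<epsilon> a \<and> y \<epsilon> b \<and> R x y" for x y
  proof
    assume "app r x y"
    then obtain p where p: "p \<epsilon> r" "kpair x y p" unfolding app_def by blast
    then obtain x' y' where "x' \<epsilon> a" "y' \<epsilon> b" "R x' y'" "kpair x' y' p" using r(2) by blast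
    then show "x \<epsilon> a \<and> y \<epsilon> b \<and> R x y" using kpair_inject[OF p(2)] by blast
  next
    assume *: "x \<epsilon> a \<and> y \<epsilon> b \<and> R x y"
    then have "x \<in> M" "y \<in> M" using mem_in assms(1,2) by blast+
    then obtain p where p: "p \<in> M" "kpair x y p" by (rule kpair_ex)
    moreover have "p \<epsilon> p2" using p p2(2) u(2) * by blast
    ultimately show "app r x y" unfolding app_def using r(2) * by blast
  qed
  have 2: "\<forall>p. p \<epsilon> r \<longrightarrow> (\<exists>x y. x \<epsilon> a \<and> y \<epsilon> b \<and> kpair x y p)" using r(2) by blast
  show thesis by (rule that[OF r(1) _ 2]) (simp add: 1)
qed

lemma function_ex:
  assumes "a \<in> M" "b \<in> M" "definable (\<lambda>e. R (e 0) (e 1))"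
    and "\<And>x. x \<epsilon> a \<Longrightarrow> \<exists>!y. y \<epsilon> b \<and> R x y"
  obtains f where "f \<in> M" "maps f a b" "\<forall>x y. app f x y \<longleftrightarrow> x \<epsilon> a \<and> y \<epsilon> b \<and> R x y"
proof -
  obtain f where f: "f \<in> M" "\<forall>x y. app f x y \<longleftrightarrow> x \<epsilon> a \<and> y \<epsilon> b \<and> R x y"
    "\<forall>p. p \<epsilon> f \<longrightarrow> (\<exists>x y. x \<epsilon> a \<and> y \<epsilon> b \<and> kpair x y p)"
    using assms(1-3) by (rule relation_ex)
  have "maps f a b"
    unfolding maps_def
  proof (intro conjI ballI)
    fix p assume "p \<in> elts f"
    then show "\<exists>x\<in>elts a. \<exists>y\<in>elts b. is_pair x y p"
      using f(1,3) assms(1,2) mem_in[OF f(1)] by (auto simp: elts_eq is_pair_iff)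
  next
    fix x assume "x \<in> elts a"
    then show "\<exists>!y. y \<in> elts b \<and> val f x y"
      using assms(4)[of x] assms(1,2) f(1,2) by (simp add: elts_eq val_iff)
  qed
  then show thesis by (rule that[OF f(1) _ f(2)])
qed

text \<open>The axiom of choice speaks of disjoint families. The fibres of a relation, taken as sets
  of pairs, are disjoint because a pair determines its first coordinate, and a selector for the
  fibres is the graph of a function.\<close>

lemma choice_function:
  assumes "a \<in> M" "b \<in> M" "definable (\<lambda>e. R (e 0) (e 1))"
    and "\<And>x. x \<epsilon> a \<Longrightarrow> \<exists>y. y \<epsilon> b \<and> R x y"
  obtains f where "f \<in> M" "\<forall>x y. app f x y \<longrightarrow> x \<epsilon> a \<and> y \<epsilon> b \<and> R x y"
    "\<forall>x. x \<epsilon> a \<longrightarrow> (\<exists>!y. app f x y)"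
proof -
  obtain r where r: "r \<in> M" "\<forall>x y. app r x y \<longleftrightarrow> x \<epsilon> a \<and> y \<epsilon> b \<and> R x y"
    using assms(1-3) by (rule relation_ex)
  obtain p where p: "p \<in> M" "\<forall>y. y \<epsilon> p \<longleftrightarrow> y \<in> M \<and> sub y r" using r(1) by (rule power_set_ex)
  define Q where
    "Q F \<longleftrightarrow> (\<exists>x. x \<epsilon> a \<and> (\<forall>q. q \<epsilon> r \<longrightarrow> (q \<epsilon> F \<longleftrightarrow> (\<exists>y. y \<epsilon> b \<and> kpair x y q))))" for F
  have "definable (\<lambda>e. Q (e 0))"
    unfolding Q_def by (intro definable_intros assms r)
  with p(1) obtain fam where fam: "fam \<in> M" "\<forall>F. F \<epsilon> fam \<longleftrightarrow> F \<epsilon> p \<and> Q F"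
    by (rule separation_definable)
  define fibre where "fibre F x \<longleftrightarrow> (\<forall>q. q \<epsilon> F \<longleftrightarrow> q \<epsilon> r \<and> (\<exists>y. kpair x y q))" for F x
  have fam_iff: "F \<epsilon> fam \<longleftrightarrow> F \<in> M \<and> (\<exists>x. x \<epsilon> a \<and> fibre F x)" for F
  proof -
    have "(\<exists>y. y \<epsilon> b \<and> kpair x y q) \<longleftrightarrow> (\<exists>y. kpair x y q)" if "q \<epsilon> r" for x q
      using r(2) that unfolding app_def by blast
    then have Q_iff: "Q F \<longleftrightarrow> (\<exists>x. x \<epsilon> a \<and> (\<forall>q. q \<epsilon> r \<longrightarrow> (q \<epsilon> F \<longleftrightarrow> (\<exists>y. kpair x y q))))"
      unfolding Q_def by auto
    show ?thesis
    proof
      assume "F \<epsilon> fam"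
      then have "F \<in> M" "sub F r" "Q F" using fam(2) p(2) by auto
      then show "F \<in> M \<and> (\<exists>x. x \<epsilon> a \<and> fibre F x)"
        unfolding Q_iff fibre_def sub_def by metis
    next
      assume *: "F \<in> M \<and> (\<exists>x. x \<epsilon> a \<and> fibre F x)"
      then have "sub F r" "Q F" unfolding Q_iff fibre_def sub_def by auto
      then show "F \<epsilon> fam" using * fam(2) p(2) by auto
    qed
  qed
  have "\<forall>F\<in>elts fam. elts F \<noteq> {}"
  proof
    fix F assume "F \<in> elts fam"
    then obtain x where x: "F \<in> M" "x \<epsilon> a" "fibre F x" using fam_iff fam(1) by (auto simp: elts_eq)
    obtain y where "y \<epsilon> b" "R x y" using assms(4)[OF x(2)] by blast
    then have "app r x y" using r(2) x(2) by blast
    then obtain q where "q \<epsilon> r" "kpair x y q" unfolding app_def by blast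
    then show "elts F \<noteq> {}" using x by (auto simp: elts_eq fibre_def)
  qed
  moreover have "\<forall>F\<in>elts fam. \<forall>G\<in>elts fam. F \<noteq> G \<longrightarrow> elts F \<inter> elts G = {}"
  proof (intro ballI impI)
    fix F G assume *: "F \<in> elts fam" "G \<in> elts fam" "F \<noteq> G"
    then obtain x x' where x: "F \<in> M" "fibre F x" "G \<in> M" "fibre G x'"
      using fam_iff fam(1) by (auto simp: elts_eq)
    then have "x \<noteq> x'" using *(3) extensional[of F G] unfolding fibre_def by metis
    then show "elts F \<inter> elts G = {}"
      using x kpair_inject unfolding fibre_def by (auto simp: elts_eq)
  qed
  ultimately obtain c where c: "c \<in> M" "\<forall>F\<in>elts fam. \<exists>!z. z \<in> elts c \<inter> elts F"
    using zfc(9) fam(1) unfolding choice_axiom_def by blast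
  define G where "G x y \<longleftrightarrow> (\<exists>q. q \<epsilon> c \<and> (q \<epsilon> r \<and> kpair x y q))" for x y
  have "definable (\<lambda>e. G (e 0) (e 1))"
    unfolding G_def by (intro definable_intros c r)
  with assms(1,2) obtain f where f: "f \<in> M"
    "\<forall>x y. app f x y \<longleftrightarrow> x \<epsilon> a \<and> y \<epsilon> b \<and> G x y"
    by (rule relation_ex)
  note f = f(1) f(2)[unfolded G_def]
  show thesis
  proof (rule that[OF f(1)])
    show "\<forall>x y. app f x y \<longrightarrow> x \<epsilon> a \<and> y \<epsilon> b \<and> R x y"
      using f(2) r(2) unfolding app_def by blast
    show "\<forall>x. x \<epsilon> a \<longrightarrow> (\<exists>!y. app f x y)"
    proof (intro allI impI)
      fix x assume x: "x \<epsilon> a"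
      define H where "H q \<longleftrightarrow> (\<exists>y. y \<epsilon> b \<and> kpair x y q)" for q
      have "definable (\<lambda>e. H (e 0))"
        unfolding H_def by (intro definable_intros assms mem_in[OF assms(1) x])
      with r(1) obtain F where F: "F \<in> M" "\<forall>q. q \<epsilon> F \<longleftrightarrow> q \<epsilon> r \<and> H q"
        by (rule separation_definable)
      note F = F(1) F(2)[unfolded H_def]
      have "fibre F x" using F r(2) unfolding fibre_def app_def by blast
      then have "F \<epsilon> fam" using fam_iff F(1) x by blast
      then obtain q where q: "q \<epsilon> c" "q \<epsilon> F" "\<forall>q'. q' \<epsilon> c \<and> q' \<epsilon> F \<longrightarrow> q' = q"
        using c fam(1) F(1) by (auto simp: elts_eq)
      obtain y where y: "y \<epsilon> b" "kpair x y q" "q \<epsilon> r" using F(2) q(2) by blast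
      show "\<exists>!y. app f x y"
      proof (rule ex1I)
        show "app f x y" using f(2) x y q(1) by blast
      next
        fix y' assume "app f x y'"
        then obtain q' where "y' \<epsilon> b" "q' \<epsilon> c" "q' \<epsilon> r" "kpair x y' q'" using f(2) by blast
        then have "q' \<epsilon> F" using F(2) by blast
        then have "q' = q" using q(3) \<open>q' \<epsilon> c\<close> by blast
        then show "y' = y" using kpair_inject[OF y(2)] \<open>kpair x y' q'\<close> by blast
      qed
    qed
  qed
qed

section \<open>Ordinals, regularity and cardinality in the model\<close>

lemma ordinal_iff: "a \<in> M \<Longrightarrow> ordinal a \<longleftrightarrow> ord a"
proof -
  assume a: "a \<in> M"
  then have "x \<in> M" if "x \<epsilon> a" for x using that by (rule mem_in)
  moreover from this have "y \<in> M" if "x \<epsilon> a" "y \<epsilon> x" for x y using that mem_in by blast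
  ultimately show ?thesis
    unfolding ordinal_def ord_def sub_def using a by (simp add: elts_eq subset_eq cong: conj_cong imp_cong)
qed

lemma limit_ordinalD:
  assumes "limit_ordinal a" "a \<in> M"
  shows "ord a" "\<exists>x. x \<epsilon> a" "x \<epsilon> a \<Longrightarrow> \<exists>y. y \<epsilon> a \<and> x \<epsilon> y"
  using assms unfolding limit_ordinal_def by (auto simp: ordinal_iff elts_eq)

lemma regularD:
  assumes "regular k" "k \<in> M"
  shows "limit_ordinal k"
    and "a \<epsilon> k \<Longrightarrow> f \<in> M \<Longrightarrow> maps f a k \<Longrightarrow> \<exists>b. b \<epsilon> k \<and> (\<forall>x y. app f x y \<longrightarrow> y \<epsilon> b)"
proof -
  show "limit_ordinal k" using assms unfolding regular_def by blast
  assume a: "a \<epsilon> k" and f: "f \<in> M" "maps f a k"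
  have aM: "a \<in> M" using mem_in[OF assms(2) a] .
  have "a \<in> elts k" using a assms(2) by (simp add: elts_eq)
  then obtain b where "b \<in> elts k" "\<forall>x\<in>elts a. \<forall>y\<in>elts k. val f x y \<longrightarrow> y \<epsilon> b"
    using assms(1) f unfolding regular_def by blast
  then have "b \<epsilon> k" "\<forall>x. x \<epsilon> a \<longrightarrow> (\<forall>y. y \<epsilon> k \<longrightarrow> app f x y \<longrightarrow> y \<epsilon> b)"
    using assms(2) f(1) aM by (auto simp: elts_eq val_iff)
  then show "\<exists>b. b \<epsilon> k \<and> (\<forall>x y. app f x y \<longrightarrow> y \<epsilon> b)"
    using mapsD(1)[OF f(2,1) aM assms(2)] by (intro exI[of _ b]) blast
qed

text \<open>The witnesses are ordinals, so taking the least one yields a function without choice,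
  and regularity bounds its values.\<close>

lemma regular_collection:
  assumes reg: "regular k" and k: "k \<in> M" and a: "a \<epsilon> k"
    and def: "definable (\<lambda>e. R (e 0) (e 1))"
    and ex: "\<And>x. x \<epsilon> a \<Longrightarrow> \<exists>w. w \<epsilon> k \<and> R x w"
  shows "\<exists>b. b \<epsilon> k \<and> (\<forall>x. x \<epsilon> a \<longrightarrow> (\<exists>w. w \<epsilon> b \<and> R x w))"
proof -
  have lim: "limit_ordinal k" using reg unfolding regular_def by blast
  note ord = limit_ordinalD(1)[OF lim k]
  have aM: "a \<in> M" using mem_in[OF k a] .
  define L where "L x w \<longleftrightarrow> R x w \<and> (\<forall>v. v \<epsilon> w \<longrightarrow> \<not> R x v)" for x w
  have "definable (\<lambda>e. L (e 0) (e 1))"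
    unfolding L_def by (intro definable_intros definable_rel2[OF def])
  moreover have "\<exists>!w. w \<epsilon> k \<and> L x w" if x: "x \<epsilon> a" for x
  proof -
    obtain w where w: "w \<epsilon> k \<and> R x w" "\<And>y. y \<epsilon> w \<Longrightarrow> \<not> (y \<epsilon> k \<and> R x y)"
      using ex[OF x] minimal[of "\<lambda>w. w \<epsilon> k \<and> R x w"] by blast
    then have "L x w" unfolding L_def using ord_trans[OF ord] by blast
    moreover have "w' = w" if "w' \<epsilon> k" "L x w'" for w'
      using ord_linear[OF ord_mem[OF ord that(1)] ord_mem[OF ord]] w that(2) \<open>L x w\<close>
      unfolding L_def by blast
    ultimately show ?thesis using w(1) by blast
  qed
  ultimately obtain f where f: "f \<in> M" "maps f a k"
    "\<forall>x y. app f x y \<longleftrightarrow> x \<epsilon> a \<and> y \<epsilon> k \<and> L x y"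
    using function_ex[OF aM k] by blast
  obtain b where b: "b \<epsilon> k" "\<forall>x y. app f x y \<longrightarrow> y \<epsilon> b"
    using regularD(2)[OF reg k a f(1,2)] by blast
  have "\<exists>w. w \<epsilon> b \<and> R x w" if "x \<epsilon> a" for x
    using mapsD(2)[OF f(2,1) aM k that] b(2) f(3) unfolding L_def by blast
  then show ?thesis using b(1) by blast
qed

lemma injectionD:
  assumes "injection f a b" "f \<in> M" "a \<in> M" "b \<in> M"
  shows "maps f a b" "app f x y \<Longrightarrow> app f x' y \<Longrightarrow> x = x'"
proof -
  show m: "maps f a b" using assms unfolding injection_def by blast
  show "x = x'" if "app f x y" "app f x' y"
    using assms that mapsD(1)[OF m assms(2-4)]
    unfolding injection_def by (simp add: elts_eq val_iff) blast
qed

lemma bijectionD: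
  assumes "bijection f a b" "f \<in> M" "a \<in> M" "b \<in> M"
  shows "maps f a b" "app f x y \<Longrightarrow> app f x' y \<Longrightarrow> x = x'" "y \<epsilon> b \<Longrightarrow> \<exists>x. app f x y"
proof -
  have inj: "injection f a b" using assms(1) unfolding bijection_def by blast
  show "maps f a b" "app f x y \<Longrightarrow> app f x' y \<Longrightarrow> x = x'"
    using injectionD[OF inj assms(2-4)] by blast+
  show "\<exists>x. app f x y" if "y \<epsilon> b"
    using assms that unfolding bijection_def by (auto simp: elts_eq val_iff)
qed

lemma injectionI:
  assumes "maps f a b" "f \<in> M" "a \<in> M" "b \<in> M"
    and "\<And>x x' y. app f x y \<Longrightarrow> app f x' y \<Longrightarrow> x = x'"
  shows "injection f a b"
  using assms unfolding injection_def by (simp add: elts_eq val_iff) blast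

lemma bijectionI:
  assumes "maps f a b" "f \<in> M" "a \<in> M" "b \<in> M"
    and "\<And>x x' y. app f x y \<Longrightarrow> app f x' y \<Longrightarrow> x = x'"
    and "\<And>y. y \<epsilon> b \<Longrightarrow> \<exists>x. app f x y"
  shows "bijection f a b"
proof -
  have "\<exists>x\<in>elts a. val f x y" if "y \<in> elts b" for y
    using assms(6)[of y] mapsD(1)[OF assms(1-4)] that assms(2-4) by (auto simp: elts_eq val_iff)
  moreover have "injection f a b" using assms(1-5) by (rule injectionI)
  ultimately show ?thesis unfolding bijection_def by blast
qed

text \<open>A strict bound \<open>b\<close> for the values of a map from a smaller ordinal is itself
  missed by that map.\<close>

lemma regular_cardinal:
  assumes "regular k" "k \<in> M"
  shows "cardinal k"
proof -
  have lim: "limit_ordinal k" using assms(1) unfolding regular_def by blast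
  have "\<not> bijection f a k" if a: "a \<epsilon> k" and f: "f \<in> M" for a f
  proof
    assume bij: "bijection f a k"
    have aM: "a \<in> M" using mem_in[OF assms(2) a] .
    note fD = bijectionD[OF bij f aM assms(2)]
    obtain b where b: "b \<epsilon> k" "\<forall>x y. app f x y \<longrightarrow> y \<epsilon> b"
      using regularD(2)[OF assms a f fD(1)] by blast
    then show False using fD(3)[OF b(1)] mapsD(1)[OF fD(1) f aM assms(2)] irrefl by blast
  qed
  then show ?thesis
    unfolding cardinal_def using lim assms(2) by (auto simp: limit_ordinal_def elts_eq)
qed

text \<open>If \<open>X\<close> were bounded, regularity would put all values of a bijection from
  \<open>X\<close> to \<open>k\<close> below some \<open>b\<close> in \<open>k\<close>, although
  \<open>b\<close> is a value.\<close>

lemma full_unbounded: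
  assumes "regular k" "k \<in> M" "X \<in> full_subsets k" "a \<epsilon> k"
  shows "\<exists>x. x \<epsilon> X \<and> a \<epsilon> x \<and> x \<epsilon> k"
proof (rule ccontr)
  assume neg: "\<not> ?thesis"
  have lim: "limit_ordinal k" using assms(1) unfolding regular_def by blast
  note k = limit_ordinalD[OF lim assms(2)]
  have X: "X \<in> M" "\<And>x. x \<epsilon> X \<Longrightarrow> x \<epsilon> k" and "card_of X k"
    using assms(2,3) unfolding full_subsets_def subsets_def by (auto simp: elts_eq)
  then obtain f where f: "f \<in> M" "bijection f X k" unfolding card_of_def by blast
  note fD = bijectionD[OF f(2,1) X(1) assms(2)] and fm = mapsD[OF bijectionD(1)[OF f(2,1) X(1) assms(2)] f(1) X(1) assms(2)]
  obtain a' where a': "a' \<epsilon> k" "a \<epsilon> a'" using k(3)[OF assms(4)] by blast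
  obtain z where z: "z \<epsilon> k" using k(2) by blast
  have sub: "x \<epsilon> a'" if "x \<epsilon> X" for x
    using neg that X(2)[OF that] ord_linear[OF ord_mem[OF k(1)] ord_mem[OF k(1)], of a x] assms(4)
      a' ord_trans[OF ord_mem[OF k(1) a'(1)] a'(2)] by blast
  \<comment> \<open>Regularity speaks of maps on ordinals. The implication makes the relation total
    on \<open>a'\<close>: elements outside \<open>X\<close> accept any witness.\<close>
  have "\<exists>b. b \<epsilon> k \<and> (\<forall>x. x \<epsilon> a' \<longrightarrow> (\<exists>w. w \<epsilon> b \<and> (x \<epsilon> X \<longrightarrow> app f x w)))"
  proof (rule regular_collection[OF assms(1,2) a'(1)])
    show "definable (\<lambda>e. e 0 \<epsilon> X \<longrightarrow> app f (e 0) (e 1))"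
      by (intro definable_intros X(1) f(1))
    show "\<exists>w. w \<epsilon> k \<and> (x \<epsilon> X \<longrightarrow> app f x w)" for x using fm(2)[of x] z by blast
  qed
  then obtain b where b: "b \<epsilon> k" "\<forall>x. x \<epsilon> X \<longrightarrow> (\<exists>w. w \<epsilon> b \<and> app f x w)" using sub by blast
  obtain x where "app f x b" using fD(3)[OF b(1)] by blast
  then show False using fm(1,3) b(2) irrefl by metis
qed

lemma maps_iff:
  assumes "f \<in> M" "a \<in> M" "b \<in> M"
  shows "maps f a b \<longleftrightarrow> (\<forall>p. p \<epsilon> f \<longrightarrow> (\<exists>x y. x \<epsilon> a \<and> y \<epsilon> b \<and> kpair x y p)) \<and>
    (\<forall>x. x \<epsilon> a \<longrightarrow> (\<exists>!y. y \<epsilon> b \<and> app f x y))"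
proof -
  have "(\<forall>p\<in>elts f. \<exists>x\<in>elts a. \<exists>y\<in>elts b. is_pair x y p) \<longleftrightarrow>
      (\<forall>p. p \<epsilon> f \<longrightarrow> (\<exists>x y. x \<epsilon> a \<and> y \<epsilon> b \<and> kpair x y p))"
    using assms mem_in[OF assms(1)] by (simp add: elts_eq is_pair_iff)
  moreover have "(\<forall>x\<in>elts a. \<exists>!y. y \<in> elts b \<and> val f x y) \<longleftrightarrow>
      (\<forall>x. x \<epsilon> a \<longrightarrow> (\<exists>!y. y \<epsilon> b \<and> app f x y))"
    using assms by (simp add: elts_eq val_iff)
  ultimately show ?thesis unfolding maps_def by blast
qed

lemma limit_ordinal_iff:
  "a \<in> M \<Longrightarrow> limit_ordinal a \<longleftrightarrow>
    ord a \<and> (\<exists>x. x \<epsilon> a) \<and> (\<forall>x. x \<epsilon> a \<longrightarrow> (\<exists>y. y \<epsilon> a \<and> x \<epsilon> y))"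
  unfolding limit_ordinal_def by (auto simp: ordinal_iff elts_eq)

text \<open>\<open>s\<close> is a function of the metalanguage; its graph \<open>F\<close> is the
  parameter through which definitions over \<open>M\<close> can refer to it.\<close>

lemma sequence_graph:
  assumes "sequence_in l s" "l \<in> M"
  obtains F where "F \<in> M" "\<forall>i x. app F i x \<longleftrightarrow> i \<epsilon> l \<and> x = s i"
proof -
  obtain F where F: "F \<in> M" "elts F = {p \<in> M. \<exists>i\<in>elts l. is_pair i (s i) p}"
    and sM: "\<forall>i\<in>elts l. s i \<in> M"
    using assms(1) unfolding sequence_in_def by blast
  have F_iff: "p \<epsilon> F \<longleftrightarrow> p \<in> M \<and> (\<exists>i. i \<epsilon> l \<and> kpair i (s i) p)" for p
  proof -
    have "p \<epsilon> F \<longleftrightarrow> p \<in> M \<and> (\<exists>i\<in>elts l. is_pair i (s i) p)"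
      using F(2) elts_eq[OF F(1)] by (simp add: set_eq_iff)
    then show ?thesis using is_pair_iff[of p] elts_eq[OF assms(2)] by auto
  qed
  have "app F i x \<longleftrightarrow> i \<epsilon> l \<and> x = s i" for i x
  proof
    assume "app F i x"
    then obtain p where p: "p \<epsilon> F" "kpair i x p" unfolding app_def by blast
    then obtain j where "j \<epsilon> l" "kpair j (s j) p" using F_iff by blast
    then show "i \<epsilon> l \<and> x = s i" using kpair_inject[OF p(2)] by blast
  next
    assume *: "i \<epsilon> l \<and> x = s i"
    then have "i \<in> M" "s i \<in> M" using mem_in[OF assms(2)] sM elts_eq[OF assms(2)] by auto
    then obtain p where "p \<in> M" "kpair i (s i) p" by (rule kpair_ex)
    then show "app F i x" unfolding app_def using F_iff * by blast
  qed
  then show thesis by (intro that[OF F(1)]) blast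
qed

end

section \<open>Ordinals and successor cardinals\<close>

context eps_universe
begin

lemma ord_cases:
  assumes "ord k" "x \<epsilon> k" "y \<epsilon> k" "\<not> x \<epsilon> y"
  shows "x = y \<or> y \<epsilon> x"
  using ord_linear[OF ord_mem[OF assms(1,2)] ord_mem[OF assms(1,3)]] assms(4) by blast

lemma ord_not_mem_trans:
  assumes "ord k" "x \<epsilon> k" "y \<epsilon> k" "\<not> x \<epsilon> y" "z \<epsilon> y"
  shows "z \<epsilon> x"
  using ord_cases[OF assms(1-4)] ord_trans[OF ord_mem[OF assms(1,2)]] assms(5) by blast

text \<open>\<open>F\<close> and \<open>G\<close> enumerate the same chain of sets in strictly
  increasing order. This is the uniqueness of enumerations by ordinals: inductively,
  \<open>x\<close> and the index of \<open>F x\<close> under \<open>G\<close> have the same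
  elements.\<close>

lemma ord_rigid_aux:
  fixes F G :: "'v \<Rightarrow> 'c set"
  assumes ord: "ord a" "ord b"
    and F: "\<And>x y. y \<epsilon> a \<Longrightarrow> x \<epsilon> y \<Longrightarrow> F x \<subset> F y"
    and G: "\<And>x y. y \<epsilon> b \<Longrightarrow> x \<epsilon> y \<Longrightarrow> G x \<subset> G y"
    and FG: "\<And>x. x \<epsilon> a \<Longrightarrow> \<exists>y. y \<epsilon> b \<and> F x = G y"
    and GF: "\<And>y. y \<epsilon> b \<Longrightarrow> \<exists>x. x \<epsilon> a \<and> F x = G y"
  shows "x \<epsilon> a \<Longrightarrow> x \<epsilon> b \<and> F x = G x"
proof (induction x rule: wfp_induct_rule[OF wf])
  case (1 x)
  obtain y where y: "y \<epsilon> b" "F x = G y" using FG[OF 1(2)] by blast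
  have "z \<epsilon> y" if "z \<epsilon> x" for z
  proof -
    have z: "z \<epsilon> a" "z \<epsilon> b" "F z = G z" using 1(1)[OF that] ord_trans[OF ord(1) 1(2) that] by auto
    then have "G z \<subset> G y" using F[OF 1(2) that] y(2) by simp
    then show ?thesis using ord_cases[OF ord(2) z(2) y(1)] G[OF z(2)] by blast
  qed
  moreover have "z \<epsilon> x" if "z \<epsilon> y" for z
  proof -
    have zb: "z \<epsilon> b" using ord_trans[OF ord(2) y(1) that] .
    obtain w where w: "w \<epsilon> a" "F w = G z" using GF[OF zb] by blast
    then have "F w \<subset> F x" using G[OF y(1) that] y(2) by simp
    then have wx: "w \<epsilon> x" using ord_cases[OF ord(1) w(1) 1(2)] F[OF w(1)] by blast
    then have "w \<epsilon> b" "G w = G z" using 1(1)[OF wx w(1)] w(2) by auto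
    then have "w = z" using ord_cases[OF ord(2) _ zb] G[OF zb] G[of w z] by blast
    then show ?thesis using wx by simp
  qed
  ultimately have "x = y" by (intro extensional) blast
  then show ?case using y by simp
qed

lemma ord_rigid:
  fixes F G :: "'v \<Rightarrow> 'c set"
  assumes "ord a" "ord b"
    and "\<And>x y. y \<epsilon> a \<Longrightarrow> x \<epsilon> y \<Longrightarrow> F x \<subset> F y"
    and "\<And>x y. y \<epsilon> b \<Longrightarrow> x \<epsilon> y \<Longrightarrow> G x \<subset> G y"
    and "\<And>x. x \<epsilon> a \<Longrightarrow> \<exists>y. y \<epsilon> b \<and> F x = G y"
    and "\<And>y. y \<epsilon> b \<Longrightarrow> \<exists>x. x \<epsilon> a \<and> F x = G y"
  shows "a = b"
proof (rule extensional)
  fix z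
  have ba: "\<exists>x. x \<epsilon> a \<and> G y = F x" if "y \<epsilon> b" for y using assms(6)[OF that] by auto
  have ab: "\<exists>y. y \<epsilon> b \<and> G y = F x" if "x \<epsilon> a" for x using assms(5)[OF that] by auto
  show "z \<epsilon> a \<longleftrightarrow> z \<epsilon> b"
  proof
    show "z \<epsilon> a \<Longrightarrow> z \<epsilon> b"
      by (rule conjunct1, rule ord_rigid_aux[where F = F and G = G, OF assms])
    show "z \<epsilon> b \<Longrightarrow> z \<epsilon> a"
      by (rule conjunct1, rule ord_rigid_aux[where F = G and G = F, OF assms(2,1,4,3) ba ab])
  qed
qed

end

context zfc_model
begin

lemma cardinal_ord: "cardinal c \<Longrightarrow> c \<in> M \<Longrightarrow> ord c"
  unfolding cardinal_def by (simp add: ordinal_iff)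

text \<open>Hartogs' argument. An injection of \<open>a\<close> into \<open>l\<close> is coded by
  the chain of the images of the elements of \<open>a\<close>, which is a set of subsets of
  \<open>l\<close>; by \<open>ord_rigid\<close> the chain determines \<open>a\<close>. If every
  ordinal of \<open>M\<close> injected, Replacement on the double power set of \<open>l\<close>
  would collect all of them into a set, and this set would be an ordinal containing itself. An
  injection is here a relation whose nonempty value sets are disjoint, which spares any check of
  single values.\<close>

lemma not_all_ordinals_inject:
  assumes "l \<in> M"
  shows "\<exists>a\<in>M. ord a \<and> \<not> (\<exists>f\<in>M. (\<forall>x. x \<epsilon> a \<longrightarrow> (\<exists>w. w \<epsilon> l \<and> app f x w)) \<and>
    (\<forall>x. x \<epsilon> a \<longrightarrow> (\<forall>x'. x' \<epsilon> a \<longrightarrow> (\<forall>w. w \<epsilon> l \<longrightarrow> app f x w \<longrightarrow> app f x' w \<longrightarrow> x = x'))))"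
proof (rule ccontr)
  define J where "J f a \<longleftrightarrow> (\<forall>x. x \<epsilon> a \<longrightarrow> (\<exists>w. w \<epsilon> l \<and> app f x w)) \<and>
    (\<forall>x. x \<epsilon> a \<longrightarrow> (\<forall>x'. x' \<epsilon> a \<longrightarrow> (\<forall>w. w \<epsilon> l \<longrightarrow> app f x w \<longrightarrow> app f x' w \<longrightarrow> x = x')))"
    for f a
  assume "\<not> ?thesis"
  then have all: "\<exists>f\<in>M. J f a" if "a \<in> M" "ord a" for a
    using that unfolding J_def by blast
  obtain p1 where p1: "p1 \<in> M" "\<forall>y. y \<epsilon> p1 \<longleftrightarrow> y \<in> M \<and> sub y l" using assms by (rule power_set_ex)
  obtain p2 where p2: "p2 \<in> M" "\<forall>y. y \<epsilon> p2 \<longleftrightarrow> y \<in> M \<and> sub y p1" using p1(1) by (rule power_set_ex)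
  define I where "I f b Z \<longleftrightarrow> (\<forall>w. w \<epsilon> l \<longrightarrow> (w \<epsilon> Z \<longleftrightarrow> (\<exists>x. x \<epsilon> b \<and> app f x w)))" for f b Z
  define T where "T r a \<longleftrightarrow> ord a \<and> (\<exists>f\<in>M. J f a \<and>
    (\<forall>Z. Z \<epsilon> p1 \<longrightarrow> (Z \<epsilon> r \<longleftrightarrow> (\<exists>b. b \<epsilon> a \<and> I f b Z))))" for r a
  define F where "F f b = {w. w \<epsilon> l \<and> (\<exists>x. x \<epsilon> b \<and> app f x w)}" for f b
  have I_ex: "\<exists>Z. Z \<epsilon> p1 \<and> I f b Z" if "f \<in> M" "b \<in> M" for f b
  proof -
    define Q where "Q w \<longleftrightarrow> (\<exists>x. x \<epsilon> b \<and> app f x w)" for w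
    have "definable (\<lambda>e. Q (e 0))" unfolding Q_def by (intro definable_intros that)
    with assms obtain Z where "Z \<in> M" "\<forall>w. w \<epsilon> Z \<longleftrightarrow> w \<epsilon> l \<and> Q w"
      by (rule separation_definable)
    then show ?thesis using p1(2) by (intro exI[of _ Z]) (auto simp: I_def Q_def sub_def)
  qed
  have I_F: "F f b = {w. w \<epsilon> Z}" if "Z \<epsilon> p1" "I f b Z" for f b Z
    using that p1(2) unfolding F_def I_def sub_def by blast
  have F_mono: "F f x \<subset> F f y" if J: "J f a" and a: "ord a" and y: "y \<epsilon> a" "x \<epsilon> y" for f a x y
  proof -
    have x: "x \<epsilon> a" using ord_trans[OF a y] .
    obtain w where w: "w \<epsilon> l" "app f x w" using J x unfolding J_def by blast
    have "w \<notin> F f x"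
    proof
      assume "w \<in> F f x"
      then obtain v where v: "v \<epsilon> x" "app f v w" unfolding F_def by blast
      have "v = x" using J ord_trans[OF a x v(1)] x w v(2) unfolding J_def by blast
      then show False using v(1) irrefl by blast
    qed
    moreover have "w \<in> F f y" using w y(2) unfolding F_def by blast
    moreover have "F f x \<subseteq> F f y" using ord_trans[OF ord_mem[OF a y(1)] y(2)] unfolding F_def by blast
    ultimately show ?thesis by blast
  qed
  have T_unique: "a = a'" if "T r a" "T r a'" "a \<in> M" "a' \<in> M" for r a a'
  proof -
    obtain f where f: "ord a" "f \<in> M" "J f a" "\<forall>Z. Z \<epsilon> p1 \<longrightarrow> (Z \<epsilon> r \<longleftrightarrow> (\<exists>b. b \<epsilon> a \<and> I f b Z))"
      using \<open>T r a\<close> unfolding T_def by blast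
    obtain g where g: "ord a'" "g \<in> M" "J g a'" "\<forall>Z. Z \<epsilon> p1 \<longrightarrow> (Z \<epsilon> r \<longleftrightarrow> (\<exists>b. b \<epsilon> a' \<and> I g b Z))"
      using \<open>T r a'\<close> unfolding T_def by blast
    have "\<exists>y. y \<epsilon> a' \<and> F f x = F g y" if x: "x \<epsilon> a" for x
    proof -
      obtain Z where Z: "Z \<epsilon> p1" "I f x Z" using I_ex[OF f(2) mem_in[OF \<open>a \<in> M\<close> x]] by blast
      then obtain y where "y \<epsilon> a'" "I g y Z" using f(4) g(4) x by blast
      then show ?thesis using I_F[OF Z] I_F[OF Z(1), of g y] by auto
    qed
    moreover have "\<exists>x. x \<epsilon> a \<and> F f x = F g y" if y: "y \<epsilon> a'" for y
    proof -
      obtain Z where Z: "Z \<epsilon> p1" "I g y Z" using I_ex[OF g(2) mem_in[OF \<open>a' \<in> M\<close> y]] by blast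
      then obtain x where "x \<epsilon> a" "I f x Z" using f(4) g(4) y by blast
      then show ?thesis using I_F[OF Z] I_F[OF Z(1), of f x] by auto
    qed
    ultimately show ?thesis
      using ord_rigid[OF f(1) g(1), of "F f" "F g"] F_mono[OF f(3,1)] F_mono[OF g(3,1)] by blast
  qed
  have "definable (\<lambda>e. T (e 0) (e 1))"
    unfolding T_def J_def I_def by (intro definable_intros p1 assms)
  with p2(1) obtain H where H: "H \<in> M" "\<forall>a. a \<epsilon> H \<longleftrightarrow> a \<in> M \<and> (\<exists>r. r \<epsilon> p2 \<and> T r a)"
    by (rule replacement_definable) (rule T_unique)
  have H_iff: "a \<epsilon> H \<longleftrightarrow> a \<in> M \<and> ord a" for a
  proof
    assume "a \<epsilon> H"
    then show "a \<in> M \<and> ord a" using H(2) unfolding T_def by blast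
  next
    assume a: "a \<in> M \<and> ord a"
    then obtain f where f: "f \<in> M" "J f a" using all by blast
    define Q where "Q Z \<longleftrightarrow> (\<exists>b. b \<epsilon> a \<and> I f b Z)" for Z
    have "definable (\<lambda>e. Q (e 0))"
      unfolding Q_def I_def by (intro definable_intros f assms) (use a in blast)
    with p1(1) obtain r where r: "r \<in> M" "\<forall>Z. Z \<epsilon> r \<longleftrightarrow> Z \<epsilon> p1 \<and> Q Z"
      by (rule separation_definable)
    then have "r \<epsilon> p2" using p2(2) by (simp add: sub_def)
    moreover have "T r a" unfolding T_def using a f r(2) unfolding Q_def by blast
    ultimately show "a \<epsilon> H" using H(2) a by blast
  qed
  have "ord H"
    unfolding ord_def sub_def
  proof (intro conjI allI impI)
    fix x z assume "x \<epsilon> H" "z \<epsilon> x"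
    then show "z \<epsilon> H" using H_iff ord_mem mem_in by blast
  next
    fix x y z assume "x \<epsilon> H" "y \<epsilon> x" "z \<epsilon> y"
    then show "z \<epsilon> x" using H_iff ord_trans by blast
  qed
  then have "H \<epsilon> H" using H_iff H(1) by blast
  then show False using irrefl by blast
qed

text \<open>Without cardinals above \<open>l\<close>, every ordinal would inject into
  \<open>l\<close> by induction: an ordinal above \<open>l\<close> is not a cardinal, hence is the
  bijective image of a smaller one, whose injection is composed with the inverse bijection.\<close>

lemma larger_cardinal_ex:
  assumes l: "l \<in> M" "ord l"
  shows "\<exists>c\<in>M. cardinal c \<and> l \<epsilon> c"
proof (rule ccontr)
  assume neg: "\<not> ?thesis"
  define J where "J f a \<longleftrightarrow> (\<forall>x. x \<epsilon> a \<longrightarrow> (\<exists>w. w \<epsilon> l \<and> app f x w)) \<and>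
    (\<forall>x. x \<epsilon> a \<longrightarrow> (\<forall>x'. x' \<epsilon> a \<longrightarrow> (\<forall>w. w \<epsilon> l \<longrightarrow> app f x w \<longrightarrow> app f x' w \<longrightarrow> x = x')))"
    for f a
  have "a \<in> M \<Longrightarrow> ord a \<Longrightarrow> \<exists>f\<in>M. J f a" for a
  proof (induction a rule: wfp_induct_rule[OF wf])
    case (1 a)
    show ?case
    proof (cases "l \<epsilon> a")
      case False
      then have sub: "x \<epsilon> l" if "x \<epsilon> a" for x
        using that ord_linear[OF l(2) 1(3)] ord_trans[OF l(2)] by blast
      define Q where "Q x y \<longleftrightarrow> x = y" for x y :: 'v
      have "definable (\<lambda>e. Q (e 0) (e 1))" unfolding Q_def by (intro definable_intros)
      with 1(2) l(1) obtain f where f: "f \<in> M" "\<forall>x y. app f x y \<longleftrightarrow> x \<epsilon> a \<and> y \<epsilon> l \<and> Q x y"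
        by (rule relation_ex)
      have "J f a" unfolding J_def using f(2) sub by (simp add: Q_def)
      then show ?thesis using f(1) by blast
    next
      case True
      then have "\<not> cardinal a" using neg 1(2) by blast
      then obtain b f where bf: "b \<epsilon> a" "f \<in> M" "bijection f b a"
        unfolding cardinal_def using 1(2,3) by (auto simp: elts_eq ordinal_iff)
      have bM: "b \<in> M" using mem_in[OF 1(2) bf(1)] .
      note fD = bijectionD[OF bf(3,2) bM 1(2)]
      note fm = mapsD[OF fD(1) bf(2) bM 1(2)]
      obtain g where g: "g \<in> M" "J g b" using 1(1)[OF bf(1) bM ord_mem[OF 1(3) bf(1)]] by blast
      define Q where "Q x w \<longleftrightarrow> (\<exists>z. z \<epsilon> b \<and> (app f z x \<and> app g z w))" for x w
      have "definable (\<lambda>e. Q (e 0) (e 1))" unfolding Q_def by (intro definable_intros bM bf g)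
      with 1(2) l(1) obtain h where h: "h \<in> M" "\<forall>x y. app h x y \<longleftrightarrow> x \<epsilon> a \<and> y \<epsilon> l \<and> Q x y"
        by (rule relation_ex)
      have "\<exists>w. w \<epsilon> l \<and> app h x w" if x: "x \<epsilon> a" for x
      proof -
        obtain z where z: "app f z x" "z \<epsilon> b" using fD(3)[OF x] fm(1) by blast
        obtain w where "w \<epsilon> l" "app g z w" using g(2) z(2) unfolding J_def by blast
        then show ?thesis using h(2) x z unfolding Q_def by blast
      qed
      moreover have "x = x'" if w: "w \<epsilon> l" "app h x w" "app h x' w" for x x' w
      proof -
        obtain z where z: "z \<epsilon> b" "app f z x" "app g z w" using w h(2) unfolding Q_def by blast
        obtain z' where z': "z' \<epsilon> b" "app f z' x'" "app g z' w" using w h(2) unfolding Q_def by blast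
        have "z = z'" using g(2) z z' w(1) unfolding J_def by blast
        then show ?thesis using fm(3) z z' by blast
      qed
      ultimately have "J h a" unfolding J_def by blast
      then show ?thesis using h(1) by blast
    qed
  qed
  then show False using not_all_ordinals_inject[OF l(1)] unfolding J_def by blast
qed

lemma succ_card_ex:
  assumes l: "l \<in> M" "ord l"
  shows "\<exists>c\<in>M. succ_card l c"
proof -
  obtain c where c: "c \<in> M \<and> cardinal c \<and> l \<epsilon> c"
    "\<And>r. r \<epsilon> c \<Longrightarrow> \<not> (r \<in> M \<and> cardinal r \<and> l \<epsilon> r)"
    using larger_cardinal_ex[OF l] minimal[of "\<lambda>c. c \<in> M \<and> cardinal c \<and> l \<epsilon> c"] by blast
  have "r = l \<or> r \<epsilon> l" if "r \<epsilon> c" "cardinal r" for r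
  proof -
    have "r \<in> M" using mem_in c(1) that(1) by blast
    then show ?thesis using c(2)[OF that(1)] that(2) ord_linear[OF l(2) cardinal_ord] by blast
  qed
  then have "succ_card l c" unfolding succ_card_def using c(1) by (auto simp: elts_eq)
  then show ?thesis using c(1) by blast
qed

end

section \<open>Normal ultrafilters\<close>

context zfc_model
begin

lemma subsets_iff: "k \<in> M \<Longrightarrow> X \<in> subsets k \<longleftrightarrow> X \<in> M \<and> sub X k"
  unfolding subsets_def sub_def by (auto simp: elts_eq)

lemma almost_subset_iff:
  assumes "k \<in> M" "A \<in> M" "B \<in> M"
  shows "almost_subset k A B \<longleftrightarrow> (\<exists>a. a \<epsilon> k \<and> (\<forall>x. x \<epsilon> A \<longrightarrow> \<not> x \<epsilon> a \<longrightarrow> x \<epsilon> B))"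
  unfolding almost_subset_def using assms mem_in[OF assms(1)] by (auto simp: elts_eq)

lemma ultrafilterD:
  assumes "ultrafilter k U" "k \<in> M" "U \<in> M"
  shows "X \<epsilon> U \<Longrightarrow> X \<in> M" "X \<epsilon> U \<Longrightarrow> x \<epsilon> X \<Longrightarrow> x \<epsilon> k"
    and "k \<epsilon> U"
    and "X \<epsilon> U \<Longrightarrow> \<exists>x. x \<epsilon> X"
    and "X \<epsilon> U \<Longrightarrow> Y \<in> M \<Longrightarrow> sub Y k \<Longrightarrow> sub X Y \<Longrightarrow> Y \<epsilon> U"
    and "X \<epsilon> U \<Longrightarrow> Y \<epsilon> U \<Longrightarrow> \<exists>Z. Z \<epsilon> U \<and> (\<forall>z. z \<epsilon> Z \<longleftrightarrow> z \<epsilon> X \<and> z \<epsilon> Y)"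
    and "X \<in> M \<Longrightarrow> sub X k \<Longrightarrow> X \<epsilon> U \<or> (\<exists>Y. Y \<epsilon> U \<and> (\<forall>z. z \<epsilon> Y \<longleftrightarrow> z \<epsilon> k \<and> \<not> z \<epsilon> X))"
proof -
  have U: "elts U = {X. X \<epsilon> U}" using assms(3) by (simp add: elts_eq)
  have uf: "{X. X \<epsilon> U} \<subseteq> subsets k" "k \<epsilon> U" "\<And>X. X \<epsilon> U \<Longrightarrow> elts X \<noteq> {}"
    "\<And>X Y. X \<epsilon> U \<Longrightarrow> Y \<in> subsets k \<Longrightarrow> elts X \<subseteq> elts Y \<Longrightarrow> Y \<epsilon> U"
    "\<And>X Y. X \<epsilon> U \<Longrightarrow> Y \<epsilon> U \<Longrightarrow> \<exists>Z. Z \<epsilon> U \<and> elts Z = elts X \<inter> elts Y"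
    "\<And>X. X \<in> subsets k \<Longrightarrow> X \<epsilon> U \<or> (\<exists>Y. Y \<epsilon> U \<and> elts Y = elts k - elts X)"
    using assms(1) unfolding ultrafilter_def U by simp_all
  show 1: "X \<in> M" if "X \<epsilon> U" for X using that assms(3) mem_in by blast
  show "x \<epsilon> k" if "X \<epsilon> U" "x \<epsilon> X" for x X
  proof -
    have "X \<in> subsets k" using uf(1) that(1) by blast
    then show ?thesis using that(2) assms(2) by (simp add: subsets_iff sub_def)
  qed
  show "k \<epsilon> U" by (rule uf(2))
  show "\<exists>x. x \<epsilon> X" if "X \<epsilon> U" for X
  proof -
    have "elts X \<noteq> {}" by (rule uf(3)[OF that])
    then show ?thesis using 1[OF that] by (simp add: elts_eq)
  qed
  show "Y \<epsilon> U" if "X \<epsilon> U" "Y \<in> M" "sub Y k" "sub X Y" for X Y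
  proof -
    have "elts X \<subseteq> elts Y" using that 1[OF that(1)] by (auto simp: elts_eq sub_def)
    moreover have "Y \<in> subsets k" using that assms(2) by (simp add: subsets_iff)
    ultimately show ?thesis using uf(4) that(1) by blast
  qed
  show "\<exists>Z. Z \<epsilon> U \<and> (\<forall>z. z \<epsilon> Z \<longleftrightarrow> z \<epsilon> X \<and> z \<epsilon> Y)" if "X \<epsilon> U" "Y \<epsilon> U" for X Y
  proof -
    from uf(5)[OF that] obtain Z where Z: "Z \<epsilon> U" "elts Z = elts X \<inter> elts Y" by blast
    then show ?thesis
      using 1[OF that(1)] 1[OF that(2)] 1[OF Z(1)] by (intro exI[of _ Z]) (simp add: elts_eq set_eq_iff)
  qed
  show "X \<epsilon> U \<or> (\<exists>Y. Y \<epsilon> U \<and> (\<forall>z. z \<epsilon> Y \<longleftrightarrow> z \<epsilon> k \<and> \<not> z \<epsilon> X))" if "X \<in> M" "sub X k" for X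
  proof (cases "X \<epsilon> U")
    case False
    have "X \<in> subsets k" using that assms(2) by (simp add: subsets_iff)
    then obtain Y where Y: "Y \<epsilon> U" "elts Y = elts k - elts X" using uf(6) False by blast
    then show ?thesis
      using that 1[OF Y(1)] assms(2)
      by (intro disjI2 exI[of _ Y]) (simp add: elts_eq set_eq_iff)
  qed simp
qed

lemma ultrafilterI:
  assumes "k \<in> M" "U \<in> M"
    and 1: "\<And>X. X \<epsilon> U \<Longrightarrow> sub X k"
    and 2: "k \<epsilon> U"
    and 3: "\<And>X. X \<epsilon> U \<Longrightarrow> \<exists>x. x \<epsilon> X"
    and 4: "\<And>X Y. X \<epsilon> U \<Longrightarrow> Y \<in> M \<Longrightarrow> sub Y k \<Longrightarrow> sub X Y \<Longrightarrow> Y \<epsilon> U"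
    and 5: "\<And>X Y. X \<epsilon> U \<Longrightarrow> Y \<epsilon> U \<Longrightarrow> \<exists>Z. Z \<epsilon> U \<and> (\<forall>z. z \<epsilon> Z \<longleftrightarrow> z \<epsilon> X \<and> z \<epsilon> Y)"
    and 6: "\<And>X. X \<in> M \<Longrightarrow> sub X k \<Longrightarrow> X \<epsilon> U \<or> (\<exists>Y. Y \<epsilon> U \<and> (\<forall>z. z \<epsilon> Y \<longleftrightarrow> z \<epsilon> k \<and> \<not> z \<epsilon> X))"
  shows "ultrafilter k U"
proof -
  have U: "elts U = {X. X \<epsilon> U}" using assms(2) by (simp add: elts_eq)
  have UM: "X \<in> M" if "X \<epsilon> U" for X using that assms(2) mem_in by blast
  show ?thesis
    unfolding ultrafilter_def U
  proof (intro conjI ballI impI)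
    show "{X. X \<epsilon> U} \<subseteq> subsets k" using UM 1 assms(1) by (auto simp: subsets_iff)
    show "k \<in> {X. X \<epsilon> U}" using 2 by simp
  next
    fix X assume "X \<in> {X. X \<epsilon> U}"
    then show "elts X \<noteq> {}" using UM[of X] 3[of X] by (auto simp: elts_eq)
  next
    fix X Y assume *: "X \<in> {X. X \<epsilon> U}" "Y \<in> subsets k" "elts X \<subseteq> elts Y"
    then show "Y \<in> {X. X \<epsilon> U}"
      using UM[of X] 4[of X Y] assms(1) by (auto simp: elts_eq sub_def subsets_iff)
  next
    fix X Y assume *: "X \<in> {X. X \<epsilon> U}" "Y \<in> {X. X \<epsilon> U}"
    then obtain Z where Z: "Z \<epsilon> U" "\<forall>z. z \<epsilon> Z \<longleftrightarrow> z \<epsilon> X \<and> z \<epsilon> Y" using 5 by blast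
    then show "\<exists>Z\<in>{X. X \<epsilon> U}. elts Z = elts X \<inter> elts Y"
      using * UM by (intro bexI[of _ Z]) (auto simp: elts_eq)
  next
    fix X assume *: "X \<in> subsets k"
    show "X \<in> {X. X \<epsilon> U} \<or> (\<exists>Y\<in>{X. X \<epsilon> U}. elts Y = elts k - elts X)"
    proof (cases "X \<epsilon> U")
      case False
      then obtain Y where Y: "Y \<epsilon> U" "\<forall>z. z \<epsilon> Y \<longleftrightarrow> z \<epsilon> k \<and> \<not> z \<epsilon> X"
        using 6[of X] * assms(1) by (auto simp: subsets_iff)
      then have "elts Y = elts k - elts X"
        using UM[OF Y(1)] * assms(1) by (auto simp: elts_eq subsets_iff)
      then show ?thesis using Y(1) by blast
    qed simp
  qed
qed

end

text \<open>Formulated for an arbitrary model because it is interpreted in each \<open>N i\<close>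
  with the measure \<open>\<U> i\<close>.\<close>

locale normal_measure = zfc_model elem M
  for elem :: "'v \<Rightarrow> 'v \<Rightarrow> bool"  (infix "\<epsilon>" 50) and M :: "'v set" +
  fixes k U :: 'v
  assumes k_in: "k \<in> M" and U_in: "U \<in> M"
    and k_regular: "regular k"
    and U_normal: "normal_ultrafilter k U"
begin

lemma U_ultra: "ultrafilter k U"
  using U_normal unfolding normal_ultrafilter_def uniform_ultrafilter_def by blast

lemmas U_facts = ultrafilterD[OF U_ultra k_in U_in]

lemmas k_ord = limit_ordinalD(1)[OF regularD(1)[OF k_regular k_in] k_in]
lemmas k_limit = limit_ordinalD(3)[OF regularD(1)[OF k_regular k_in] k_in]

lemma sub_k: "a \<epsilon> k \<Longrightarrow> sub a k"
  using k_ord unfolding ord_def by blast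

lemma card_U: "X \<epsilon> U \<Longrightarrow> card_of X k"
  using U_normal U_in
  unfolding normal_ultrafilter_def uniform_ultrafilter_def full_subsets_def by (auto simp: elts_eq)

text \<open>By uniformity all sets of \<open>U\<close> have size \<open>k\<close>, and an element of
  the cardinal \<open>k\<close> does not.\<close>

lemma final_segment:
  assumes "a \<epsilon> k"
  shows "\<exists>X. X \<epsilon> U \<and> (\<forall>x. x \<epsilon> X \<longleftrightarrow> x \<epsilon> k \<and> \<not> x \<epsilon> a)"
proof -
  have "\<not> a \<epsilon> U"
  proof
    assume "a \<epsilon> U"
    then have "card_of a k" by (rule card_U)
    then show False unfolding card_of_def cardinal_def using assms k_in by (auto simp: elts_eq)
  qed
  then show ?thesis using U_facts(7)[OF mem_in[OF k_in assms] sub_k[OF assms]] by blast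
qed

lemma inter_final:
  assumes "X \<epsilon> U" "a \<epsilon> k"
  shows "\<exists>x. x \<epsilon> X \<and> \<not> x \<epsilon> a"
proof -
  obtain Y where Y: "Y \<epsilon> U" "\<forall>x. x \<epsilon> Y \<longleftrightarrow> x \<epsilon> k \<and> \<not> x \<epsilon> a" using final_segment[OF assms(2)] by blast
  obtain Z where Z: "Z \<epsilon> U" "\<forall>z. z \<epsilon> Z \<longleftrightarrow> z \<epsilon> X \<and> z \<epsilon> Y" using U_facts(6)[OF assms(1) Y(1)] by blast
  show ?thesis using U_facts(4)[OF Z(1)] Z(2) Y(2) by blast
qed

text \<open>Normality for a definable matrix in place of a function: the sections of
  \<open>P\<close> lie in \<open>U\<close>, and sending \<open>y\<close> to its section is a
  function of the model.\<close>

lemma diagonal: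
  assumes def: "definable (\<lambda>e. P (e 0) (e 1))"
    and P: "\<And>y. y \<epsilon> k \<Longrightarrow> \<exists>X. X \<epsilon> U \<and> (\<forall>x. x \<epsilon> X \<longrightarrow> P y x)"
  shows "\<exists>Y. Y \<epsilon> U \<and> (\<forall>x. x \<epsilon> Y \<longleftrightarrow> x \<epsilon> k \<and> (\<forall>y. y \<epsilon> x \<longrightarrow> P y x))"
proof -
  define R where "R y X \<longleftrightarrow> (\<forall>x. x \<epsilon> k \<longrightarrow> (x \<epsilon> X \<longleftrightarrow> P y x))" for y X
  have R: "definable (\<lambda>e. R (e 0) (e 1))"
    unfolding R_def by (intro definable_intros definable_rel2[OF def] k_in)
  have R_ex: "\<exists>!X. X \<epsilon> U \<and> R y X" if y: "y \<epsilon> k" for y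
  proof -
    have yM: "y \<in> M" using mem_in[OF k_in y] .
    define Q where "Q = P y"
    have "definable (\<lambda>e. Q (e 0))"
      unfolding Q_def by (intro definable_rel2[OF def] definable_basic yM)
    with k_in obtain X where X: "X \<in> M" "\<forall>x. x \<epsilon> X \<longleftrightarrow> x \<epsilon> k \<and> Q x" by (rule separation_definable)
    obtain X' where X': "X' \<epsilon> U" "\<forall>x. x \<epsilon> X' \<longrightarrow> P y x" using P[OF y] by blast
    have "X \<epsilon> U"
      using U_facts(2)[OF X'(1)] X X'(2)
      by (intro U_facts(5)[OF X'(1)]) (auto simp: sub_def Q_def)
    then have "X \<epsilon> U \<and> R y X" unfolding R_def using X(2) by (simp add: Q_def)
    moreover have "X' = X" if "X' \<epsilon> U \<and> R y X'" for X'
      using that U_facts(2)[of X'] X(2)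
      by (intro extensional) (auto simp: R_def Q_def)
    ultimately show ?thesis by blast
  qed
  obtain f where f: "f \<in> M" "maps f k U" "\<forall>x y. app f x y \<longleftrightarrow> x \<epsilon> k \<and> y \<epsilon> U \<and> R x y"
    by (rule function_ex[OF k_in U_in R R_ex])
  obtain Y where Y: "Y \<in> elts U"
    "elts Y = {x \<in> elts k. \<forall>\<xi>\<in>elts x. \<forall>X\<in>elts U. val f \<xi> X \<longrightarrow> x \<epsilon> X}"
    using U_normal f(1,2) unfolding normal_ultrafilter_def by blast
  have YU: "Y \<epsilon> U" using Y(1) U_in by (simp add: elts_eq)
  have "x \<epsilon> Y \<longleftrightarrow> x \<epsilon> k \<and> (\<forall>y. y \<epsilon> x \<longrightarrow> P y x)" for x
  proof -
    have "x \<epsilon> Y \<longleftrightarrow> x \<epsilon> k \<and> (\<forall>\<xi>\<in>elts x. \<forall>X. X \<epsilon> U \<longrightarrow> app f \<xi> X \<longrightarrow> x \<epsilon> X)"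
      using Y(2) U_facts(1)[OF YU] U_in k_in by (simp add: elts_eq set_eq_iff val_iff[OF f(1)])
    also have "\<dots> \<longleftrightarrow> x \<epsilon> k \<and> (\<forall>y. y \<epsilon> x \<longrightarrow> P y x)"
    proof (rule conj_cong[OF refl])
      assume x: "x \<epsilon> k"
      have "(\<forall>X. X \<epsilon> U \<longrightarrow> app f y X \<longrightarrow> x \<epsilon> X) \<longleftrightarrow> P y x" if y: "y \<epsilon> x" for y
      proof -
        have yk: "y \<epsilon> k" using ord_trans[OF k_ord x y] .
        obtain X where X: "X \<epsilon> U" "app f y X"
          using mapsD(2)[OF f(2,1) k_in U_in yk] by blast
        have "x \<epsilon> X' \<longleftrightarrow> P y x" if "app f y X'" for X'
          using f(3) that x unfolding R_def by blast
        then show ?thesis using X by blast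
      qed
      then show "(\<forall>\<xi>\<in>elts x. \<forall>X. X \<epsilon> U \<longrightarrow> app f \<xi> X \<longrightarrow> x \<epsilon> X) \<longleftrightarrow> (\<forall>y. y \<epsilon> x \<longrightarrow> P y x)"
        using elts_eq[OF mem_in[OF k_in x]] by simp
    qed
    finally show ?thesis .
  qed
  then show ?thesis using YU by blast
qed

text \<open>For fixed \<open>y\<close> all large \<open>x\<close> have an element of
  \<open>B\<close> between \<open>y\<close> and \<open>x\<close>. The diagonal intersection of these
  final segments is the set of limit points of \<open>B\<close>.\<close>

lemma limits_in_U:
  assumes B: "B \<in> M" "sub B k" and unb: "\<And>a. a \<epsilon> k \<Longrightarrow> \<exists>z. z \<epsilon> B \<and> a \<epsilon> z"
  shows "\<exists>Y. Y \<epsilon> U \<and> (\<forall>x. x \<epsilon> Y \<longrightarrow> (\<forall>y. y \<epsilon> x \<longrightarrow> (\<exists>z. z \<epsilon> B \<and> (y \<epsilon> z \<and> z \<epsilon> x))))"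
proof -
  define P where "P y x \<longleftrightarrow> (\<exists>z. z \<epsilon> B \<and> (y \<epsilon> z \<and> z \<epsilon> x))" for y x
  have def: "definable (\<lambda>e. P (e 0) (e 1))" unfolding P_def by (intro definable_intros B)
  have "\<exists>X. X \<epsilon> U \<and> (\<forall>x. x \<epsilon> X \<longrightarrow> P y x)" if y: "y \<epsilon> k" for y
  proof -
    obtain z where z: "z \<epsilon> B" "y \<epsilon> z" using unb[OF y] by blast
    have zk: "z \<epsilon> k" using B(2) z(1) unfolding sub_def by blast
    obtain a where a: "a \<epsilon> k" "z \<epsilon> a" using k_limit[OF zk] by blast
    obtain X where X: "X \<epsilon> U" "\<forall>x. x \<epsilon> X \<longleftrightarrow> x \<epsilon> k \<and> \<not> x \<epsilon> a" using final_segment[OF a(1)] by blast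
    have "P y x" if "x \<epsilon> X" for x
      using ord_not_mem_trans[OF k_ord _ a(1) _ a(2)] X(2) that z unfolding P_def by blast
    then show ?thesis using X(1) by blast
  qed
  from diagonal[of P, OF def this] show ?thesis unfolding P_def by blast
qed

text \<open>Such \<open>C\<close> and \<open>e\<close> code a relation between \<open>\<xi>\<close> and \<open>x \<in> C\<close> with \<open>\<xi> < x\<close> by a subset of
  \<open>\<kappa>\<close>: the block of \<open>\<kappa>\<close> from \<open>x\<close> to the next element of \<open>C\<close> is mapped by \<open>e\<close> onto a superset
  of \<open>x\<close>. This replaces a pairing function on \<open>\<kappa>\<close>; uniformity of \<open>U\<close> supplies, for each \<open>x\<close>, a
  bijection between \<open>\<kappa> \<setminus> x\<close> and \<open>\<kappa>\<close>, and \<open>C\<close> is a set of closure points of a choice of these.\<close>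

lemma coding:
  obtains C e where "C \<epsilon> U" "e \<in> M"
    "\<forall>w \<xi> \<xi>'. app e w \<xi> \<longrightarrow> app e w \<xi>' \<longrightarrow> \<xi> = \<xi>'"
    "\<forall>x \<xi>. x \<epsilon> C \<longrightarrow> \<xi> \<epsilon> x \<longrightarrow>
       (\<exists>w. w \<epsilon> k \<and> \<not> w \<epsilon> x \<and> (\<forall>x'. x' \<epsilon> C \<longrightarrow> x \<epsilon> x' \<longrightarrow> w \<epsilon> x') \<and> app e w \<xi>)"
proof -
  \<comment> \<open>On \<open>k\<close>, such a \<open>g\<close> is an injective partial function
    that is defined only outside \<open>x\<close> and has all of \<open>k\<close> as its
    range.\<close>
  define good where "good x g \<longleftrightarrow>
    (\<forall>w. w \<epsilon> k \<longrightarrow> (\<forall>\<xi>. \<xi> \<epsilon> k \<longrightarrow> app g w \<xi> \<longrightarrow> \<not> w \<epsilon> x)) \<and>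
    (\<forall>w. w \<epsilon> k \<longrightarrow> (\<forall>\<xi>. \<xi> \<epsilon> k \<longrightarrow> (\<forall>\<xi>'. \<xi>' \<epsilon> k \<longrightarrow> app g w \<xi> \<longrightarrow> app g w \<xi>' \<longrightarrow> \<xi> = \<xi>'))) \<and>
    (\<forall>w. w \<epsilon> k \<longrightarrow> (\<forall>w'. w' \<epsilon> k \<longrightarrow> (\<forall>\<xi>. \<xi> \<epsilon> k \<longrightarrow> app g w \<xi> \<longrightarrow> app g w' \<xi> \<longrightarrow> w = w'))) \<and>
    (\<forall>\<xi>. \<xi> \<epsilon> k \<longrightarrow> (\<exists>w. w \<epsilon> k \<and> app g w \<xi>))" for x g
  \<comment> \<open>Choice needs a set of candidates: every \<open>g\<close> considered is a subset
    of \<open>b0\<close>.\<close>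
  obtain b0 where b0: "b0 \<in> M"
    "\<forall>x y p. x \<epsilon> k \<longrightarrow> y \<epsilon> k \<longrightarrow> p \<in> M \<longrightarrow> kpair x y p \<longrightarrow> p \<epsilon> b0" using k_in by (rule kpair_bound)
  obtain b where b: "b \<in> M" "\<forall>y. y \<epsilon> b \<longleftrightarrow> y \<in> M \<and> sub y b0" using b0(1) by (rule power_set_ex)
  have good: "definable (\<lambda>e. good (e 0) (e 1))" unfolding good_def by (intro definable_intros k_in)
  have good_ex: "\<exists>g. g \<epsilon> b \<and> good x g" if x: "x \<epsilon> k" for x
  proof -
    obtain Z where Z: "Z \<epsilon> U" "\<forall>z. z \<epsilon> Z \<longleftrightarrow> z \<epsilon> k \<and> \<not> z \<epsilon> x" using final_segment[OF x] by blast
    have ZM: "Z \<in> M" using U_facts(1)[OF Z(1)] .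
    obtain g0 where g0: "g0 \<in> M" "bijection g0 Z k" using card_U[OF Z(1)] unfolding card_of_def by blast
    note gD = bijectionD[OF g0(2,1) ZM k_in]
    note gm = mapsD[OF gD(1) g0(1) ZM k_in]
    define Q where "Q = app g0"
    have "definable (\<lambda>e. Q (e 0) (e 1))" unfolding Q_def by (intro definable_intros g0)
    with k_in k_in obtain g where g: "g \<in> M" "\<forall>x y. app g x y \<longleftrightarrow> x \<epsilon> k \<and> y \<epsilon> k \<and> Q x y"
      "\<forall>p. p \<epsilon> g \<longrightarrow> (\<exists>x y. x \<epsilon> k \<and> y \<epsilon> k \<and> kpair x y p)"
      by (rule relation_ex)
    have "sub g b0" unfolding sub_def using g(3) b0(2) mem_in[OF g(1)] by blast
    then have "g \<epsilon> b" using b(2) g(1) by blast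
    moreover have "good x g"
      unfolding good_def g(2)[rule_format] Q_def
    proof (intro conjI allI impI; (elim conjE)?)
      fix w \<xi> assume "app g0 w \<xi>"
      then show "\<not> w \<epsilon> x" using gm(1) Z(2) by blast
    next
      fix w \<xi> \<xi>' assume "app g0 w \<xi>" "app g0 w \<xi>'"
      then show "\<xi> = \<xi>'" by (rule gm(3))
    next
      fix w w' \<xi> assume "app g0 w \<xi>" "app g0 w' \<xi>"
      then show "w = w'" by (rule gD(2))
    next
      fix \<xi> assume "\<xi> \<epsilon> k"
      then obtain w where "app g0 w \<xi>" using gD(3) by blast
      then show "\<exists>w. w \<epsilon> k \<and> w \<epsilon> k \<and> \<xi> \<epsilon> k \<and> app g0 w \<xi>" using gm(1) Z(2) by blast
    qed
    ultimately show ?thesis by blast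
  qed
  obtain f where f: "f \<in> M" "\<forall>x g. app f x g \<longrightarrow> x \<epsilon> k \<and> g \<epsilon> b \<and> good x g"
    "\<forall>x. x \<epsilon> k \<longrightarrow> (\<exists>!g. app f x g)"
    by (rule choice_function[OF k_in b(1) good good_ex])
  define e0 where "e0 x w \<xi> \<longleftrightarrow> (\<exists>g. g \<epsilon> b \<and> (app f x g \<and> app g w \<xi>))" for x w \<xi>
  have e0: "(w \<epsilon> k \<longrightarrow> \<xi> \<epsilon> k \<longrightarrow> e0 x w \<xi> \<longrightarrow> \<not> w \<epsilon> x) \<and>
      (w \<epsilon> k \<longrightarrow> \<xi> \<epsilon> k \<longrightarrow> \<xi>' \<epsilon> k \<longrightarrow> e0 x w \<xi> \<longrightarrow> e0 x w \<xi>' \<longrightarrow> \<xi> = \<xi>') \<and>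
      (w \<epsilon> k \<longrightarrow> w' \<epsilon> k \<longrightarrow> \<xi> \<epsilon> k \<longrightarrow> e0 x w \<xi> \<longrightarrow> e0 x w' \<xi> \<longrightarrow> w = w') \<and>
      (\<xi> \<epsilon> k \<longrightarrow> (\<exists>w. w \<epsilon> k \<and> e0 x w \<xi>))" if x: "x \<epsilon> k" for x w w' \<xi> \<xi>'
  proof -
    obtain g where g: "app f x g" "g \<epsilon> b" "good x g" using f(2,3) x by blast
    have e0_iff: "e0 x w \<xi> \<longleftrightarrow> app g w \<xi>" for w \<xi> using g f(3) x unfolding e0_def by blast
    note good = g(3)[unfolded good_def]
    show ?thesis
      unfolding e0_iff
      using good[THEN conjunct1] good[THEN conjunct2, THEN conjunct1]
        good[THEN conjunct2, THEN conjunct2, THEN conjunct1]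
        good[THEN conjunct2, THEN conjunct2, THEN conjunct2]
      by metis
  qed
  \<comment> \<open>The closure condition: the map chosen for \<open>y\<close> has the preimages of
    all elements of \<open>y\<close> below \<open>x\<close>. In \<open>C\<close> it holds for every
    \<open>y\<close> below \<open>x\<close>. Hence for \<open>x\<close> below \<open>x'\<close> in
    \<open>C\<close>, the map chosen for \<open>x\<close> has the preimages of the elements of
    \<open>x\<close> below \<open>x'\<close>, and they are never below \<open>x\<close>.\<close>
  define P where "P y x \<longleftrightarrow> (\<forall>\<xi>. \<xi> \<epsilon> y \<longrightarrow> (\<exists>w. w \<epsilon> x \<and> e0 y w \<xi>))" for y x
  have "definable (\<lambda>e. P (e 0) (e 1))" unfolding P_def e0_def by (intro definable_intros b f)
  moreover have "\<exists>X. X \<epsilon> U \<and> (\<forall>x. x \<epsilon> X \<longrightarrow> P y x)" if y: "y \<epsilon> k" for y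
  proof -
    have yM: "y \<in> M" using mem_in[OF k_in y] .
    define R where "R \<xi> w \<longleftrightarrow> e0 y w \<xi>" for \<xi> w
    have "definable (\<lambda>e. R (e 0) (e 1))" unfolding R_def e0_def by (intro definable_intros b f yM)
    moreover have "\<exists>w. w \<epsilon> k \<and> R \<xi> w" if "\<xi> \<epsilon> y" for \<xi>
      using e0[OF y] ord_trans[OF k_ord y that] unfolding R_def by blast
    ultimately obtain c where c: "c \<epsilon> k" "\<forall>\<xi>. \<xi> \<epsilon> y \<longrightarrow> (\<exists>w. w \<epsilon> c \<and> R \<xi> w)"
      using regular_collection[OF k_regular k_in y, of R] by blast
    obtain X where X: "X \<epsilon> U" "\<forall>x. x \<epsilon> X \<longleftrightarrow> x \<epsilon> k \<and> \<not> x \<epsilon> c" using final_segment[OF c(1)] by blast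
    have "P y x" if "x \<epsilon> X" for x
    proof -
      have "w \<epsilon> x" if "w \<epsilon> c" for w
        using ord_not_mem_trans[OF k_ord _ c(1) _ that] X(2) \<open>x \<epsilon> X\<close> by blast
      then show ?thesis using c(2) unfolding P_def R_def by blast
    qed
    then show ?thesis using X(1) by blast
  qed
  ultimately obtain C where C: "C \<epsilon> U" "\<forall>x. x \<epsilon> C \<longleftrightarrow> x \<epsilon> k \<and> (\<forall>y. y \<epsilon> x \<longrightarrow> P y x)"
    using diagonal[of P] by blast
  have CM: "C \<in> M" using U_facts(1)[OF C(1)] .
  define block where "block x w \<longleftrightarrow> \<not> w \<epsilon> x \<and> (\<forall>x'. x' \<epsilon> C \<longrightarrow> x \<epsilon> x' \<longrightarrow> w \<epsilon> x')" for x w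
  have block_unique: "x = x'" if "x \<epsilon> C" "x' \<epsilon> C" "block x w" "block x' w" for x x' w
    using that ord_cases[OF k_ord, of x x'] C(2) unfolding block_def by blast
  define R where "R w \<xi> \<longleftrightarrow> (\<exists>x. x \<epsilon> C \<and> (block x w \<and> e0 x w \<xi>))" for w \<xi>
  have "definable (\<lambda>e. R (e 0) (e 1))"
    unfolding R_def block_def e0_def by (intro definable_intros b f CM)
  with k_in k_in obtain e where e: "e \<in> M" "\<forall>x y. app e x y \<longleftrightarrow> x \<epsilon> k \<and> y \<epsilon> k \<and> R x y"
    by (rule relation_ex)
  show thesis
  proof (rule that[OF C(1) e(1)])
    show "\<forall>w \<xi> \<xi>'. app e w \<xi> \<longrightarrow> app e w \<xi>' \<longrightarrow> \<xi> = \<xi>'"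
    proof (intro allI impI)
      fix w \<xi> \<xi>' assume *: "app e w \<xi>" "app e w \<xi>'"
      then obtain x where x: "x \<epsilon> C" "block x w" "e0 x w \<xi>" using e(2) unfolding R_def by blast
      obtain x' where x': "x' \<epsilon> C" "block x' w" "e0 x' w \<xi>'" using e(2) * unfolding R_def by blast
      have "x' = x" using block_unique x x' by blast
      then show "\<xi> = \<xi>'" using e0[of x w \<xi> \<xi>'] x x' e(2) * C(2) by blast
    qed
    show "\<forall>x \<xi>. x \<epsilon> C \<longrightarrow> \<xi> \<epsilon> x \<longrightarrow>
       (\<exists>w. w \<epsilon> k \<and> \<not> w \<epsilon> x \<and> (\<forall>x'. x' \<epsilon> C \<longrightarrow> x \<epsilon> x' \<longrightarrow> w \<epsilon> x') \<and> app e w \<xi>)"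
    proof (intro allI impI)
      fix x \<xi> assume x: "x \<epsilon> C" and \<xi>: "\<xi> \<epsilon> x"
      have xk: "x \<epsilon> k" using C(2) x by blast
      have \<xi>k: "\<xi> \<epsilon> k" using ord_trans[OF k_ord xk \<xi>] .
      obtain w where w: "w \<epsilon> k" "e0 x w \<xi>" using e0[OF xk] \<xi>k by blast
      have "w \<epsilon> x'" if x': "x' \<epsilon> C" "x \<epsilon> x'" for x'
      proof -
        have x'k: "x' \<epsilon> k" using C(2) x'(1) by blast
        \<comment> \<open>Closure of \<open>x'\<close> gives some preimage of \<xi> below
          \<open>x'\<close>; by injectivity it is \<open>w\<close>.\<close>
        obtain w' where w': "w' \<epsilon> x'" "e0 x w' \<xi>" using C(2) x' \<xi> unfolding P_def by blast
        have "w' \<epsilon> k" using ord_trans[OF k_ord x'k w'(1)] .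
        then have "w' = w" using e0[OF xk] w w'(2) \<xi>k by blast
        then show ?thesis using w'(1) by simp
      qed
      moreover have "\<not> w \<epsilon> x" using e0[OF xk] w \<xi>k by blast
      ultimately have "block x w" unfolding block_def by blast
      then show "\<exists>w. w \<epsilon> k \<and> \<not> w \<epsilon> x \<and> (\<forall>x'. x' \<epsilon> C \<longrightarrow> x \<epsilon> x' \<longrightarrow> w \<epsilon> x') \<and> app e w \<xi>"
        using w \<xi>k e(2) x unfolding R_def block_def by blast
    qed
  qed
qed

end

section \<open>The union of a tower of normal measures\<close>

locale measure_tower = zfc_model elem M
  for elem :: "'v \<Rightarrow> 'v \<Rightarrow> bool"  (infix "\<epsilon>" 50) and M :: "'v set" +
  fixes \<kappa> lam S :: 'v and N :: "'v \<Rightarrow> 'v set" and \<U> k :: "'v \<Rightarrow> 'v"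
  assumes \<kappa>_in: "\<kappa> \<in> M" and \<kappa>_regular: "regular \<kappa>"
    and lam_in: "lam \<in> M" and lam_regular: "regular lam"
    and N_model: "i \<epsilon> lam \<Longrightarrow> eps_structure.transitive_model elem (N i)"
    and N_sub: "i \<epsilon> lam \<Longrightarrow> N i \<subseteq> M"
    and \<U>_seq: "sequence_in lam \<U>" and k_seq: "sequence_in lam k"
    and N_mono: "i \<epsilon> lam \<Longrightarrow> j \<epsilon> lam \<Longrightarrow> i \<epsilon> j \<Longrightarrow> N i \<subseteq> N j"
    and \<U>_in: "i \<epsilon> lam \<Longrightarrow> \<U> i \<in> N i"
    and \<U>_normal: "i \<epsilon> lam \<Longrightarrow> eps_structure.normal_ultrafilter elem (N i) \<kappa> (\<U> i)"
    and k_full: "i \<epsilon> lam \<Longrightarrow> k i \<in> full_subsets \<kappa>"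
    and k_almost: "i \<epsilon> lam \<Longrightarrow> X \<epsilon> \<U> i \<Longrightarrow> almost_subset \<kappa> (k i) X"
    and k_in_N: "i \<epsilon> lam \<Longrightarrow> j \<epsilon> i \<Longrightarrow> k j \<in> N i"
    and subsets_N: "subsets \<kappa> = (\<Union>i\<in>{i. i \<epsilon> lam}. eps_structure.subsets elem (N i) \<kappa>)"
    and S_in: "S \<in> M" and S_lam: "s \<epsilon> S \<Longrightarrow> s \<epsilon> lam"
    and S_unbounded: "a \<epsilon> lam \<Longrightarrow> \<exists>s. s \<epsilon> S \<and> a \<epsilon> s"
    and \<U>_mono: "i \<epsilon> S \<Longrightarrow> j \<epsilon> S \<Longrightarrow> i \<epsilon> j \<Longrightarrow> X \<epsilon> \<U> i \<Longrightarrow> X \<epsilon> \<U> j"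
begin

lemmas lam_ord = limit_ordinalD(1)[OF regularD(1)[OF lam_regular lam_in] lam_in]
lemmas lam_limit = limit_ordinalD(3)[OF regularD(1)[OF lam_regular lam_in] lam_in]
lemmas lam_nonempty = limit_ordinalD(2)[OF regularD(1)[OF lam_regular lam_in] lam_in]
lemmas \<kappa>_ord = limit_ordinalD(1)[OF regularD(1)[OF \<kappa>_regular \<kappa>_in] \<kappa>_in]
lemmas \<kappa>_limit = limit_ordinalD(3)[OF regularD(1)[OF \<kappa>_regular \<kappa>_in] \<kappa>_in]

lemma N_zfc: "i \<epsilon> lam \<Longrightarrow> zfc_model elem (N i)"
  by (intro zfc_model.intro zfc_model_axioms.intro N_model eps_universe_axioms)

lemma \<kappa>_in_N:
  assumes i: "i \<epsilon> lam" shows "\<kappa> \<in> N i"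
proof -
  interpret N: zfc_model elem "N i" using i by (rule N_zfc)
  have "\<kappa> \<in> N.elts (\<U> i)"
    using \<U>_normal[OF i]
    unfolding N.normal_ultrafilter_def N.uniform_ultrafilter_def N.ultrafilter_def by blast
  then show ?thesis unfolding N.elts_def by blast
qed

lemma N_maps:
  assumes i: "i \<epsilon> lam" and "f \<in> N i" "a \<in> N i" "b \<in> N i"
  shows "eps_structure.maps elem (N i) f a b \<longleftrightarrow> maps f a b"
proof -
  have M: "f \<in> M" "a \<in> M" "b \<in> M" using assms N_sub[OF i] by blast+
  show ?thesis
    by (simp add: zfc_model.maps_iff[OF N_zfc[OF i] assms(2-4)] maps_iff[OF M])
qed

lemma N_bijection:
  assumes i: "i \<epsilon> lam" and "f \<in> N i" "a \<in> N i" "b \<in> N i"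
    and "eps_structure.bijection elem (N i) f a b"
  shows "bijection f a b"
proof -
  note D = zfc_model.bijectionD[OF N_zfc[OF i] assms(5,2-4)]
  have M: "f \<in> M" "a \<in> M" "b \<in> M" using assms N_sub[OF i] by blast+
  have "maps f a b" using D(1) N_maps[OF assms(1-4)] by simp
  then show ?thesis using M D(2,3) by (rule bijectionI)
qed

text \<open>Regularity of \<kappa> passes down: a function of \<open>N i\<close> is a function of
  \<open>M\<close>, and the bound found in \<open>M\<close> is an element of \<kappa>, hence lies in
  \<open>N i\<close>.\<close>

lemma N_measure:
  assumes i: "i \<epsilon> lam" shows "normal_measure elem (N i) \<kappa> (\<U> i)"
proof -
  interpret N: zfc_model elem "N i" using i by (rule N_zfc)
  have \<kappa>N: "\<kappa> \<in> N i" using i by (rule \<kappa>_in_N)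
  have "N.limit_ordinal \<kappa>"
    using regularD(1)[OF \<kappa>_regular \<kappa>_in]
    by (simp add: N.limit_ordinal_iff[OF \<kappa>N] limit_ordinal_iff[OF \<kappa>_in])
  moreover have "\<exists>\<beta>\<in>N.elts \<kappa>. \<forall>x\<in>N.elts \<alpha>. \<forall>y\<in>N.elts \<kappa>. N.val f x y \<longrightarrow> y \<epsilon> \<beta>"
    if "\<alpha> \<in> N.elts \<kappa>" "f \<in> N i" "N.maps f \<alpha> \<kappa>" for \<alpha> f
  proof -
    have \<alpha>: "\<alpha> \<epsilon> \<kappa>" "\<alpha> \<in> N i" using that(1) by (auto simp: N.elts_def)
    have "maps f \<alpha> \<kappa>" using N_maps[OF i that(2) \<alpha>(2) \<kappa>N] that(3) by blast
    moreover have "f \<in> M" using that(2) N_sub[OF i] by blast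
    ultimately obtain b where b: "b \<epsilon> \<kappa>" "\<forall>x y. app f x y \<longrightarrow> y \<epsilon> b"
      using regularD(2)[OF \<kappa>_regular \<kappa>_in \<alpha>(1)] by blast
    then show ?thesis
      using N.val_iff[OF that(2)] N.elts_eq[OF \<kappa>N] by (intro bexI[of _ b]) auto
  qed
  ultimately have "N.regular \<kappa>" unfolding N.regular_def by blast
  then show ?thesis
    by (intro normal_measure.intro normal_measure_axioms.intro N.zfc_model_axioms \<kappa>N \<U>_in
        \<U>_normal i)
qed

lemma k_props:
  assumes i: "i \<epsilon> lam"
  shows "k i \<in> M" "sub (k i) \<kappa>" "a \<epsilon> \<kappa> \<Longrightarrow> \<exists>x. x \<epsilon> k i \<and> a \<epsilon> x"
  using k_full[OF i] full_unbounded[OF \<kappa>_regular \<kappa>_in k_full[OF i]]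
  unfolding full_subsets_def by (auto simp: subsets_iff[OF \<kappa>_in])

text \<open>Truth for all sufficiently large indices in \<open>S\<close>. Finitely many such
  properties hold together at some index, which is how finitely many sets are brought into one
  model.\<close>

definition ev :: "('v \<Rightarrow> bool) \<Rightarrow> bool" where
  "ev P \<longleftrightarrow> (\<exists>a. a \<epsilon> lam \<and> (\<forall>t. t \<epsilon> S \<longrightarrow> a \<epsilon> t \<longrightarrow> P t))"

lemma ev_conj: "ev P \<Longrightarrow> ev Q \<Longrightarrow> ev (\<lambda>t. P t \<and> Q t)"
proof -
  assume "ev P" "ev Q"
  then obtain a b where ab: "a \<epsilon> lam" "\<forall>t. t \<epsilon> S \<longrightarrow> a \<epsilon> t \<longrightarrow> P t"
    "b \<epsilon> lam" "\<forall>t. t \<epsilon> S \<longrightarrow> b \<epsilon> t \<longrightarrow> Q t" unfolding ev_def by blast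
  have *: "x \<epsilon> t" if "t \<epsilon> S" "y \<epsilon> t" "x \<epsilon> y" for t x y
    using ord_trans[OF ord_mem[OF lam_ord S_lam[OF that(1)]] that(2,3)] .
  have "\<exists>c. c \<epsilon> lam \<and> (\<forall>t. t \<epsilon> S \<longrightarrow> c \<epsilon> t \<longrightarrow> a \<epsilon> t \<and> b \<epsilon> t)"
    using ord_linear[OF ord_mem[OF lam_ord ab(1)] ord_mem[OF lam_ord ab(3)]]
  proof (elim disjE)
    assume "a \<epsilon> b"
    then show ?thesis using ab(3) * by (intro exI[of _ b]) blast
  next
    assume "a = b"
    then show ?thesis using ab(3) by (intro exI[of _ b]) blast
  next
    assume "b \<epsilon> a"
    then show ?thesis using ab(1) * by (intro exI[of _ a]) blast
  qed
  then obtain c where "c \<epsilon> lam" "\<forall>t. t \<epsilon> S \<longrightarrow> c \<epsilon> t \<longrightarrow> a \<epsilon> t \<and> b \<epsilon> t" by blast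
  then show ?thesis unfolding ev_def using ab(2,4) by (intro exI[of _ c]) blast
qed

lemma ev_ex:
  assumes "ev P" obtains t where "t \<epsilon> S" "P t"
  using assms S_unbounded unfolding ev_def by blast

lemma ev_above: "a \<epsilon> lam \<Longrightarrow> ev (\<lambda>t. a \<epsilon> t)"
  unfolding ev_def by blast

lemma ev_in_N:
  assumes "X \<in> M" "sub X \<kappa>"
  shows "ev (\<lambda>t. X \<in> N t)"
proof -
  have "X \<in> subsets \<kappa>" using assms by (simp add: subsets_iff[OF \<kappa>_in])
  then obtain i where i: "i \<epsilon> lam" "X \<in> eps_structure.subsets elem (N i) \<kappa>"
    using subsets_N by blast
  then have "X \<in> N i" unfolding eps_structure.subsets_def by blast
  then show ?thesis
    unfolding ev_def using i(1) N_mono[OF i(1)] S_lam by (intro exI[of _ i]) blast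
qed

lemma ev_\<U>:
  assumes "s \<epsilon> S" "X \<epsilon> \<U> s"
  shows "ev (\<lambda>t. X \<epsilon> \<U> t)"
  unfolding ev_def using S_lam[OF assms(1)] \<U>_mono[OF assms(1) _ _ assms(2)]
  by (intro exI[of _ s]) blast

lemma \<U>_sub:
  assumes "i \<epsilon> lam" "X \<epsilon> \<U> i" shows "X \<in> N i" "X \<in> M" "sub X \<kappa>"
proof -
  interpret N: normal_measure elem "N i" \<kappa> "\<U> i" using assms(1) by (rule N_measure)
  show "X \<in> N i" using N.U_facts(1)[OF assms(2)] .
  then show "X \<in> M" using N_sub[OF assms(1)] by blast
  show "sub X \<kappa>" unfolding sub_def using N.U_facts(2)[OF assms(2)] by blast
qed

text \<open>The union is an element of \<open>M\<close> because the graph of the sequence \<U> is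
  one and can serve as a parameter of Separation.\<close>

lemma limit_measure_ex: "\<exists>U. U \<in> M \<and> (\<forall>X. X \<epsilon> U \<longleftrightarrow> (\<exists>s. s \<epsilon> S \<and> X \<epsilon> \<U> s))"
proof -
  obtain F where F: "F \<in> M" "\<forall>i x. app F i x \<longleftrightarrow> i \<epsilon> lam \<and> x = \<U> i"
    using \<U>_seq lam_in by (rule sequence_graph)
  obtain p where p: "p \<in> M" "\<forall>y. y \<epsilon> p \<longleftrightarrow> y \<in> M \<and> sub y \<kappa>" using \<kappa>_in by (rule power_set_ex)
  define Q where "Q X \<longleftrightarrow> (\<exists>s. s \<epsilon> S \<and> (\<exists>u\<in>M. app F s u \<and> X \<epsilon> u))" for X
  have "definable (\<lambda>e. Q (e 0))" unfolding Q_def by (intro definable_intros S_in F)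
  with p(1) obtain U where U: "U \<in> M" "\<forall>X. X \<epsilon> U \<longleftrightarrow> X \<epsilon> p \<and> Q X"
    by (rule separation_definable)
  have "X \<epsilon> U \<longleftrightarrow> (\<exists>s. s \<epsilon> S \<and> X \<epsilon> \<U> s)" for X
  proof
    assume "X \<epsilon> U"
    then obtain s u where "s \<epsilon> S" "app F s u" "X \<epsilon> u" using U(2) unfolding Q_def by blast
    moreover from this have "u = \<U> s" using F(2) by simp
    ultimately show "\<exists>s. s \<epsilon> S \<and> X \<epsilon> \<U> s" by blast
  next
    assume "\<exists>s. s \<epsilon> S \<and> X \<epsilon> \<U> s"
    then obtain s where s: "s \<epsilon> S" "X \<epsilon> \<U> s" by blast
    note sl = S_lam[OF s(1)]
    have "X \<epsilon> p" using p(2) \<U>_sub[OF sl s(2)] by blast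
    moreover have "\<U> s \<in> M" using \<U>_in[OF sl] N_sub[OF sl] by blast
    ultimately show "X \<epsilon> U" using U(2) F(2) sl s unfolding Q_def by blast
  qed
  then show ?thesis using U(1) by blast
qed

section \<open>The limit measure is a normal ultrafilter of the large model\<close>

definition U :: 'v where "U = (SOME U. U \<in> M \<and> (\<forall>X. X \<epsilon> U \<longleftrightarrow> (\<exists>s. s \<epsilon> S \<and> X \<epsilon> \<U> s)))"

lemma U_in: "U \<in> M" and U_iff: "X \<epsilon> U \<longleftrightarrow> (\<exists>s. s \<epsilon> S \<and> X \<epsilon> \<U> s)"
  using someI_ex[OF limit_measure_ex] unfolding U_def by blast+

lemma U_I: "s \<epsilon> S \<Longrightarrow> X \<epsilon> \<U> s \<Longrightarrow> X \<epsilon> U"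
  using U_iff by blast

lemma U_ev: "X \<epsilon> U \<Longrightarrow> ev (\<lambda>t. X \<epsilon> \<U> t)"
  using U_iff ev_\<U> by blast

lemma U_ultrafilter: "ultrafilter \<kappa> U"
proof (rule ultrafilterI[OF \<kappa>_in U_in])
  show "sub X \<kappa>" if X: "X \<epsilon> U" for X using X U_iff \<U>_sub(3) S_lam by blast
  show "\<kappa> \<epsilon> U"
  proof -
    obtain s where s: "s \<epsilon> S" using lam_nonempty S_unbounded by blast
    interpret N: normal_measure elem "N s" \<kappa> "\<U> s" using S_lam[OF s] by (rule N_measure)
    show ?thesis using U_I[OF s N.U_facts(3)] .
  qed
  show "\<exists>x. x \<epsilon> X" if X: "X \<epsilon> U" for X
  proof -
    obtain s where s: "s \<epsilon> S" "X \<epsilon> \<U> s" using X U_iff by blast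
    interpret N: normal_measure elem "N s" \<kappa> "\<U> s" using S_lam[OF s(1)] by (rule N_measure)
    show ?thesis using N.U_facts(4)[OF s(2)] .
  qed
  show "Y \<epsilon> U" if X: "X \<epsilon> U" "Y \<in> M" "sub Y \<kappa>" "sub X Y" for X Y
  proof -
    obtain t where t: "t \<epsilon> S" "X \<epsilon> \<U> t \<and> Y \<in> N t"
      using ev_conj[OF U_ev[OF X(1)] ev_in_N[OF X(2,3)]] by (rule ev_ex)
    interpret N: normal_measure elem "N t" \<kappa> "\<U> t" using S_lam[OF t(1)] by (rule N_measure)
    show ?thesis using U_I[OF t(1) N.U_facts(5)] t(2) X by blast
  qed
  show "\<exists>Z. Z \<epsilon> U \<and> (\<forall>z. z \<epsilon> Z \<longleftrightarrow> z \<epsilon> X \<and> z \<epsilon> Y)" if X: "X \<epsilon> U" "Y \<epsilon> U" for X Y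
  proof -
    obtain t where t: "t \<epsilon> S" "X \<epsilon> \<U> t \<and> Y \<epsilon> \<U> t"
      using ev_conj[OF U_ev[OF X(1)] U_ev[OF X(2)]] by (rule ev_ex)
    interpret N: normal_measure elem "N t" \<kappa> "\<U> t" using S_lam[OF t(1)] by (rule N_measure)
    show ?thesis using U_I[OF t(1)] N.U_facts(6)[of X Y] t(2) by blast
  qed
  show "X \<epsilon> U \<or> (\<exists>Y. Y \<epsilon> U \<and> (\<forall>z. z \<epsilon> Y \<longleftrightarrow> z \<epsilon> \<kappa> \<and> \<not> z \<epsilon> X))" if X: "X \<in> M" "sub X \<kappa>" for X
  proof -
    obtain t where t: "t \<epsilon> S" "X \<in> N t" using ev_in_N[OF X] by (rule ev_ex)
    interpret N: normal_measure elem "N t" \<kappa> "\<U> t" using S_lam[OF t(1)] by (rule N_measure)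
    show ?thesis using U_I[OF t(1)] N.U_facts(7)[OF t(2) X(2)] by blast
  qed
qed

lemmas U_facts = ultrafilterD[OF U_ultrafilter \<kappa>_in U_in]

lemma U_uniform: "uniform_ultrafilter \<kappa> U"
proof -
  have "X \<in> full_subsets \<kappa>" if X: "X \<epsilon> U" for X
  proof -
    obtain s where s: "s \<epsilon> S" "X \<epsilon> \<U> s" using X U_iff by blast
    note sl = S_lam[OF s(1)]
    interpret N: normal_measure elem "N s" \<kappa> "\<U> s" using sl by (rule N_measure)
    obtain f where f: "f \<in> N s" "N.bijection f X \<kappa>"
      using N.card_U[OF s(2)] unfolding N.card_of_def by blast
    have "bijection f X \<kappa>"
      using N_bijection[OF sl f(1) \<U>_sub(1)[OF sl s(2)] N.k_in f(2)] .
    moreover have "f \<in> M" using f(1) N_sub[OF sl] by blast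
    ultimately have "card_of X \<kappa>"
      unfolding card_of_def using regular_cardinal[OF \<kappa>_regular \<kappa>_in] by blast
    then show ?thesis
      unfolding full_subsets_def using \<U>_sub[OF sl s(2)] by (simp add: subsets_iff[OF \<kappa>_in])
  qed
  then show ?thesis
    unfolding uniform_ultrafilter_def using U_ultrafilter elts_eq[OF U_in] by blast
qed

lemma U_final_segment:
  assumes "a \<epsilon> \<kappa>"
  shows "\<exists>X. X \<epsilon> U \<and> (\<forall>x. x \<epsilon> X \<longleftrightarrow> x \<epsilon> \<kappa> \<and> \<not> x \<epsilon> a)"
proof -
  obtain s where s: "s \<epsilon> S" using lam_nonempty S_unbounded by blast
  interpret N: normal_measure elem "N s" \<kappa> "\<U> s" using S_lam[OF s] by (rule N_measure)
  show ?thesis using N.final_segment[OF assms] U_I[OF s] by blast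
qed

text \<open>Normality of a single \<open>\<U> t\<close> cannot be applied to \<open>f\<close>
  directly, since \<open>f\<close> is only known to lie in \<open>M\<close>. What \<open>N t\<close>
  receives is a subset of \<kappa> that records, on a measure one set, which points belong to which
  \<open>f \<xi>\<close>.\<close>

lemma U_diagonal:
  assumes f: "f \<in> M" "maps f \<kappa> U"
  shows "\<exists>Y. Y \<epsilon> U \<and> (\<forall>x. x \<epsilon> Y \<longleftrightarrow>
    x \<epsilon> \<kappa> \<and> (\<forall>\<xi>. \<xi> \<epsilon> x \<longrightarrow> (\<forall>X. X \<epsilon> U \<longrightarrow> app f \<xi> X \<longrightarrow> x \<epsilon> X)))"
proof -
  note fm = mapsD[OF f(2,1) \<kappa>_in U_in]
  obtain s where s: "s \<epsilon> S" using lam_nonempty S_unbounded by blast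
  note sl = S_lam[OF s]
  interpret Ns: normal_measure elem "N s" \<kappa> "\<U> s" using sl by (rule N_measure)
  obtain C e where C: "C \<epsilon> \<U> s" and e: "e \<in> N s"
    "\<forall>w \<xi> \<xi>'. app e w \<xi> \<longrightarrow> app e w \<xi>' \<longrightarrow> \<xi> = \<xi>'"
    "\<forall>x \<xi>. x \<epsilon> C \<longrightarrow> \<xi> \<epsilon> x \<longrightarrow>
       (\<exists>w. w \<epsilon> \<kappa> \<and> \<not> w \<epsilon> x \<and> (\<forall>x'. x' \<epsilon> C \<longrightarrow> x \<epsilon> x' \<longrightarrow> w \<epsilon> x') \<and> app e w \<xi>)"
    by (rule Ns.coding)
  have CM: "C \<in> M" and C\<kappa>: "x \<epsilon> C \<Longrightarrow> x \<epsilon> \<kappa>" for x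
    using \<U>_sub[OF sl C] unfolding sub_def by blast+
  have eM: "e \<in> M" using e(1) N_sub[OF sl] by blast
  define block where "block x w \<longleftrightarrow> \<not> w \<epsilon> x \<and> (\<forall>x'. x' \<epsilon> C \<longrightarrow> x \<epsilon> x' \<longrightarrow> w \<epsilon> x')" for x w
  have block_unique: "x = x'" if "x \<epsilon> C" "x' \<epsilon> C" "block x w" "block x' w" for x x' w
    using that ord_cases[OF \<kappa>_ord C\<kappa>[OF that(1)] C\<kappa>[OF that(2)]] unfolding block_def by blast
  define G where "G \<xi> x \<longleftrightarrow> (\<exists>X. X \<epsilon> U \<and> (app f \<xi> X \<and> x \<epsilon> X))" for \<xi> x
  \<comment> \<open>The code of \<open>f\<close>: the point \<open>w\<close> in the block of
    \<open>x\<close> with \<open>e\<close>-value \<xi> below \<open>x\<close> is put into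
    \<open>R\<close> if \<open>x\<close> belongs to \<open>f \<xi>\<close>.\<close>
  define Q where "Q w \<longleftrightarrow> (\<exists>x. x \<epsilon> C \<and> (block x w \<and> (\<exists>\<xi>. \<xi> \<epsilon> x \<and> (app e w \<xi> \<and> G \<xi> x))))" for w
  have "definable (\<lambda>e. Q (e 0))"
    unfolding Q_def block_def G_def by (intro definable_intros CM eM U_in f)
  with \<kappa>_in obtain R where R: "R \<in> M" "\<forall>w. w \<epsilon> R \<longleftrightarrow> w \<epsilon> \<kappa> \<and> Q w"
    by (rule separation_definable)
  have decode: "(\<exists>w. w \<epsilon> R \<and> (block x w \<and> app e w \<xi>)) \<longleftrightarrow> G \<xi> x" if x: "x \<epsilon> C" "\<xi> \<epsilon> x" for x \<xi>
  proof
    assume "\<exists>w. w \<epsilon> R \<and> (block x w \<and> app e w \<xi>)"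
    then obtain w where w: "w \<epsilon> R" "block x w" "app e w \<xi>" by blast
    then obtain x' \<xi>' where *: "x' \<epsilon> C" "block x' w" "app e w \<xi>'" "G \<xi>' x'"
      using R(2) unfolding Q_def by blast
    have "x' = x" using block_unique[OF *(1) x(1) *(2) w(2)] .
    moreover have "\<xi>' = \<xi>" using e(2) w(3) *(3) by blast
    ultimately show "G \<xi> x" using *(4) by simp
  next
    assume G: "G \<xi> x"
    obtain w where "w \<epsilon> \<kappa>" "block x w" "app e w \<xi>"
      using e(3) x unfolding block_def by blast
    then show "\<exists>w. w \<epsilon> R \<and> (block x w \<and> app e w \<xi>)"
      using R(2) x G unfolding Q_def by blast
  qed
  have "sub R \<kappa>" using R(2) unfolding sub_def by blast
  then obtain t where t: "t \<epsilon> S" "R \<in> N t \<and> s \<epsilon> t"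
    using ev_conj[OF ev_in_N[OF R(1)] ev_above[OF sl]] ev_ex by blast
  note tl = S_lam[OF t(1)]
  interpret Nt: normal_measure elem "N t" \<kappa> "\<U> t" using tl by (rule N_measure)
  have Ct: "C \<epsilon> \<U> t" using \<U>_mono[OF s t(1) _ C] t(2) by blast
  have eN: "e \<in> N t" using e(1) N_mono[OF sl tl] t(2) by blast
  have CN: "C \<in> N t" using Nt.U_facts(1)[OF Ct] .
  have RN: "R \<in> N t" using t(2) by blast
  \<comment> \<open>Decoding inside \<open>N t\<close>. The section of \<open>P\<close> at \<xi>
    contains the intersection of \<open>C\<close> with \<open>f \<xi>\<close>, so it belongs to
    \<open>U\<close>; its diagonal intersection can be formed in \<open>N t\<close>.\<close>
  define P where "P \<xi> x \<longleftrightarrow> x \<epsilon> C \<and> (\<xi> \<epsilon> x \<longrightarrow> (\<exists>w. w \<epsilon> R \<and> (block x w \<and> app e w \<xi>)))" for \<xi> x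
  have P_def': "Nt.definable (\<lambda>e. P (e 0) (e 1))"
    unfolding P_def block_def by (intro Nt.definable_intros CN eN RN)
  have "\<exists>X. X \<epsilon> \<U> t \<and> (\<forall>x. x \<epsilon> X \<longrightarrow> P \<xi> x)" if \<xi>: "\<xi> \<epsilon> \<kappa>" for \<xi>
  proof -
    have \<xi>N: "\<xi> \<in> N t" using Nt.mem_in[OF Nt.k_in \<xi>] .
    define P' where "P' = P \<xi>"
    have "Nt.definable (\<lambda>e. P' (e 0))"
      unfolding P'_def by (intro Nt.definable_rel2[OF P_def'] Nt.definable_basic \<xi>N)
    with Nt.k_in obtain X where X: "X \<in> N t" "\<forall>x. x \<epsilon> X \<longleftrightarrow> x \<epsilon> \<kappa> \<and> P' x"
      by (rule Nt.separation_definable)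
    have X\<kappa>: "sub X \<kappa>" using X(2) unfolding sub_def by blast
    have XM: "X \<in> M" using X(1) N_sub[OF tl] by blast
    obtain X' where X': "X' \<epsilon> U" "app f \<xi> X'" using fm(2)[OF \<xi>] by blast
    obtain Z where Z: "Z \<epsilon> U" "\<forall>z. z \<epsilon> Z \<longleftrightarrow> z \<epsilon> C \<and> z \<epsilon> X'"
      using U_facts(6)[OF U_I[OF s C] X'(1)] by blast
    have "P \<xi> z" if "z \<epsilon> Z" for z
      using that Z(2) X' decode unfolding P_def G_def by blast
    then have "sub Z X" unfolding sub_def using X(2) C\<kappa> Z(2) by (simp add: P'_def)
    then have XU: "X \<epsilon> U" by (rule U_facts(5)[OF Z(1) XM X\<kappa>])
    \<comment> \<open>A set of \<open>N t\<close> that is in \<open>U\<close> is already in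
      \<open>\<U> t\<close>: otherwise its complement would be in \<open>\<U> t\<close>, hence in
      \<open>U\<close>.\<close>
    have "X \<epsilon> \<U> t"
    proof (rule ccontr)
      assume "\<not> X \<epsilon> \<U> t"
      then obtain Y where Y: "Y \<epsilon> \<U> t" "\<forall>z. z \<epsilon> Y \<longleftrightarrow> z \<epsilon> \<kappa> \<and> \<not> z \<epsilon> X"
        using Nt.U_facts(7)[OF X(1) X\<kappa>] by blast
      obtain Z where "Z \<epsilon> U" "\<forall>z. z \<epsilon> Z \<longleftrightarrow> z \<epsilon> X \<and> z \<epsilon> Y"
        using U_facts(6)[OF XU U_I[OF t(1) Y(1)]] by blast
      then show False using U_facts(4)[of Z] Y(2) by blast
    qed
    then show ?thesis using X(2) by (intro exI[of _ X]) (simp add: P'_def)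
  qed
  then obtain Y where Y: "Y \<epsilon> \<U> t" "\<forall>x. x \<epsilon> Y \<longleftrightarrow> x \<epsilon> \<kappa> \<and> (\<forall>y. y \<epsilon> x \<longrightarrow> P y x)"
    using Nt.diagonal[OF P_def'] by blast
  define D where "D x \<longleftrightarrow> (\<forall>\<xi>. \<xi> \<epsilon> x \<longrightarrow> (\<forall>X. X \<epsilon> U \<longrightarrow> app f \<xi> X \<longrightarrow> x \<epsilon> X))" for x
  have "definable (\<lambda>e. D (e 0))" unfolding D_def by (intro definable_intros U_in f)
  with \<kappa>_in obtain T where T: "T \<in> M" "\<forall>x. x \<epsilon> T \<longleftrightarrow> x \<epsilon> \<kappa> \<and> D x" by (rule separation_definable)
  have "D x" if x: "x \<epsilon> Y" for x
    unfolding D_def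
  proof (intro allI impI)
    fix \<xi> X assume \<xi>: "\<xi> \<epsilon> x" and X: "X \<epsilon> U" "app f \<xi> X"
    have "P \<xi> x" using Y(2) x \<xi> by blast
    then have "G \<xi> x" using decode[of x \<xi>] \<xi> unfolding P_def by blast
    then show "x \<epsilon> X" unfolding G_def using fm(3)[OF X(2)] by blast
  qed
  then have "sub Y T" unfolding sub_def using Y(2) T(2) by blast
  moreover have "sub T \<kappa>" using T(2) unfolding sub_def by blast
  ultimately have "T \<epsilon> U" using U_facts(5)[OF U_I[OF t(1) Y(1)] T(1)] by blast
  then show ?thesis using T(2) unfolding D_def by blast
qed

text \<open>Completeness is read off from normality. The family is continued with the value \<kappa>
  from \<alpha> on, and outside \<alpha> the diagonal intersection is contained in every set of the
  family.\<close>

lemma U_complete: "complete_ultrafilter \<kappa> U"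
proof -
  have "\<exists>Y\<in>elts U. elts Y = {x \<in> elts \<kappa>. \<forall>\<xi>\<in>elts \<alpha>. \<forall>X\<in>elts U. val f \<xi> X \<longrightarrow> x \<epsilon> X}"
    if \<alpha>: "\<alpha> \<epsilon> \<kappa>" and f: "f \<in> M" "maps f \<alpha> U" for \<alpha> f
  proof -
    have \<alpha>M: "\<alpha> \<in> M" using mem_in[OF \<kappa>_in \<alpha>] .
    note fm = mapsD[OF f(2,1) \<alpha>M U_in]
    define Q where "Q \<xi> X \<longleftrightarrow> (\<xi> \<epsilon> \<alpha> \<and> app f \<xi> X) \<or> (\<not> \<xi> \<epsilon> \<alpha> \<and> X = \<kappa>)" for \<xi> X
    have Q: "definable (\<lambda>e. Q (e 0) (e 1))" unfolding Q_def by (intro definable_intros \<alpha>M f \<kappa>_in)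
    have Q_ex: "\<exists>!X. X \<epsilon> U \<and> Q \<xi> X" if "\<xi> \<epsilon> \<kappa>" for \<xi>
    proof (cases "\<xi> \<epsilon> \<alpha>")
      case True
      then obtain X where "X \<epsilon> U" "app f \<xi> X" using fm(2) by blast
      then show ?thesis using True fm(3) unfolding Q_def by blast
    next
      case False
      then show ?thesis using U_facts(3) unfolding Q_def by blast
    qed
    obtain g where g: "g \<in> M" "maps g \<kappa> U" "\<forall>x y. app g x y \<longleftrightarrow> x \<epsilon> \<kappa> \<and> y \<epsilon> U \<and> Q x y"
      by (rule function_ex[OF \<kappa>_in U_in Q Q_ex])
    obtain Y where Y: "Y \<epsilon> U" "\<forall>x. x \<epsilon> Y \<longleftrightarrow>
        x \<epsilon> \<kappa> \<and> (\<forall>\<xi>. \<xi> \<epsilon> x \<longrightarrow> (\<forall>X. X \<epsilon> U \<longrightarrow> app g \<xi> X \<longrightarrow> x \<epsilon> X))"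
      using U_diagonal[OF g(1,2)] by blast
    obtain X0 where X0: "X0 \<epsilon> U" "\<forall>x. x \<epsilon> X0 \<longleftrightarrow> x \<epsilon> \<kappa> \<and> \<not> x \<epsilon> \<alpha>"
      using U_final_segment[OF \<alpha>] by blast
    obtain Z where Z: "Z \<epsilon> U" "\<forall>z. z \<epsilon> Z \<longleftrightarrow> z \<epsilon> Y \<and> z \<epsilon> X0"
      using U_facts(6)[OF Y(1) X0(1)] by blast
    define D where "D x \<longleftrightarrow> (\<forall>\<xi>. \<xi> \<epsilon> \<alpha> \<longrightarrow> (\<forall>X. X \<epsilon> U \<longrightarrow> app f \<xi> X \<longrightarrow> x \<epsilon> X))" for x
    have "definable (\<lambda>e. D (e 0))" unfolding D_def by (intro definable_intros U_in f \<alpha>M)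
    with \<kappa>_in obtain T where T: "T \<in> M" "\<forall>x. x \<epsilon> T \<longleftrightarrow> x \<epsilon> \<kappa> \<and> D x" by (rule separation_definable)
    have "D x" if x: "x \<epsilon> Z" for x
      unfolding D_def
    proof (intro allI impI)
      fix \<xi> X assume \<xi>: "\<xi> \<epsilon> \<alpha>" and X: "X \<epsilon> U" "app f \<xi> X"
      have xk: "x \<epsilon> \<kappa>" "\<not> x \<epsilon> \<alpha>" "x \<epsilon> Y" using x Z(2) X0(2) by blast+
      have "\<xi> \<epsilon> x" using ord_not_mem_trans[OF \<kappa>_ord xk(1) \<alpha> xk(2) \<xi>] .
      moreover have "app g \<xi> X"
        using g(3) X \<xi> ord_trans[OF \<kappa>_ord \<alpha> \<xi>] unfolding Q_def by blast
      ultimately show "x \<epsilon> X" using Y(2) xk(3) X(1) by blast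
    qed
    then have "sub Z T" unfolding sub_def using T(2) Z(2) X0(2) by blast
    moreover have "sub T \<kappa>" using T(2) unfolding sub_def by blast
    ultimately have TU: "T \<epsilon> U" using U_facts(5)[OF Z(1) T(1)] by blast
    have "elts T = {x \<in> elts \<kappa>. \<forall>\<xi>\<in>elts \<alpha>. \<forall>X\<in>elts U. val f \<xi> X \<longrightarrow> x \<epsilon> X}"
      using T(2) unfolding D_def
      by (simp add: elts_eq[OF T(1)] elts_eq[OF \<kappa>_in] elts_eq[OF \<alpha>M] elts_eq[OF U_in] val_iff[OF f(1)])
    then show ?thesis using TU elts_eq[OF U_in] by blast
  qed
  then show ?thesis
    unfolding complete_ultrafilter_def using U_ultrafilter elts_eq[OF \<kappa>_in] by simp
qed

lemma U_normal: "normal_ultrafilter \<kappa> U"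
proof -
  have "\<exists>Y\<in>elts U. elts Y = {x \<in> elts \<kappa>. \<forall>\<xi>\<in>elts x. \<forall>X\<in>elts U. val f \<xi> X \<longrightarrow> x \<epsilon> X}"
    if f: "f \<in> M" "maps f \<kappa> U" for f
  proof -
    obtain Y where Y: "Y \<epsilon> U" "\<forall>x. x \<epsilon> Y \<longleftrightarrow>
        x \<epsilon> \<kappa> \<and> (\<forall>\<xi>. \<xi> \<epsilon> x \<longrightarrow> (\<forall>X. X \<epsilon> U \<longrightarrow> app f \<xi> X \<longrightarrow> x \<epsilon> X))"
      using U_diagonal[OF f] by blast
    have "elts x = {z. z \<epsilon> x}" if "x \<epsilon> \<kappa>" for x using elts_eq[OF mem_in[OF \<kappa>_in that]] .
    then have "elts Y = {x \<in> elts \<kappa>. \<forall>\<xi>\<in>elts x. \<forall>X\<in>elts U. val f \<xi> X \<longrightarrow> x \<epsilon> X}"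
      using Y(2)
      by (auto simp: elts_eq[OF U_facts(1)[OF Y(1)]] elts_eq[OF \<kappa>_in] elts_eq[OF U_in] val_iff[OF f(1)])
    then show ?thesis using Y(1) elts_eq[OF U_in] by blast
  qed
  then show ?thesis
    unfolding normal_ultrafilter_def using U_uniform U_complete by blast
qed

end

section \<open>Splitting by the pseudo-intersections\<close>

context eps_universe
begin

text \<open>The elements of \<open>c\<close> without an immediate predecessor in \<open>c\<close> play the role of the even-indexed
  ones: they need no enumeration of \<open>c\<close>, so that \<open>split\<close> is absolute between the models.\<close>

definition split :: "'v \<Rightarrow> 'v \<Rightarrow> bool" where
  "split c z \<longleftrightarrow> (\<exists>x. x \<epsilon> c \<and> (\<not> z \<epsilon> x \<and> (\<forall>y. y \<epsilon> c \<longrightarrow> \<not> (x \<epsilon> y \<and> \<not> z \<epsilon> y)) \<and>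
     (\<forall>y. y \<epsilon> c \<longrightarrow> y \<epsilon> x \<longrightarrow> (\<exists>w. w \<epsilon> c \<and> (y \<epsilon> w \<and> w \<epsilon> x)))))"

end

lemma (in zfc_model) definable_split:
  "param s \<Longrightarrow> param t \<Longrightarrow> definable (\<lambda>e. split (s e) (t e))"
  by (rule definable_rel2[of split], unfold split_def) (intro definable_intros)

context measure_tower
begin

lemma next_element:
  assumes i: "i \<epsilon> lam" and x: "x \<epsilon> \<kappa>"
  obtains y where "y \<epsilon> k i" "x \<epsilon> y" "\<forall>z. z \<epsilon> k i \<longrightarrow> x \<epsilon> z \<longrightarrow> \<not> z \<epsilon> y"
proof -
  obtain y0 where "y0 \<epsilon> k i \<and> x \<epsilon> y0" using k_props(3)[OF i x] by blast
  then show thesis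
  proof (rule minimal)
    fix y assume "y \<epsilon> k i \<and> x \<epsilon> y" "\<And>z. z \<epsilon> y \<Longrightarrow> \<not> (z \<epsilon> k i \<and> x \<epsilon> z)"
    then show thesis by (intro that[of y]) blast+
  qed
qed

lemma k_\<kappa>: "i \<epsilon> lam \<Longrightarrow> x \<epsilon> k i \<Longrightarrow> x \<epsilon> \<kappa>"
  using k_props(2) unfolding sub_def by blast

text \<open>Since \<open>k i\<close> is almost contained in the set of limits of \<open>B\<close>, the set \<open>B\<close> meets the interval
  between any two consecutive elements of \<open>k i\<close>, up to a bounded part.\<close>

lemma split_unbounded:
  assumes i: "i \<epsilon> lam" and B: "B \<in> N i" "sub B \<kappa>"
    and unb: "\<And>a. a \<epsilon> \<kappa> \<Longrightarrow> \<exists>z. z \<epsilon> B \<and> a \<epsilon> z" and a: "a \<epsilon> \<kappa>"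
  shows "\<exists>z. z \<epsilon> B \<and> a \<epsilon> z \<and> split (k i) z" "\<exists>z. z \<epsilon> B \<and> a \<epsilon> z \<and> \<not> split (k i) z"
proof -
  interpret N: normal_measure elem "N i" \<kappa> "\<U> i" using i by (rule N_measure)
  note k\<kappa> = k_\<kappa>[OF i]
  obtain Y where Y: "Y \<epsilon> \<U> i"
    "\<forall>x. x \<epsilon> Y \<longrightarrow> (\<forall>y. y \<epsilon> x \<longrightarrow> (\<exists>z. z \<epsilon> B \<and> (y \<epsilon> z \<and> z \<epsilon> x)))"
    using N.limits_in_U[OF B unb] by blast
  obtain a0 where a0: "a0 \<epsilon> \<kappa>" "\<forall>x. x \<epsilon> k i \<longrightarrow> \<not> x \<epsilon> a0 \<longrightarrow> x \<epsilon> Y"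
    using k_almost[OF i Y(1)] almost_subset_iff[OF \<kappa>_in k_props(1)[OF i] \<U>_sub(2)[OF i Y(1)]] by blast
  have between: "\<exists>z. z \<epsilon> B \<and> y \<epsilon> z \<and> z \<epsilon> x" if "x \<epsilon> k i" "\<not> x \<epsilon> a0" "y \<epsilon> x" for x y
    using a0(2) Y(2) that by blast
  \<comment> \<open>The larger of \<open>a0\<close> and \<open>a\<close>: beyond it
    \<open>k i\<close> consists of limits of \<open>B\<close>, and points found there exceed
    \<open>a\<close>.\<close>
  obtain c where c: "c \<epsilon> \<kappa>" "\<forall>x. x \<epsilon> \<kappa> \<longrightarrow> \<not> x \<epsilon> c \<longrightarrow> \<not> x \<epsilon> a0 \<and> \<not> x \<epsilon> a"
  proof -
    consider "a \<epsilon> a0" | "a = a0" | "a0 \<epsilon> a"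
      using ord_cases[OF \<kappa>_ord a a0(1)] by blast
    then show thesis
    proof cases
      case 1
      then show thesis using that[OF a0(1)] ord_trans[OF ord_mem[OF \<kappa>_ord a0(1)] 1] by blast
    next
      case 2
      then show thesis using that[OF a0(1)] by blast
    next
      case 3
      then show thesis using that[OF a] ord_trans[OF ord_mem[OF \<kappa>_ord a] 3] by blast
    qed
  qed
  have not_sym: "\<not> y \<epsilon> x" if "x \<epsilon> y" "y \<epsilon> \<kappa>" for x y
    using ord_asym[OF ord_mem[OF \<kappa>_ord that(2)] that(1)] .
  have above: "z \<epsilon> B \<Longrightarrow> x \<epsilon> z \<Longrightarrow> x \<epsilon> \<kappa> \<Longrightarrow> \<not> x \<epsilon> c \<Longrightarrow> a \<epsilon> z" for x z
    using c(2) ord_cases[OF \<kappa>_ord _ a, of x] ord_trans[OF ord_mem[OF \<kappa>_ord], of z x a] B(2)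
    unfolding sub_def by blast
  have up: "\<not> y \<epsilon> c" if "x \<epsilon> y" "y \<epsilon> \<kappa>" "\<not> x \<epsilon> c" for x y
    using that ord_trans[OF ord_mem[OF \<kappa>_ord c(1)], of y x] by blast

  show "\<exists>z. z \<epsilon> B \<and> a \<epsilon> z \<and> split (k i) z"
  proof -
    \<comment> \<open>The set of limits of \<open>k i\<close> must be measured in a later model,
      because \<open>k i\<close> is available only from there on.\<close>
    obtain j where j: "j \<epsilon> lam" "i \<epsilon> j" using lam_limit[OF i] by blast
    interpret Nj: normal_measure elem "N j" \<kappa> "\<U> j" using j(1) by (rule N_measure)
    obtain L where L: "L \<epsilon> \<U> j"
      "\<forall>x. x \<epsilon> L \<longrightarrow> (\<forall>y. y \<epsilon> x \<longrightarrow> (\<exists>z. z \<epsilon> k i \<and> (y \<epsilon> z \<and> z \<epsilon> x)))"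
      using Nj.limits_in_U[OF k_in_N[OF j] k_props(2)[OF i] k_props(3)[OF i]] by blast
    obtain l where l: "l \<epsilon> L" "\<not> l \<epsilon> c" using Nj.inter_final[OF L(1) c(1)] by blast
    have l\<kappa>: "l \<epsilon> \<kappa>" using Nj.U_facts(2)[OF L(1) l(1)] .
    obtain x0 where "x0 \<epsilon> k i \<and> \<not> x0 \<epsilon> l" using k_props(3)[OF i l\<kappa>] not_sym k\<kappa> by blast
    \<comment> \<open>Let \<open>x\<close> be the least element of \<open>k i\<close> that is not
      below the limit \<open>l\<close>. Elements of \<open>k i\<close> below \<open>x\<close> are
      below \<open>l\<close>, where \<open>k i\<close> has no largest element, so \<open>x\<close>
      has no immediate predecessor in \<open>k i\<close>. Any point of \<open>B\<close> between
      \<open>x\<close> and its successor in \<open>k i\<close> is then as required.\<close>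
    then obtain x where x: "x \<epsilon> k i \<and> \<not> x \<epsilon> l" "\<forall>y. y \<epsilon> x \<longrightarrow> \<not> (y \<epsilon> k i \<and> \<not> y \<epsilon> l)"
      using minimal[of "\<lambda>x. x \<epsilon> k i \<and> \<not> x \<epsilon> l"] by metis
    have x\<kappa>: "x \<epsilon> \<kappa>" using k\<kappa> x(1) by blast
    have lx: "y \<epsilon> x" if "y \<epsilon> l" for y
      using ord_not_mem_trans[OF \<kappa>_ord x\<kappa> l\<kappa> _ that] x(1) by blast
    have xc: "\<not> x \<epsilon> c" using x(1) l(2) up[of l x] ord_cases[OF \<kappa>_ord x\<kappa> l\<kappa>] x\<kappa> by blast
    obtain y where y: "y \<epsilon> k i" "x \<epsilon> y" "\<forall>z. z \<epsilon> k i \<longrightarrow> x \<epsilon> z \<longrightarrow> \<not> z \<epsilon> y"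
      using i x\<kappa> by (rule next_element)
    have y\<kappa>: "y \<epsilon> \<kappa>" using k\<kappa> y(1) .
    have "\<not> y \<epsilon> c" using up[OF y(2) y\<kappa> xc] .
    then obtain z where z: "z \<epsilon> B" "x \<epsilon> z" "z \<epsilon> y" using between[OF y(1) _ y(2)] c(2) y\<kappa> by blast
    have z\<kappa>: "z \<epsilon> \<kappa>" using B(2) z(1) unfolding sub_def by blast
    have "split (k i) z"
      unfolding split_def
    proof (rule exI[of _ x], intro conjI allI impI)
      show "x \<epsilon> k i" using x(1) by blast
      show "\<not> z \<epsilon> x" using not_sym[OF z(2) z\<kappa>] .
      show "\<not> (x \<epsilon> w \<and> \<not> z \<epsilon> w)" if "w \<epsilon> k i" for w
        using y(3) that ord_not_mem_trans[OF \<kappa>_ord k\<kappa>[OF that] y\<kappa> _ z(3)] by blast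
      show "\<exists>v. v \<epsilon> k i \<and> (w \<epsilon> v \<and> v \<epsilon> x)" if "w \<epsilon> k i" "w \<epsilon> x" for w
        using x(2) that L(2) l(1) lx by blast
    qed
    then show ?thesis using z(1) above[OF z(1,2) x\<kappa> xc] by blast
  qed

  show "\<exists>z. z \<epsilon> B \<and> a \<epsilon> z \<and> \<not> split (k i) z"
  proof -
    \<comment> \<open>Three consecutive elements \<open>x0\<close>, \<open>x1\<close>,
      \<open>x2\<close> of \<open>k i\<close>: as \<open>x1\<close> has the immediate predecessor
      \<open>x0\<close>, points between \<open>x1\<close> and \<open>x2\<close> are not in the
      splitting set.\<close>
    obtain x0 where x0: "x0 \<epsilon> k i" "c \<epsilon> x0" using k_props(3)[OF i c(1)] by blast
    have x0\<kappa>: "x0 \<epsilon> \<kappa>" using k\<kappa> x0(1) .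
    have x0c: "\<not> x0 \<epsilon> c" using not_sym[OF x0(2) x0\<kappa>] .
    obtain x1 where x1: "x1 \<epsilon> k i" "x0 \<epsilon> x1" "\<forall>z. z \<epsilon> k i \<longrightarrow> x0 \<epsilon> z \<longrightarrow> \<not> z \<epsilon> x1"
      using i x0\<kappa> by (rule next_element)
    have x1\<kappa>: "x1 \<epsilon> \<kappa>" using k\<kappa> x1(1) .
    have x1c: "\<not> x1 \<epsilon> c" using up[OF x1(2) x1\<kappa> x0c] .
    obtain x2 where x2: "x2 \<epsilon> k i" "x1 \<epsilon> x2" "\<forall>z. z \<epsilon> k i \<longrightarrow> x1 \<epsilon> z \<longrightarrow> \<not> z \<epsilon> x2"
      using i x1\<kappa> by (rule next_element)
    have x2\<kappa>: "x2 \<epsilon> \<kappa>" using k\<kappa> x2(1) .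
    have "\<not> x2 \<epsilon> c" using up[OF x2(2) x2\<kappa> x1c] .
    then obtain z where z: "z \<epsilon> B" "x1 \<epsilon> z" "z \<epsilon> x2" using between[OF x2(1) _ x2(2)] c(2) x2\<kappa> by blast
    have z\<kappa>: "z \<epsilon> \<kappa>" using B(2) z(1) unfolding sub_def by blast
    have "\<not> split (k i) z"
    proof
      assume "split (k i) z"
      then obtain x where x: "x \<epsilon> k i" "\<not> z \<epsilon> x" "\<forall>y. y \<epsilon> k i \<longrightarrow> \<not> (x \<epsilon> y \<and> \<not> z \<epsilon> y)"
        "\<forall>y. y \<epsilon> k i \<longrightarrow> y \<epsilon> x \<longrightarrow> (\<exists>w. w \<epsilon> k i \<and> (y \<epsilon> w \<and> w \<epsilon> x))"
        unfolding split_def by blast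
      have "\<not> x \<epsilon> x1" using x(3) x1(1) not_sym[OF z(2) z\<kappa>] by blast
      moreover have "\<not> x1 \<epsilon> x"
      proof
        assume "x1 \<epsilon> x"
        then have "\<not> x \<epsilon> x2" using x2(3) x(1) by blast
        then show False using ord_not_mem_trans[OF \<kappa>_ord k\<kappa>[OF x(1)] x2\<kappa> _ z(3)] x(2) by blast
      qed
      ultimately have "x = x1" using ord_cases[OF \<kappa>_ord k\<kappa>[OF x(1)] x1\<kappa>] by blast
      then show False using x(4) x0(1) x1(2,3) by blast
    qed
    then show ?thesis using z(1) above[OF z(1,2) x1\<kappa> x1c] by blast
  qed
qed

text \<open>If it were in \<open>N i\<close>, the splitting set would be an unbounded set of
  \<open>N i\<close> and would have to split itself.\<close>

lemma split_not_in_N: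
  assumes i: "i \<epsilon> lam" and A: "A \<in> N i"
  shows "\<not> (\<forall>z. z \<epsilon> A \<longleftrightarrow> z \<epsilon> \<kappa> \<and> split (k i) z)"
proof
  assume A_iff: "\<forall>z. z \<epsilon> A \<longleftrightarrow> z \<epsilon> \<kappa> \<and> split (k i) z"
  have "\<exists>z. z \<epsilon> A \<and> a \<epsilon> z" if "a \<epsilon> \<kappa>" for a
  proof -
    have "sub \<kappa> \<kappa>" by (simp add: sub_def)
    then show ?thesis
      using split_unbounded(1)[OF i \<kappa>_in_N[OF i] _ _ that] \<kappa>_limit A_iff by blast
  qed
  moreover have "sub A \<kappa>" using A_iff unfolding sub_def by blast
  moreover obtain a where "a \<epsilon> \<kappa>" using limit_ordinalD(2)[OF regularD(1)[OF \<kappa>_regular \<kappa>_in] \<kappa>_in] by blast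
  ultimately show False using split_unbounded(2)[OF i A] A_iff by blast
qed

section \<open>The two halves of \<kappa> given by a splitting set\<close>

lemma split_set:
  assumes "zfc_model elem W" "\<kappa> \<in> W" "c \<in> W"
  obtains A where "A \<in> W" "\<forall>z. z \<epsilon> A \<longleftrightarrow> z \<epsilon> \<kappa> \<and> split c z"
proof -
  interpret W: zfc_model elem W by (rule assms(1))
  have "W.definable (\<lambda>e. split c (e 0))"
    by (intro W.definable_split W.definable_basic assms(3))
  with assms(2) show thesis by (rule W.separation_definable) (rule that)
qed

lemma complement_set:
  assumes "zfc_model elem W" "a \<in> W" "c \<in> W"
  obtains A where "A \<in> W" "\<forall>z. z \<epsilon> A \<longleftrightarrow> z \<epsilon> a \<and> \<not> z \<epsilon> c"
proof -
  interpret W: zfc_model elem W by (rule assms(1))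
  have "W.definable (\<lambda>e. \<not> e 0 \<epsilon> c)" by (intro W.definable_basic assms(3))
  with assms(2) show thesis by (rule W.separation_definable) (rule that)
qed

definition side :: "'v \<Rightarrow> 'v \<Rightarrow> bool" where
  "side A c \<longleftrightarrow> (\<forall>z. z \<epsilon> \<kappa> \<longrightarrow> (z \<epsilon> A \<longleftrightarrow> split c z)) \<or> (\<forall>z. z \<epsilon> \<kappa> \<longrightarrow> (z \<epsilon> A \<longleftrightarrow> \<not> split c z))"

lemma definable_side: "param s \<Longrightarrow> param t \<Longrightarrow> definable (\<lambda>e. side (s e) (t e))"
  by (rule definable_rel2[of side], unfold side_def) (intro definable_intros definable_split \<kappa>_in)

lemma side_not_in_N:
  assumes i: "i \<epsilon> lam" and A: "sub A \<kappa>" "side A (k i)"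
  shows "A \<notin> N i"
proof
  assume AN: "A \<in> N i"
  obtain A' where A': "A' \<in> N i" "\<forall>z. z \<epsilon> A' \<longleftrightarrow> z \<epsilon> \<kappa> \<and> \<not> z \<epsilon> A"
    using N_zfc[OF i] \<kappa>_in_N[OF i] AN by (rule complement_set)
  show False
    using A split_not_in_N[OF i AN] split_not_in_N[OF i A'(1)] A'(2)
    unfolding side_def sub_def by blast
qed

lemma side_in_N:
  assumes j: "j \<epsilon> lam" "i \<epsilon> j" and A: "sub A \<kappa>" "side A (k i)"
  shows "A \<in> N j"
proof -
  obtain A1 where A1: "A1 \<in> N j" "\<forall>z. z \<epsilon> A1 \<longleftrightarrow> z \<epsilon> \<kappa> \<and> split (k i) z"
    using N_zfc[OF j(1)] \<kappa>_in_N[OF j(1)] k_in_N[OF j] by (rule split_set)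
  obtain A2 where A2: "A2 \<in> N j" "\<forall>z. z \<epsilon> A2 \<longleftrightarrow> z \<epsilon> \<kappa> \<and> \<not> z \<epsilon> A1"
    using N_zfc[OF j(1)] \<kappa>_in_N[OF j(1)] A1(1) by (rule complement_set)
  from A(2) consider "\<forall>z. z \<epsilon> \<kappa> \<longrightarrow> (z \<epsilon> A \<longleftrightarrow> split (k i) z)"
    | "\<forall>z. z \<epsilon> \<kappa> \<longrightarrow> (z \<epsilon> A \<longleftrightarrow> \<not> split (k i) z)" unfolding side_def by blast
  then show ?thesis
  proof cases
    case 1
    then have "A = A1" using A(1) A1(2) unfolding sub_def by (intro extensional) blast
    then show ?thesis using A1(1) by simp
  next
    case 2
    then have "A = A2" using A(1) A1(2) A2(2) unfolding sub_def by (intro extensional) blast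
    then show ?thesis using A2(1) by simp
  qed
qed

lemma k_not_in_N: "i \<epsilon> lam \<Longrightarrow> k i \<notin> N i"
proof
  assume i: "i \<epsilon> lam" and k: "k i \<in> N i"
  obtain A where "A \<in> N i" "\<forall>z. z \<epsilon> A \<longleftrightarrow> z \<epsilon> \<kappa> \<and> split (k i) z"
    using N_zfc[OF i] \<kappa>_in_N[OF i] k by (rule split_set)
  then show False using split_not_in_N[OF i] by blast
qed

text \<open>For \<open>i\<close> below \<open>j\<close> the set \<open>k i\<close> is in
  \<open>N j\<close> and \<open>k j\<close> is not. Consequently the sets \<open>k i\<close> form a
  family of size exactly \<open>lam\<close>.\<close>

lemma k_inj: "i \<epsilon> lam \<Longrightarrow> j \<epsilon> lam \<Longrightarrow> k i = k j \<Longrightarrow> i = j"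
  using ord_linear[OF ord_mem[OF lam_ord] ord_mem[OF lam_ord], of i j]
    k_in_N[of i j] k_in_N[of j i] k_not_in_N[of i] k_not_in_N[of j] by auto

text \<open>A side of \<open>k i\<close> is missing from \<open>N i\<close> and present in all later
  models, so the set alone determines its index.\<close>

lemma side_inj:
  assumes "i \<epsilon> lam" "j \<epsilon> lam" "sub A \<kappa>" "side A (k i)" "side A (k j)"
  shows "i = j"
  using ord_linear[OF ord_mem[OF lam_ord assms(1)] ord_mem[OF lam_ord assms(2)]]
    side_in_N[OF assms(1) _ assms(3,5)] side_in_N[OF assms(2) _ assms(3,4)]
    side_not_in_N[OF assms(1,3,4)] side_not_in_N[OF assms(2,3,5)] by blast

text \<open>An unbounded set of \<open>N t\<close> meets both halves beyond every bound, so a final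
  part of it fits into neither.\<close>

lemma not_almost_subset_side:
  assumes t: "t \<epsilon> lam" and B: "B \<in> N t" "B \<in> full_subsets \<kappa>"
    and A: "A \<in> M" "side A (k t)"
  shows "\<not> almost_subset \<kappa> B A"
proof
  assume "almost_subset \<kappa> B A"
  have BM: "B \<in> M" "sub B \<kappa>"
    using B(2) unfolding full_subsets_def by (auto simp: subsets_iff[OF \<kappa>_in])
  then have B\<kappa>: "z \<epsilon> B \<Longrightarrow> z \<epsilon> \<kappa>" for z unfolding sub_def by blast
  obtain a where a: "a \<epsilon> \<kappa>" "\<forall>x. x \<epsilon> B \<longrightarrow> \<not> x \<epsilon> a \<longrightarrow> x \<epsilon> A"
    using \<open>almost_subset \<kappa> B A\<close> almost_subset_iff[OF \<kappa>_in BM(1) A(1)] by blast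
  have unb: "\<exists>z. z \<epsilon> B \<and> b \<epsilon> z" if "b \<epsilon> \<kappa>" for b
    using full_unbounded[OF \<kappa>_regular \<kappa>_in B(2) that] by blast
  have *: "z \<epsilon> A" if "z \<epsilon> B" "a \<epsilon> z" for z
    using a(2) that ord_asym[OF ord_mem[OF \<kappa>_ord B\<kappa>[OF that(1)]] that(2)] by blast
  obtain z1 where z1: "z1 \<epsilon> B" "a \<epsilon> z1" "split (k t) z1"
    using split_unbounded(1)[OF t B(1) BM(2) unb a(1)] by blast
  obtain z2 where z2: "z2 \<epsilon> B" "a \<epsilon> z2" "\<not> split (k t) z2"
    using split_unbounded(2)[OF t B(1) BM(2) unb a(1)] by blast
  show False using A(2) *[OF z1(1,2)] *[OF z2(1,2)] z1(3) z2(3) B\<kappa>[OF z1(1)] B\<kappa>[OF z2(1)]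
    unfolding side_def by blast
qed

lemma side_ex:
  assumes i: "i \<epsilon> lam" and V: "ultrafilter \<kappa> V" "V \<in> M"
  obtains A where "A \<epsilon> V" "side A (k i)"
proof -
  obtain A where A: "A \<in> M" "\<forall>z. z \<epsilon> A \<longleftrightarrow> z \<epsilon> \<kappa> \<and> split (k i) z"
    using zfc_model_axioms \<kappa>_in k_props(1)[OF i] by (rule split_set)
  have "sub A \<kappa>" using A(2) unfolding sub_def by blast
  from ultrafilterD(7)[OF V(1) \<kappa>_in V(2) A(1) this] consider "A \<epsilon> V"
    | Y where "Y \<epsilon> V" "\<forall>z. z \<epsilon> Y \<longleftrightarrow> z \<epsilon> \<kappa> \<and> \<not> z \<epsilon> A" by blast
  then show thesis
  proof cases
    case 1
    then show thesis using that[of A] A(2) unfolding side_def by blast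
  next
    case 2
    then show thesis using that[of Y] A(2) unfolding side_def by blast
  qed
qed

section \<open>The cardinal characteristics of the limit measure\<close>

lemma lam_cardinal: "cardinal lam"
  using regular_cardinal[OF lam_regular lam_in] .

text \<open>Indices for fewer than \<open>lam\<close> sets are bounded by regularity of
  \<open>lam\<close>. The bound must be found in \<open>M\<close>, hence \<open>R\<close> has to be
  definable over \<open>M\<close>.\<close>

lemma small_family:
  assumes B: "B \<in> M" "card_of B \<mu>" "\<mu> \<epsilon> lam"
    and def: "definable (\<lambda>e. R (e 0) (e 1))"
    and R: "\<And>b. b \<epsilon> B \<Longrightarrow> \<exists>s. s \<epsilon> S \<and> R b s"
  obtains t where "t \<epsilon> S" "\<forall>b. b \<epsilon> B \<longrightarrow> (\<exists>s. s \<epsilon> S \<and> s \<epsilon> t \<and> R b s)"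
proof -
  have \<mu>M: "\<mu> \<in> M" using mem_in[OF lam_in B(3)] .
  obtain g where g: "g \<in> M" "bijection g B \<mu>" using B(2) unfolding card_of_def by blast
  note gD = bijectionD[OF g(2,1) B(1) \<mu>M]
  note gm = mapsD[OF gD(1) g(1) B(1) \<mu>M]
  define Q where "Q \<xi> s \<longleftrightarrow> s \<epsilon> S \<and> (\<exists>b. b \<epsilon> B \<and> (app g b \<xi> \<and> R b s))" for \<xi> s
  have "definable (\<lambda>e. Q (e 0) (e 1))"
    unfolding Q_def by (intro definable_intros definable_rel2[OF def] S_in B g)
  moreover have "\<exists>s. s \<epsilon> lam \<and> Q \<xi> s" if \<xi>: "\<xi> \<epsilon> \<mu>" for \<xi>
  proof -
    obtain b where b: "app g b \<xi>" "b \<epsilon> B" using gD(3)[OF \<xi>] gm(1) by blast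
    obtain s where "s \<epsilon> S" "R b s" using R[OF b(2)] by blast
    then show ?thesis using b S_lam unfolding Q_def by blast
  qed
  ultimately obtain c where c: "c \<epsilon> lam" "\<forall>\<xi>. \<xi> \<epsilon> \<mu> \<longrightarrow> (\<exists>s. s \<epsilon> c \<and> Q \<xi> s)"
    using regular_collection[OF lam_regular lam_in B(3), of Q] by blast
  obtain t where t: "t \<epsilon> S" "c \<epsilon> t" using S_unbounded[OF c(1)] by blast
  have "\<exists>s. s \<epsilon> S \<and> s \<epsilon> t \<and> R b s" if b: "b \<epsilon> B" for b
  proof -
    obtain \<xi> where \<xi>: "\<xi> \<epsilon> \<mu>" "app g b \<xi>" using gm(2)[OF b] by blast
    obtain s where s: "s \<epsilon> c" "Q \<xi> s" using c(2) \<xi>(1) by blast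
    then obtain b' where "s \<epsilon> S" "app g b' \<xi>" "R b' s" unfolding Q_def by blast
    moreover from this have "b' = b" using gD(2) \<xi>(2) by blast
    ultimately show ?thesis using ord_trans[OF ord_mem[OF lam_ord S_lam[OF t(1)]] t(2) s(1)] by blast
  qed
  then show thesis by (intro that[OF t(1)]) blast
qed

text \<open>A small base would be contained in one \<open>N t\<close>, and the half of
  \<open>k t\<close> that lies in \<open>V\<close> almost contains no set of \<open>N t\<close> of
  full size. \<open>V\<close> is arbitrary because the bound is used both for \<open>U\<close> and
  for the minimum over all complete ultrafilters.\<close>

lemma no_small_pi_base:
  assumes V: "V \<in> M" "ultrafilter \<kappa> V" and B: "B \<in> M" "pi_base \<kappa> V B"
    and \<mu>: "\<mu> \<epsilon> lam"
  shows "\<not> card_of B \<mu>"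
proof
  assume card: "card_of B \<mu>"
  have full: "b \<in> full_subsets \<kappa>" if "b \<epsilon> B" for b
    using B that elts_eq[OF B(1)] unfolding pi_base_def by blast
  then have b\<kappa>: "b \<in> M" "sub b \<kappa>" if "b \<epsilon> B" for b
    using that unfolding full_subsets_def by (auto simp: subsets_iff[OF \<kappa>_in])
  obtain F where F: "F \<in> M" "\<forall>i x. app F i x \<longleftrightarrow> i \<epsilon> lam \<and> x = \<U> i"
    using \<U>_seq lam_in by (rule sequence_graph)
  have \<U>M: "\<U> s \<in> M" if "s \<epsilon> S" for s using \<U>_in N_sub S_lam[OF that] by blast
  \<comment> \<open>A definable substitute for saying that \<open>b\<close> is in
    \<open>N s\<close>: the sequence \<U> is a parameter in \<open>M\<close>, and \<open>N s\<close>
    contains \<open>b\<close> as soon as \<open>b\<close> or its complement is in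
    \<open>\<U> s\<close>. Some \<open>s\<close> qualifies because \<open>U\<close> decides
    \<open>b\<close>.\<close>
  define R where "R b s \<longleftrightarrow> (\<exists>u\<in>M. app F s u \<and>
      (b \<epsilon> u \<or> (\<exists>Y. Y \<epsilon> u \<and> (\<forall>z. z \<epsilon> \<kappa> \<longrightarrow> (z \<epsilon> Y \<longleftrightarrow> \<not> z \<epsilon> b)))))" for b s
  have def: "definable (\<lambda>e. R (e 0) (e 1))" unfolding R_def by (intro definable_intros F \<kappa>_in)
  have R_iff: "R b s \<longleftrightarrow>
      b \<epsilon> \<U> s \<or> (\<exists>Y. Y \<epsilon> \<U> s \<and> (\<forall>z. z \<epsilon> \<kappa> \<longrightarrow> (z \<epsilon> Y \<longleftrightarrow> \<not> z \<epsilon> b)))" if "s \<epsilon> S" for b s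
    unfolding R_def using F(2) S_lam[OF that] \<U>M[OF that] by auto
  have ex: "\<exists>s. s \<epsilon> S \<and> R b s" if b: "b \<epsilon> B" for b
  proof -
    obtain X where X: "X \<epsilon> U" "X = b \<or> (\<forall>z. z \<epsilon> X \<longleftrightarrow> z \<epsilon> \<kappa> \<and> \<not> z \<epsilon> b)"
      using U_facts(7)[OF b\<kappa>[OF b]] by blast
    then obtain s where s: "s \<epsilon> S" "X \<epsilon> \<U> s" using U_iff by blast
    then show ?thesis using X(2) R_iff[OF s(1)] by blast
  qed
  obtain t where t: "t \<epsilon> S" "\<forall>b. b \<epsilon> B \<longrightarrow> (\<exists>s. s \<epsilon> S \<and> s \<epsilon> t \<and> R b s)"
    by (rule small_family[OF B(1) card \<mu> def ex])
  note tl = S_lam[OF t(1)]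
  have bN: "b \<in> N t" if b: "b \<epsilon> B" for b
  proof -
    obtain s where s: "s \<epsilon> S" "s \<epsilon> t" "R b s" using t(2) b by blast
    from s(3) consider "b \<epsilon> \<U> s" | Y where "Y \<epsilon> \<U> s" "\<forall>z. z \<epsilon> \<kappa> \<longrightarrow> (z \<epsilon> Y \<longleftrightarrow> \<not> z \<epsilon> b)"
      using R_iff[OF s(1)] by blast
    then show ?thesis
    proof cases
      case 1
      then show ?thesis using \<U>_sub(1)[OF tl] \<U>_mono[OF s(1) t(1) s(2)] by blast
    next
      case (2 Y)
      have "Y \<in> N t" using \<U>_sub(1)[OF tl] \<U>_mono[OF s(1) t(1) s(2) 2(1)] by blast
      then obtain A where A: "A \<in> N t" "\<forall>z. z \<epsilon> A \<longleftrightarrow> z \<epsilon> \<kappa> \<and> \<not> z \<epsilon> Y"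
        by (rule complement_set[OF N_zfc[OF tl] \<kappa>_in_N[OF tl]])
      have "b = A" using 2(2) A(2) b\<kappa>(2)[OF b] unfolding sub_def by (intro extensional) blast
      then show ?thesis using A(1) by simp
    qed
  qed
  obtain A where A: "A \<epsilon> V" "side A (k t)" using tl V(2,1) by (rule side_ex)
  have AM: "A \<in> M" using mem_in[OF V(1) A(1)] .
  obtain b where b: "b \<epsilon> B" "almost_subset \<kappa> b A"
    using B(2) A(1) elts_eq[OF B(1)] elts_eq[OF V(1)] unfolding pi_base_def by blast
  then show False using not_almost_subset_side[OF tl bN full AM A(2)] by blast
qed

text \<open>The base consists of all \<open>k i\<close>: a set of \<open>U\<close> lies in some
  \<open>\<U> s\<close> and almost contains \<open>k s\<close>.\<close>

lemma U_pi_char: "pi_char \<kappa> U lam"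
proof -
  obtain F where F: "F \<in> M" "\<forall>i x. app F i x \<longleftrightarrow> i \<epsilon> lam \<and> x = k i"
    using k_seq lam_in by (rule sequence_graph)
  obtain p where p: "p \<in> M" "\<forall>y. y \<epsilon> p \<longleftrightarrow> y \<in> M \<and> sub y \<kappa>" using \<kappa>_in by (rule power_set_ex)
  define Q where "Q x \<longleftrightarrow> (\<exists>i. i \<epsilon> lam \<and> app F i x)" for x
  have "definable (\<lambda>e. Q (e 0))" unfolding Q_def by (intro definable_intros lam_in F)
  with p(1) obtain B where B: "B \<in> M" "\<forall>x. x \<epsilon> B \<longleftrightarrow> x \<epsilon> p \<and> Q x"
    by (rule separation_definable)
  have B_iff: "x \<epsilon> B \<longleftrightarrow> (\<exists>i. i \<epsilon> lam \<and> x = k i)" for x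
    using B(2) p(2) F(2) k_props(1,2) unfolding Q_def by auto
  have "pi_base \<kappa> U B"
    unfolding pi_base_def
  proof (intro conjI ballI)
    show "elts B \<subseteq> full_subsets \<kappa>" using B_iff k_full elts_eq[OF B(1)] by auto
    fix A assume "A \<in> elts U"
    then obtain s where s: "s \<epsilon> S" "A \<epsilon> \<U> s" using U_iff elts_eq[OF U_in] by blast
    then show "\<exists>b\<in>elts B. almost_subset \<kappa> b A"
      using k_almost[OF S_lam[OF s(1)] s(2)] B_iff S_lam[OF s(1)] elts_eq[OF B(1)] by auto
  qed
  moreover have "card_of B lam"
  proof -
    define R where "R x i \<longleftrightarrow> app F i x" for x i
    have R: "definable (\<lambda>e. R (e 0) (e 1))" unfolding R_def by (intro definable_intros F)
    have ex: "\<exists>!i. i \<epsilon> lam \<and> R x i" if "x \<epsilon> B" for x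
      using that B_iff F(2) k_inj unfolding R_def by auto
    obtain f where f: "f \<in> M" "maps f B lam" "\<forall>x y. app f x y \<longleftrightarrow> x \<epsilon> B \<and> y \<epsilon> lam \<and> R x y"
      by (rule function_ex[OF B(1) lam_in R ex])
    have "bijection f B lam"
    proof (rule bijectionI[OF f(2,1) B(1) lam_in])
      show "x = x'" if "app f x i" "app f x' i" for x x' i
        using that f(3) F(2) unfolding R_def by simp
      show "\<exists>x. app f x i" if "i \<epsilon> lam" for i
        using that f(3) F(2) B_iff unfolding R_def by auto
    qed
    then show ?thesis unfolding card_of_def using lam_cardinal f(1) by blast
  qed
  ultimately show ?thesis
    unfolding pi_char_def is_min_def
    using B(1) lam_in lam_ord no_small_pi_base[OF U_in U_ultrafilter] elts_eq[OF lam_in]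
    by (auto simp: ordinal_iff)
qed

lemma U_pi_P_point:
  assumes \<nu>: "succ_card \<mu> \<nu>" "\<nu> \<in> M" and \<mu>: "\<mu> \<epsilon> lam"
  shows "pi_P_point \<kappa> \<nu> U"
  unfolding pi_P_point_def
proof (intro ballI impI)
  fix \<A> assume \<A>M: "\<A> \<in> M" and *: "elts \<A> \<subseteq> elts U \<and> (\<exists>\<nu>'\<in>elts \<nu>. card_of \<A> \<nu>')"
  then obtain \<nu>' where \<nu>': "\<nu>' \<epsilon> \<nu>" "card_of \<A> \<nu>'" using elts_eq[OF \<nu>(2)] by blast
  have "cardinal \<nu>'" using \<nu>'(2) unfolding card_of_def by blast
  \<comment> \<open>A family smaller than the successor of \<mu> has size at most \<mu>, which is
    still below \<open>lam\<close>.\<close>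
  then have "\<nu>' = \<mu> \<or> \<nu>' \<epsilon> \<mu>"
    using \<nu> \<nu>'(1) elts_eq[OF \<nu>(2)] unfolding succ_card_def by blast
  then have \<nu>'_lam: "\<nu>' \<epsilon> lam" using \<mu> ord_trans[OF lam_ord \<mu>] by blast
  have sub: "A \<epsilon> U" if "A \<epsilon> \<A>" for A
    using * that elts_eq[OF \<A>M] elts_eq[OF U_in] by blast
  obtain F where F: "F \<in> M" "\<forall>i x. app F i x \<longleftrightarrow> i \<epsilon> lam \<and> x = \<U> i"
    using \<U>_seq lam_in by (rule sequence_graph)
  define R where "R A s \<longleftrightarrow> (\<exists>u\<in>M. app F s u \<and> A \<epsilon> u)" for A s
  have def: "definable (\<lambda>e. R (e 0) (e 1))" unfolding R_def by (intro definable_intros F)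
  have R_iff: "R A s \<longleftrightarrow> A \<epsilon> \<U> s" if "s \<epsilon> S" for A s
  proof -
    have "\<U> s \<in> M" using \<U>_in N_sub S_lam[OF that] by blast
    then show ?thesis unfolding R_def using F(2) S_lam[OF that] by auto
  qed
  have ex: "\<exists>s. s \<epsilon> S \<and> R A s" if A: "A \<epsilon> \<A>" for A
    using sub[OF A] U_iff R_iff by blast
  obtain t where t: "t \<epsilon> S" "\<forall>A. A \<epsilon> \<A> \<longrightarrow> (\<exists>s. s \<epsilon> S \<and> s \<epsilon> t \<and> R A s)"
    by (rule small_family[OF \<A>M \<nu>'(2) \<nu>'_lam def ex])
  have "almost_subset \<kappa> (k t) A" if A: "A \<in> elts \<A>" for A
  proof -
    obtain s where s: "s \<epsilon> S" "s \<epsilon> t" "R A s" using t(2) A elts_eq[OF \<A>M] by blast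
    have "A \<epsilon> \<U> s" using s(3) R_iff[OF s(1)] by blast
    then show ?thesis using k_almost[OF S_lam[OF t(1)]] \<U>_mono[OF s(1) t(1) s(2)] by blast
  qed
  then show "\<exists>B\<in>full_subsets \<kappa>. \<forall>A\<in>elts \<A>. almost_subset \<kappa> B A"
    using k_full[OF S_lam[OF t(1)]] by blast
qed

text \<open>The bad family contains, for each \<open>i\<close>, the half of \<open>k i\<close> that
  is in \<open>U\<close>. A pseudo-intersection would appear in some \<open>N t\<close>, against the
  choice of the half for \<open>t\<close>.\<close>

lemma U_not_pi_P_point:
  assumes \<nu>: "succ_card lam \<nu>" "\<nu> \<in> M"
  shows "\<not> pi_P_point \<kappa> \<nu> U"
proof -
  obtain F where F: "F \<in> M" "\<forall>i x. app F i x \<longleftrightarrow> i \<epsilon> lam \<and> x = k i"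
    using k_seq lam_in by (rule sequence_graph)
  define R where "R A i \<longleftrightarrow> (\<exists>c\<in>M. app F i c \<and> side A c)" for A i
  have R: "definable (\<lambda>e. R (e 0) (e 1))" unfolding R_def by (intro definable_intros definable_side F)
  have R_iff: "R A i \<longleftrightarrow> i \<epsilon> lam \<and> side A (k i)" for A i
    using F(2) k_props(1) unfolding R_def by auto
  define Q where "Q A \<longleftrightarrow> (\<exists>i. i \<epsilon> lam \<and> R A i)" for A
  have "definable (\<lambda>e. Q (e 0))"
    unfolding Q_def by (intro definable_intros definable_rel2[OF R] lam_in)
  with U_in obtain \<A> where \<A>: "\<A> \<in> M" "\<forall>A. A \<epsilon> \<A> \<longleftrightarrow> A \<epsilon> U \<and> Q A"
    by (rule separation_definable)
  have U\<kappa>: "sub A \<kappa>" if "A \<epsilon> U" for A using U_facts(2)[OF that] unfolding sub_def by blast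
  \<comment> \<open>Two sides of the same set that differ at one point of \<kappa> are
    complementary, and \<open>U\<close> does not contain both. So each index contributes one set and
    the family has size exactly \<open>lam\<close>.\<close>
  have side_unique: "A = A'" if A: "A \<epsilon> U" "A' \<epsilon> U" "side A c" "side A' c" for A A' c
  proof (rule ccontr)
    assume "A \<noteq> A'"
    then obtain z0 where "z0 \<epsilon> A \<longleftrightarrow> \<not> z0 \<epsilon> A'" using extensional by blast
    moreover from this have "z0 \<epsilon> \<kappa>" using U\<kappa>[OF A(1)] U\<kappa>[OF A(2)] unfolding sub_def by blast
    ultimately have "z \<epsilon> A \<longleftrightarrow> \<not> z \<epsilon> A'" if "z \<epsilon> \<kappa>" for z
      using that A(3,4) unfolding side_def by (elim disjE) simp_all
    moreover obtain Z where "Z \<epsilon> U" "\<forall>z. z \<epsilon> Z \<longleftrightarrow> z \<epsilon> A \<and> z \<epsilon> A'"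
      using U_facts(6)[OF A(1,2)] by blast
    ultimately show False using U_facts(4)[of Z] U_facts(2)[OF A(1)] by blast
  qed
  have ex: "\<exists>!i. i \<epsilon> lam \<and> R A i" if "A \<epsilon> \<A>" for A
    using that \<A>(2) side_inj[of _ _ A] U\<kappa>[of A] unfolding Q_def R_iff by blast
  obtain f where f: "f \<in> M" "maps f \<A> lam" "\<forall>x y. app f x y \<longleftrightarrow> x \<epsilon> \<A> \<and> y \<epsilon> lam \<and> R x y"
    by (rule function_ex[OF \<A>(1) lam_in R ex])
  have in_\<A>: "\<exists>A. A \<epsilon> \<A> \<and> side A (k i)" if i: "i \<epsilon> lam" for i
  proof -
    obtain A where "A \<epsilon> U" "side A (k i)" using i U_ultrafilter U_in by (rule side_ex)
    then show ?thesis using \<A>(2) i unfolding Q_def R_iff by blast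
  qed
  have "bijection f \<A> lam"
  proof (rule bijectionI[OF f(2,1) \<A>(1) lam_in])
    show "A = A'" if "app f A i" "app f A' i" for A A' i
      using that f(3) \<A>(2) side_unique[of A A' "k i"] unfolding R_iff by blast
    show "\<exists>A. app f A i" if "i \<epsilon> lam" for i
      using that f(3) in_\<A>[OF that] unfolding R_iff by blast
  qed
  then have "card_of \<A> lam" unfolding card_of_def using lam_cardinal f(1) by blast
  moreover have "lam \<in> elts \<nu>" using \<nu> elts_eq[OF \<nu>(2)] unfolding succ_card_def by blast
  moreover have "elts \<A> \<subseteq> elts U" using \<A>(2) elts_eq[OF \<A>(1)] elts_eq[OF U_in] by blast
  moreover have "\<exists>A\<in>elts \<A>. \<not> almost_subset \<kappa> B A" if B: "B \<in> full_subsets \<kappa>" for B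
  proof -
    have "B \<in> M" "sub B \<kappa>"
      using B unfolding full_subsets_def by (auto simp: subsets_iff[OF \<kappa>_in])
    then obtain t where t: "t \<epsilon> S" "B \<in> N t" using ev_in_N ev_ex by blast
    obtain A where A: "A \<epsilon> \<A>" "side A (k t)" using in_\<A>[OF S_lam[OF t(1)]] by blast
    then show ?thesis
      using not_almost_subset_side[OF S_lam[OF t(1)] t(2) B mem_in[OF \<A>(1) A(1)] A(2)]
        elts_eq[OF \<A>(1)] by blast
  qed
  ultimately show ?thesis unfolding pi_P_point_def using \<A>(1) by blast
qed

lemma U_pi_pseudo: "pi_pseudo \<kappa> U lam"
proof -
  \<comment> \<open>\<open>pi_pseudo\<close> asserts that the successor cardinal exists in
    \<open>M\<close>; Hartogs' argument was made for this.\<close>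
  obtain \<nu> where "\<nu> \<in> M" "succ_card lam \<nu>" using succ_card_ex[OF lam_in lam_ord] by blast
  then have "\<exists>\<nu>\<in>M. succ_card lam \<nu> \<and> \<not> pi_P_point \<kappa> \<nu> U" using U_not_pi_P_point by blast
  then show ?thesis
    unfolding pi_pseudo_def is_min_def
    using lam_in lam_ord lam_cardinal U_pi_P_point elts_eq[OF lam_in] by (auto simp: ordinal_iff)
qed

lemma U_pi_u_com: "pi_u_com \<kappa> lam"
proof -
  have "\<not> pi_char \<kappa> V \<mu>" if V: "V \<in> M" "uniform_ultrafilter \<kappa> V" and \<mu>: "\<mu> \<epsilon> lam" for V \<mu>
  proof -
    have "ultrafilter \<kappa> V" using V(2) unfolding uniform_ultrafilter_def by blast
    then show ?thesis
      using no_small_pi_base[OF V(1) _ _ _ \<mu>] unfolding pi_char_def is_min_def by blast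
  qed
  then have "\<forall>\<mu>\<in>elts lam. \<not> (\<exists>V\<in>M. uniform_ultrafilter \<kappa> V \<and> complete_ultrafilter \<kappa> V \<and> pi_char \<kappa> V \<mu>)"
    using elts_eq[OF lam_in] by blast
  moreover have "\<exists>V\<in>M. uniform_ultrafilter \<kappa> V \<and> complete_ultrafilter \<kappa> V \<and> pi_char \<kappa> V lam"
    using U_in U_uniform U_complete U_pi_char by blast
  moreover have "ordinal lam" using lam_in lam_ord by (simp add: ordinal_iff)
  ultimately show ?thesis unfolding pi_u_com_def is_min_def using lam_in by blast
qed

end

theorem theorem2p32:
  fixes E :: "'v \<Rightarrow> 'v \<Rightarrow> bool"
    and M :: "'v set"
    and \<kappa> lam :: 'v
    and N :: "'v \<Rightarrow> 'v set"
    and \<U> k :: "'v \<Rightarrow> 'v"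
  assumes V_wellfounded: "wfP E"
    and V_extensional: "\<And>x y. (\<And>z. E z x \<longleftrightarrow> E z y) \<Longrightarrow> x = y"
    and M_model: "eps_structure.transitive_model E M"
    and \<kappa>: "\<kappa> \<in> M" "eps_structure.regular E M \<kappa>" "eps_structure.uncountable E M \<kappa>"
    and lam: "lam \<in> M" "eps_structure.regular E M lam" "eps_structure.uncountable E M lam"
    and \<kappa>_less_lam: "E \<kappa> lam"
    and N_model: "\<And>i. E i lam \<Longrightarrow> eps_structure.transitive_model E (N i) \<and> N i \<subseteq> M"
    and \<U>_in_M: "eps_structure.sequence_in E M lam \<U>"
    and k_in_M: "eps_structure.sequence_in E M lam k"
    and c1: "\<And>i j. E i lam \<Longrightarrow> E j lam \<Longrightarrow> E i j \<Longrightarrow> N i \<subseteq> N j"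
    and c2: "\<And>i. E i lam \<Longrightarrow> \<U> i \<in> N i \<and> eps_structure.normal_ultrafilter E (N i) \<kappa> (\<U> i)"
    and c3: "\<And>i. E i lam \<Longrightarrow> k i \<in> eps_structure.full_subsets E M \<kappa>"
            "\<And>i X. E i lam \<Longrightarrow> E X (\<U> i) \<Longrightarrow> eps_structure.almost_subset E M \<kappa> (k i) X"
            "\<And>i j. E i lam \<Longrightarrow> E j i \<Longrightarrow> k j \<in> N i"
    and c4: "eps_structure.subsets E M \<kappa> =
               (\<Union>i\<in>{i. E i lam}. eps_structure.subsets E (N i) \<kappa>)"
    and c5: "\<exists>S\<in>M. (\<forall>s. E s S \<longrightarrow> E s lam) \<and>
               (\<forall>\<alpha>. E \<alpha> lam \<longrightarrow> (\<exists>s. E s S \<and> E \<alpha> s)) \<and>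
               (\<forall>i j. E i S \<and> E j S \<and> E i j \<longrightarrow> (\<forall>X. E X (\<U> i) \<longrightarrow> E X (\<U> j)))"
  shows "(\<exists>U\<in>M. eps_structure.normal_ultrafilter E M \<kappa> U \<and>
                 eps_structure.simple_pi_P_point E M \<kappa> lam U) \<and>
         eps_structure.pi_u_com E M \<kappa> lam"
proof -
  obtain S where S: "S \<in> M" "\<forall>s. E s S \<longrightarrow> E s lam" "\<forall>\<alpha>. E \<alpha> lam \<longrightarrow> (\<exists>s. E s S \<and> E \<alpha> s)"
    "\<forall>i j. E i S \<and> E j S \<and> E i j \<longrightarrow> (\<forall>X. E X (\<U> i) \<longrightarrow> E X (\<U> j))"
    using c5 by blast
  interpret M: zfc_model E M
    by (intro zfc_model.intro eps_universe.intro zfc_model_axioms.intro V_wellfounded M_model)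
      (rule V_extensional)
  interpret measure_tower E M \<kappa> lam S N \<U> k
  proof (intro measure_tower.intro M.zfc_model_axioms measure_tower_axioms.intro)
    show "N i \<subseteq> N j" if "E i lam" "E j lam" "E i j" for i j using that by (rule c1)
    show "M.almost_subset \<kappa> (k i) X" if "E i lam" "E X (\<U> i)" for i X using that by (rule c3(2))
    show "k j \<in> N i" if "E i lam" "E j i" for i j using that by (rule c3(3))
    show "E X (\<U> j)" if "E i S" "E j S" "E i j" "E X (\<U> i)" for i j X using that S(4) by blast
    show "\<exists>s. E s S \<and> E a s" if "E a lam" for a using that S(3) by blast
    show "E s lam" if "E s S" for s using that S(2) by blast
    show "M.subsets \<kappa> = (\<Union>i\<in>{i. E i lam}. eps_structure.subsets E (N i) \<kappa>)" by (rule c4)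
  qed (use \<kappa>(1,2) lam(1,2) N_model \<U>_in_M k_in_M c2 c3(1) S(1) in simp_all)
  show ?thesis
    using U_in U_normal U_uniform U_pi_pseudo U_pi_char U_pi_u_com
    unfolding M.simple_pi_P_point_def by blast
qed

end
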